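(* Let $n\ge 2$ be an integer, $\rho\in\{0,\dots,n-1\}$, $\lambda>0$, and let $\varphi=\frac{2\rho}{n-1}\left(1-\frac{\rho+1}{2n}\right)$. Consider the seriation model with uniformly random permutation described in the context. Let $D\in\mathbb{N}$ and suppose that $n\geq2(2D+2)^2$ and $$\zeta:=2^{12}\lambda^2(D+1)^{42}\max\left(1,\frac{4\rho^2}{n}\right)<1 .$$ Then $$MMSE_{\leq D}\ \geq\ \lambda^2\,\frac{n-1}{n}\left[\varphi(1-\varphi)-2^{18}\,\frac{\rho^2}{(n-1)^2}\,(D+1)^{44}\,\frac{\max(\zeta,1/n)}{1-\max(\zeta,1/n)}\right].$$
   Context: Model. $\pi^*$ is a uniformly random permutation of $[n]=\{1,\dots,n\}$. The signal matrix $X\in\mathbb{R}^{n\times n}$ has entries $X_{ij}=\lambda\,\mathbf{1}\{|\pi^*(i)-\pi^*(j)|\leq\rho\}$. One observes $Y=X+E$, where $E\in\mathbb{R}^{n\times n}$ is independent of $\pi^*$ and has i.i.d. $\mathcal{N}(0,1)$ entries. For $i\ne j$, $\varphi$ is the probability that $|\pi^*(i)-\pi^*(j)|\le\rho$. Low-degree risk. $$MMSE_{\leq D}:=\inf_{\hat X}\ \frac{1}{n^2}\,\mathbb{E}\left[\|\hat X-X\|_F^2\right],$$ where the infimum is over all matrices $\hat X=\hat X(Y)\in\mathbb{R}^{n\times n}$ each of whose entries is a real multivariate polynomial in the entries of $Y$ of degree at most $D$, and $\|\cdot\|_F$ is the Frobenius norm. *)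

theory Defs
  imports "HOL-Probability.Probability" "HOL-Library.Poly_Mapping"
begin

text \<open>
  Matrices in \<open>\<real>\<^sup>n\<^sup>\<times>\<^sup>n\<close> are functions on index pairs, only ever used on \<open>idx n\<close>.
  A real multivariate polynomial in variables of type \<open>'v\<close> is a finitely supported
  map from monomials (exponent vectors, \<open>'v \<Rightarrow>\<^sub>0 nat\<close>) to real coefficients.
\<close>

definition idx :: "nat \<Rightarrow> (nat \<times> nat) set" where
  "idx n = {1..n} \<times> {1..n}"

type_synonym 'v real_mpoly = "('v \<Rightarrow>\<^sub>0 nat) \<Rightarrow>\<^sub>0 real"

definition monom_degree :: "('v \<Rightarrow>\<^sub>0 nat) \<Rightarrow> nat" where
  "monom_degree m = (\<Sum>v\<in>Poly_Mapping.keys m. Poly_Mapping.lookup m v)"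

definition eval_mpoly :: "'v real_mpoly \<Rightarrow> ('v \<Rightarrow> real) \<Rightarrow> real" where
  "eval_mpoly p y =
     (\<Sum>m\<in>Poly_Mapping.keys p. Poly_Mapping.lookup p m *
        (\<Prod>v\<in>Poly_Mapping.keys m. y v ^ Poly_Mapping.lookup m v))"

definition mpolys_le :: "nat \<Rightarrow> 'v set \<Rightarrow> 'v real_mpoly set" where
  "mpolys_le D V =
     {p. \<forall>m\<in>Poly_Mapping.keys p. Poly_Mapping.keys m \<subseteq> V \<and> monom_degree m \<le> D}"

definition frobenius_norm :: "nat \<Rightarrow> (nat \<times> nat \<Rightarrow> real) \<Rightarrow> real" where
  "frobenius_norm n A = L2_set A (idx n)"

text \<open>
  The canonical joint law of the pair (latent permutation, noise matrix): the product
  measure makes the two components independent, with independent noise entries.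
\<close>

definition seriation_space :: "nat \<Rightarrow> ((nat \<Rightarrow> nat) \<times> (nat \<times> nat \<Rightarrow> real)) measure" where
  "seriation_space n =
     measure_pmf (pmf_of_set {p. p permutes {1..n}}) \<Otimes>\<^sub>M
     PiM (idx n) (\<lambda>_. density lborel std_normal_density)"

definition signal :: "nat \<Rightarrow> real \<Rightarrow> (nat \<Rightarrow> nat) \<Rightarrow> nat \<times> nat \<Rightarrow> real" where
  "signal \<rho> lam p =
     (\<lambda>(i, j). lam * (if \<bar>int (p i) - int (p j)\<bar> \<le> int \<rho> then 1 else 0))"

definition observation ::
    "nat \<Rightarrow> real \<Rightarrow> (nat \<Rightarrow> nat) \<times> (nat \<times> nat \<Rightarrow> real) \<Rightarrow> nat \<times> nat \<Rightarrow> real" where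
  "observation \<rho> lam = (\<lambda>(p, E) k. signal \<rho> lam p k + E k)"

definition seriation_risk ::
    "nat \<Rightarrow> nat \<Rightarrow> real \<Rightarrow> (nat \<times> nat \<Rightarrow> (nat \<times> nat) real_mpoly) \<Rightarrow> real" where
  "seriation_risk n \<rho> lam F =
     1 / (real n)\<^sup>2 *
       (\<integral>\<omega>. (frobenius_norm n
              (\<lambda>k. eval_mpoly (F k) (observation \<rho> lam \<omega>) - signal \<rho> lam (fst \<omega>) k))\<^sup>2
          \<partial>seriation_space n)"

text \<open>
  The infimum is over a nonempty set of nonnegative reals. No integrability side condition
  is needed, since polynomials in bounded and Gaussian variables have all moments.
\<close>

definition MMSE_le :: "nat \<Rightarrow> nat \<Rightarrow> nat \<Rightarrow> real \<Rightarrow> real" where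
  "MMSE_le D n \<rho> lam =
     (INF F \<in> {F. \<forall>k\<in>idx n. F k \<in> mpolys_le D (idx n)}. seriation_risk n \<rho> lam F)"

end

theory Submission
  imports Defs "HOL-Computational_Algebra.Polynomial"
begin

text \<open>
  A function \<open>W\<close> of the noise alone with \<open>E[W f(Y)] = E[x f(Y)]\<close> for every polynomial \<open>f\<close> of
  degree at most \<open>D\<close> certifies that the risk of estimating \<open>x\<close> is at least \<open>E[x^2] - E[W^2]\<close>.
  The Hermite coefficients of \<open>W\<close> are joint cumulants of \<open>x\<close> and entries of \<open>X\<close>. They are
  represented by \<open>N = D + 1\<close> independent copies of the permutation and a primitive \<open>N\<close>-th root
  of unity \<open>z\<close>: each entry is replaced by the sum of \<open>z^i X(w_i)\<close> over the copies \<open>w_i\<close>, while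
  \<open>x\<close> is evaluated at the copy \<open>w_0\<close>.

  Consider the graph formed by the entries of a multi-index and by the pair defining \<open>x\<close>.
  If the positions of a component not containing this pair differ, across all copies, from
  those of all other vertices, then the copies may be shifted cyclically on that component alone;
  this multiplies the integrand by a root of unity different from 1, so such configurations
  contribute nothing. In the others every further component collides with another one. At least
  half of these collisions can be exposed one after the other, each costing a factor of order \<open>1 / n\<close>, and
  every remaining edge of a spanning forest costs a factor of order \<open>\<rho> / n\<close>.
\<close>

section \<open>Twisted cumulants\<close>

text \<open>Positions in a random permutation are dependent, so the cumulant of a disconnected graph
  need not vanish. It is only small, and the smallness must survive a sum over all graphs. In the
  partition formula for cumulants the cancellation is spread over many signed terms; with roots of
  unity it is a symmetry of the integrand, exact as long as the shifted maps stay injective, so that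
  only collisions have to be counted. The balance is this: about n^(|V| - 2) vertex sets V contain
  the given pair, so a squared cumulant must be of order n^(2 - |V|), apart from the prefactor
  \<rho>^2 / n^2. Exposing half of the collisions is just enough, since each costs 1/n^2 after
  squaring, hence 1/n per further component. A squared forest edge costs \<rho>^2 / n^2, that is 1/n
  times the ratio \<rho>^2 / n that enters \<zeta>. What is left is a constant per unit of degree,
  and the sum over degrees is geometric. The zero multi-index contributes the squared mean \<phi>^2,
  which turns \<phi> into \<phi> (1 - \<phi>). The argument yields the powers 14 and 3 of D + 1; the
  bound with 42 and 44 follows by monotonicity.\<close>

lemma sum_PiE_insert:
  assumes "a \<notin> I"
  shows "(\<Sum>w\<in>PiE (insert a I) (\<lambda>_. P). f w) = (\<Sum>p\<in>P. \<Sum>w\<in>PiE I (\<lambda>_. P). f (w(a := p)))"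
proof -
  have "(\<Sum>w\<in>PiE (insert a I) (\<lambda>_. P). f w) =
      (\<Sum>y\<in>P \<times> PiE I (\<lambda>_. P). f ((\<lambda>(p, w). w(a := p)) y))"
    unfolding PiE_insert_eq using inj_combinator[OF assms, of "\<lambda>_. P"]
    by (subst sum.reindex) (auto simp: o_def)
  then show ?thesis
    by (simp add: sum.cartesian_product case_prod_unfold)
qed

text \<open>Rotating the copies permutes the range of summation and multiplies every linear form by
  \<open>z\<close>, so the sum equals itself times \<open>z\<close> to the power of its
  degree.\<close>

lemma twisted_moment_eq_0:
  fixes X :: "'p \<Rightarrow> 'v \<Rightarrow> complex"
  assumes N: "N \<ge> 1" and z: "z ^ N = 1" and zb: "z ^ (\<Sum>v\<in>A. b v) \<noteq> 1"
  shows "(\<Sum>w\<in>PiE {1..N} (\<lambda>_. P). \<Prod>v\<in>A. (\<Sum>i=1..N. z ^ i * X (w i) v) ^ b v) = 0"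
proof -
  \<comment> \<open>\<open>s\<close> rotates the copies 1 to \<open>N\<close>, with \<open>N\<close>
    going to 1, and \<open>t\<close> is its inverse; \<open>z ^ N = 1\<close> makes the wrap-around
    consistent.\<close>
  define s where "s i = (if i = N then 1 else Suc i)" for i
  define t where "t i = (if i = 1 then N else i - 1)" for i
  have s: "s i \<in> {1..N}" "t (s i) = i" if "i \<in> {1..N}" for i
    using that N by (auto simp: s_def t_def)
  have t: "t i \<in> {1..N}" "s (t i) = i" if "i \<in> {1..N}" for i
    using that N by (auto simp: s_def t_def)
  let ?O = "PiE {1..N} (\<lambda>_. P)"
  define F where "F w = (\<Prod>v\<in>A. (\<Sum>i=1..N. z ^ i * X (w i) v) ^ b v)" for w
  have z_s: "z ^ s i = z * z ^ i" for i
    using z by (simp add: s_def)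
  have F_shift: "F w = z ^ (\<Sum>v\<in>A. b v) * F (\<lambda>i\<in>{1..N}. w (s i))" for w
  proof -
    have "(\<Sum>i=1..N. z ^ i * X (w i) v) = z * (\<Sum>i=1..N. z ^ i * X (w (s i)) v)" for v
    proof -
      have "(\<Sum>i=1..N. z ^ i * X (w i) v) = (\<Sum>i=1..N. z ^ s i * X (w (s i)) v)"
        by (rule sum.reindex_bij_witness[of _ s t]) (use s t in auto)
      then show ?thesis
        by (simp add: z_s sum_distrib_left mult.assoc)
    qed
    then have "F w = (\<Prod>v\<in>A. z ^ b v * (\<Sum>i=1..N. z ^ i * X (w (s i)) v) ^ b v)"
      by (simp add: F_def power_mult_distrib)
    also have "\<dots> = z ^ (\<Sum>v\<in>A. b v) * F (\<lambda>i\<in>{1..N}. w (s i))"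
      by (simp add: F_def prod.distrib power_sum)
    finally show ?thesis .
  qed
  have "sum F ?O = (\<Sum>w\<in>?O. z ^ (\<Sum>v\<in>A. b v) * F (\<lambda>i\<in>{1..N}. w (s i)))"
    by (intro sum.cong refl F_shift)
  also have "\<dots> = (\<Sum>w\<in>?O. z ^ (\<Sum>v\<in>A. b v) * F w)"
  proof (rule sum.reindex_bij_witness[of _ "\<lambda>w. \<lambda>i\<in>{1..N}. w (t i)" "\<lambda>w. \<lambda>i\<in>{1..N}. w (s i)"])
    fix w assume w: "w \<in> ?O"
    show "(\<lambda>i\<in>{1..N}. (\<lambda>i\<in>{1..N}. w (s i)) (t i)) = w"
      "(\<lambda>i\<in>{1..N}. (\<lambda>i\<in>{1..N}. w (t i)) (s i)) = w"
      using w s t by (auto simp: fun_eq_iff PiE_iff extensional_def)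
    show "(\<lambda>i\<in>{1..N}. w (s i)) \<in> ?O" "(\<lambda>i\<in>{1..N}. w (t i)) \<in> ?O"
      using w s t by (auto simp: PiE_iff)
  qed simp
  finally have "(1 - z ^ (\<Sum>v\<in>A. b v)) * sum F ?O = 0"
    unfolding sum_distrib_left[symmetric] by (simp add: left_diff_distrib)
  with zb show ?thesis
    by (simp add: F_def)
qed

lemma prod_binomial:
  fixes x y :: "'v \<Rightarrow> 'a :: comm_ring_1"
  assumes "finite A"
  shows "(\<Prod>v\<in>A. (x v + y v) ^ a v) =
    (\<Sum>b\<in>PiE A (\<lambda>v. {..a v}). of_nat (\<Prod>v\<in>A. a v choose b v) *
       ((\<Prod>v\<in>A. x v ^ b v) * (\<Prod>v\<in>A. y v ^ (a v - b v))))"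
  unfolding binomial_ring
  using assms by (subst prod_sum_PiE) (auto simp: prod.distrib of_nat_prod mult.assoc)

text \<open>Good's root-of-unity formula for the joint cumulant of \<open>x\<close> and the
  \<open>X v\<close> with multiplicities \<open>b\<close>, for \<open>p\<close> uniform in
  \<open>P\<close>. Evaluating \<open>x\<close> at copy 0 alone replaces the usual average over
  rotations and lets one \<open>N\<close> serve every weight of \<open>b\<close> below
  \<open>N\<close>.\<close>

definition twisted_cumulant ::
    "nat \<Rightarrow> complex \<Rightarrow> 'p set \<Rightarrow> ('p \<Rightarrow> complex) \<Rightarrow> ('p \<Rightarrow> 'v \<Rightarrow> complex) \<Rightarrow> 'v set \<Rightarrow> ('v \<Rightarrow> nat) \<Rightarrow> complex"
  where "twisted_cumulant N z P x X A b =
    (\<Sum>w\<in>PiE {..<N} (\<lambda>_. P). x (w 0) * (\<Prod>v\<in>A. (\<Sum>i<N. z ^ i * X (w i) v) ^ b v)) / of_nat (card P) ^ N"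

text \<open>This is the recursion that determines cumulants from moments. Both sides are one sum
  over \<open>N + 1\<close> copies. As \<open>z ^ N = 1\<close>, copy \<open>N\<close> acts as an
  independent copy of \<open>X\<close>, and a binomial expansion gives the left side. As
  \<open>z ^ 0 = 1\<close>, copy 0 carries \<open>X\<close> jointly with \<open>x\<close>, and the
  forms in the other copies have vanishing moments of degree 1 to \<open>N - 1\<close>, which gives
  the right side.\<close>

theorem twisted_cumulant_moments:
  fixes x :: "'p \<Rightarrow> complex" and X :: "'p \<Rightarrow> 'v \<Rightarrow> complex" and y :: "'v \<Rightarrow> complex"
  assumes A: "finite A" and P: "finite P" "P \<noteq> {}" and N: "N \<ge> 1" and z: "z ^ N = 1"
    and prim: "\<And>k. 0 < k \<Longrightarrow> k < N \<Longrightarrow> z ^ k \<noteq> 1"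
    and a: "(\<Sum>v\<in>A. a v) < N"
  shows "(\<Sum>b\<in>PiE A (\<lambda>v. {..a v}). of_nat (\<Prod>v\<in>A. a v choose b v) *
      twisted_cumulant N z P x X A b * (\<Sum>p\<in>P. \<Prod>v\<in>A. (y v + X p v) ^ (a v - b v))) =
    (\<Sum>p\<in>P. x p * (\<Prod>v\<in>A. (y v + X p v) ^ a v))"
proof -
  let ?c = "of_nat (card P) :: complex"
  have c: "?c \<noteq> 0"
    using P by simp
  define L where "L w v = (\<Sum>i<N. z ^ i * X (w i) v)" for w v
  define L' where "L' w v = (\<Sum>i=1..N. z ^ i * X (w i) v)" for w v
  let ?T = "\<Sum>w\<in>PiE {..N} (\<lambda>_. P). x (w 0) * (\<Prod>v\<in>A. ((\<Sum>i\<le>N. z ^ i * X (w i) v) + y v) ^ a v)"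
  have L_cong: "L (w(N := p)) = L w" for w p
    unfolding L_def by (intro ext sum.cong) auto
  have L'_cong: "L' (w(0 := p)) = L' w" for w p
    unfolding L'_def by (intro ext sum.cong) auto
  have "?c ^ N * (\<Sum>b\<in>PiE A (\<lambda>v. {..a v}). of_nat (\<Prod>v\<in>A. a v choose b v) *
      twisted_cumulant N z P x X A b * (\<Sum>p\<in>P. \<Prod>v\<in>A. (y v + X p v) ^ (a v - b v)))
    = (\<Sum>b\<in>PiE A (\<lambda>v. {..a v}). of_nat (\<Prod>v\<in>A. a v choose b v) *
      (\<Sum>w\<in>PiE {..<N} (\<lambda>_. P). x (w 0) * (\<Prod>v\<in>A. L w v ^ b v)) *
       (\<Sum>p\<in>P. \<Prod>v\<in>A. (y v + X p v) ^ (a v - b v)))"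
    unfolding sum_distrib_left[of "?c ^ N"]
    by (intro sum.cong refl) (use c in \<open>simp add: twisted_cumulant_def L_def\<close>)
  also have "\<dots> = (\<Sum>b\<in>PiE A (\<lambda>v. {..a v}). \<Sum>p\<in>P. \<Sum>w\<in>PiE {..<N} (\<lambda>_. P).
      of_nat (\<Prod>v\<in>A. a v choose b v) * (x (w 0) * (\<Prod>v\<in>A. L w v ^ b v)) *
        (\<Prod>v\<in>A. (y v + X p v) ^ (a v - b v)))"
    by (simp only: sum_distrib_left sum_distrib_right)
  also have "\<dots> = (\<Sum>p\<in>P. \<Sum>w\<in>PiE {..<N} (\<lambda>_. P). \<Sum>b\<in>PiE A (\<lambda>v. {..a v}).
      of_nat (\<Prod>v\<in>A. a v choose b v) * (x (w 0) * (\<Prod>v\<in>A. L w v ^ b v)) *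
        (\<Prod>v\<in>A. (y v + X p v) ^ (a v - b v)))"
    by (subst sum.swap, intro sum.cong refl, rule sum.swap)
  also have "\<dots> = (\<Sum>p\<in>P. \<Sum>w\<in>PiE {..<N} (\<lambda>_. P).
      x (w 0) * (\<Prod>v\<in>A. (L w v + (y v + X p v)) ^ a v))"
    unfolding prod_binomial[OF A, of "L _" "\<lambda>v. y v + X _ v"] sum_distrib_left
    by (intro sum.cong refl) (simp only: mult_ac)
  also have "\<dots> = ?T"
  proof -
    have eq: "{..N} = insert N {..<N}" by auto
    have "?T = (\<Sum>p\<in>P. \<Sum>w\<in>PiE {..<N} (\<lambda>_. P).
       x ((w(N := p)) 0) * (\<Prod>v\<in>A. ((\<Sum>i\<le>N. z ^ i * X ((w(N := p)) i) v) + y v) ^ a v))"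
      by (subst eq, subst sum_PiE_insert) auto
    also have "\<dots> = (\<Sum>p\<in>P. \<Sum>w\<in>PiE {..<N} (\<lambda>_. P).
      x (w 0) * (\<Prod>v\<in>A. (L w v + (y v + X p v)) ^ a v))"
    proof -
      have "(\<Sum>i\<le>N. z ^ i * X ((w(N := p)) i) v) = L w v + X p v" for w p v
        using fun_cong[OF L_cong[of w p], of v] z
        unfolding L_def lessThan_Suc_atMost[symmetric] sum.lessThan_Suc by simp
      then show ?thesis
        using N by (simp add: add_ac)
    qed
    finally show ?thesis by simp
  qed
  \<comment> \<open>The same sum \<open>?T\<close> with copy 0 split off instead of copy
    \<open>N\<close>; the forms \<open>L'\<close> use copies 1 to \<open>N\<close>.\<close>
  also have "\<dots> = (\<Sum>p\<in>P. \<Sum>w\<in>PiE {1..N} (\<lambda>_. P).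
      x p * (\<Prod>v\<in>A. (L' w v + (y v + X p v)) ^ a v))"
  proof -
    have eq: "{..N} = insert 0 {1..N}" by auto
    have "?T = (\<Sum>p\<in>P. \<Sum>w\<in>PiE {1..N} (\<lambda>_. P).
       x ((w(0 := p)) 0) * (\<Prod>v\<in>A. ((\<Sum>i\<le>N. z ^ i * X ((w(0 := p)) i) v) + y v) ^ a v))"
      by (subst eq, subst sum_PiE_insert) auto
    also have "\<dots> = (\<Sum>p\<in>P. \<Sum>w\<in>PiE {1..N} (\<lambda>_. P).
      x p * (\<Prod>v\<in>A. (L' w v + (y v + X p v)) ^ a v))"
    proof -
      have "(\<Sum>i\<le>N. z ^ i * X ((w(0 := p)) i) v) = L' w v + X p v" for w p v
        using fun_cong[OF L'_cong[of w p], of v] unfolding L'_def eq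
        by (subst sum.insert) auto
      then show ?thesis
        by (simp add: add_ac)
    qed
    finally show ?thesis by simp
  qed
  also have "\<dots> = (\<Sum>p\<in>P. \<Sum>w\<in>PiE {1..N} (\<lambda>_. P). \<Sum>b\<in>PiE A (\<lambda>v. {..a v}).
      x p * of_nat (\<Prod>v\<in>A. a v choose b v) *
      (\<Prod>v\<in>A. (y v + X p v) ^ (a v - b v)) * (\<Prod>v\<in>A. L' w v ^ b v))"
    unfolding prod_binomial[OF A, of "L' _" "\<lambda>v. y v + X _ v"] sum_distrib_left
    by (intro sum.cong refl) (simp only: mult_ac)
  also have "\<dots> = (\<Sum>p\<in>P. \<Sum>b\<in>PiE A (\<lambda>v. {..a v}).
      x p * of_nat (\<Prod>v\<in>A. a v choose b v) *
      (\<Prod>v\<in>A. (y v + X p v) ^ (a v - b v)) * (\<Sum>w\<in>PiE {1..N} (\<lambda>_. P). \<Prod>v\<in>A. L' w v ^ b v))"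
    unfolding sum_distrib_left by (intro sum.cong refl, rule sum.swap)
  \<comment> \<open>A nonzero \<open>b\<close> below \<open>a\<close> has weight between 1 and
    \<open>N - 1\<close>, where the power of the primitive root \<open>z\<close> is not 1. Only the
    zero exponent survives.\<close>
  also have "\<dots> = (\<Sum>p\<in>P. \<Sum>b\<in>PiE A (\<lambda>v. {..a v}).
      if b = (\<lambda>v\<in>A. 0) then x p * (\<Prod>v\<in>A. (y v + X p v) ^ a v) * ?c ^ N else 0)"
  proof (intro sum.cong refl, goal_cases)
    case (1 p b)
    show ?case
    proof (cases "b = (\<lambda>v\<in>A. 0)")
      case True
      then show ?thesis
        using P by (simp add: card_PiE)
    next
      case False
      have "\<exists>v\<in>A. b v \<noteq> 0"
      proof (rule ccontr)
        assume "\<not> (\<exists>v\<in>A. b v \<noteq> 0)"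
        then have "b = (\<lambda>v\<in>A. 0)"
          using 1 by (intro ext) (auto simp: PiE_def extensional_def restrict_def)
        with False show False by simp
      qed
      then have "(\<Sum>v\<in>A. b v) > 0"
        using A by (metis gr0I sum_eq_0_iff)
      moreover have "(\<Sum>v\<in>A. b v) \<le> (\<Sum>v\<in>A. a v)"
        using 1 by (intro sum_mono) (auto simp: PiE_iff)
      ultimately have "z ^ (\<Sum>v\<in>A. b v) \<noteq> 1"
        using prim a by simp
      from twisted_moment_eq_0[OF N z this, where P = P and X = X] False show ?thesis
        by (simp add: L'_def)
    qed
  qed
  also have "\<dots> = ?c ^ N * (\<Sum>p\<in>P. x p * (\<Prod>v\<in>A. (y v + X p v) ^ a v))"
  proof -
    have "finite (PiE A (\<lambda>v. {..a v}))" "(\<lambda>v\<in>A. 0) \<in> PiE A (\<lambda>v. {..a v})"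
      using A by (auto intro: finite_PiE)
    then show ?thesis
      unfolding sum_distrib_left by (intro sum.cong refl) (simp add: mult_ac)
  qed
  finally show ?thesis
    using c by simp
qed

section \<open>Hermite polynomials and the dual certificate\<close>

abbreviation std_gauss :: "real measure" where
  "std_gauss \<equiv> density lborel std_normal_density"

definition gauss_mean :: "real poly \<Rightarrow> real" where
  "gauss_mean p = (\<integral>x. poly p x \<partial>std_gauss)"

lemma prob_space_std_gauss: "prob_space std_gauss"
  by (rule prob_space_normal_density) simp

lemma has_bochner_integral_gauss_power:
  "has_bochner_integral std_gauss (\<lambda>x. x ^ k)
     (if even k then fact k / (2 ^ (k div 2) * fact (k div 2)) else 0)"
proof -
  have "has_bochner_integral lborel (\<lambda>x. std_normal_density x * x ^ k)
     (if even k then fact k / (2 ^ (k div 2) * fact (k div 2)) else 0)"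
  proof (cases "even k")
    case True
    then show ?thesis using std_normal_moment_even[of "k div 2"] by simp
  next
    case False
    then show ?thesis using std_normal_moment_odd[of "k div 2"] by simp
  qed
  then show ?thesis
    by (intro has_bochner_integral_density) auto
qed

lemma integrable_gauss_poly [simp]: "integrable std_gauss (poly p)"
proof -
  have "integrable std_gauss (\<lambda>x. \<Sum>i\<le>degree p. coeff p i * x ^ i)"
    by (intro Bochner_Integration.integrable_sum integrable_mult_right)
      (use has_bochner_integral_gauss_power in \<open>auto simp: has_bochner_integral_iff\<close>)
  moreover have "(\<lambda>x. \<Sum>i\<le>degree p. coeff p i * x ^ i) = poly p"
    by (simp add: fun_eq_iff poly_altdef)
  ultimately show ?thesis
    by simp
qed

lemma gauss_mean_0 [simp]: "gauss_mean 0 = 0"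
  and gauss_mean_add: "gauss_mean (p + q) = gauss_mean p + gauss_mean q"
  and gauss_mean_diff: "gauss_mean (p - q) = gauss_mean p - gauss_mean q"
  and gauss_mean_smult: "gauss_mean (smult c p) = c * gauss_mean p"
  by (simp_all add: gauss_mean_def)

lemma gauss_mean_const [simp]: "gauss_mean [:c:] = c"
proof -
  interpret prob_space std_gauss by (rule prob_space_std_gauss)
  show ?thesis using prob_space by (simp add: gauss_mean_def)
qed

lemma gauss_mean_power:
  "gauss_mean (monom 1 k) = (if even k then fact k / (2 ^ (k div 2) * fact (k div 2)) else 0)"
  using has_bochner_integral_gauss_power[of k]
  by (auto simp: gauss_mean_def poly_monom has_bochner_integral_iff)

lemma gauss_mean_monom: "gauss_mean (monom c k) = c * gauss_mean (monom 1 k)"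
  by (simp flip: gauss_mean_smult add: smult_monom)

text \<open>Gaussian integration by parts. Both sides are linear, and on monomials it is the
  recursion between moments two orders apart, read off from the explicit formula.\<close>

lemma gauss_mean_stein: "gauss_mean (pCons 0 p) = gauss_mean (pderiv p)"
proof -
  have monom: "gauss_mean (monom 1 (Suc k)) = of_nat k * gauss_mean (monom 1 (k - 1))" for k
  proof (cases "k = 0 \<or> even k")
    case True
    then show ?thesis by (auto simp: gauss_mean_power)
  next
    case False
    then obtain j where k: "k = Suc (2 * j)"
      by (metis oddE Suc_eq_plus1)
    have "fact (2 * Suc j) / (2 ^ Suc j * fact (Suc j)) =
        ((2 * real j + 2) * ((2 * real j + 1) * fact (2 * j))) / ((2 * real j + 2) * (2 ^ j * fact j) :: real)"
      by (simp add: algebra_simps)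
    also have "\<dots> = (2 * real j + 1) * (fact (2 * j) / (2 ^ j * fact j))"
      by (subst mult_divide_mult_cancel_left) (auto simp: add_eq_0_iff)
    finally show ?thesis
      using k by (simp add: gauss_mean_power add_ac)
  qed
  have "gauss_mean (pCons 0 (\<Sum>i\<le>n. monom (c i) i)) = gauss_mean (pderiv (\<Sum>i\<le>n. monom (c i) i))" for n c
  proof (induction n)
    case 0
    have "gauss_mean (pCons 0 [:c 0:]) = c 0 * gauss_mean (monom 1 1)"
      by (simp flip: gauss_mean_smult add: smult_monom monom_Suc monom_0)
    then show ?case by (simp add: gauss_mean_power monom_0 pderiv_pCons)
  next
    case (Suc n)
    have "gauss_mean (pCons 0 (monom (c (Suc n)) (Suc n))) = c (Suc n) * gauss_mean (monom 1 (Suc (Suc n)))"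
      by (simp flip: gauss_mean_smult add: smult_monom monom_Suc)
    also have "\<dots> = gauss_mean (pderiv (monom (c (Suc n)) (Suc n)))"
      unfolding monom by (simp add: pderiv_monom gauss_mean_monom[of "_ * _"])
    finally have *: "gauss_mean (pCons 0 (monom (c (Suc n)) (Suc n))) = gauss_mean (pderiv (monom (c (Suc n)) (Suc n)))" .
    have pCons_add: "pCons 0 (p + q) = pCons 0 p + pCons 0 q" for p q :: "real poly"
      by simp
    then show ?case
      using Suc * by (simp add: gauss_mean_add pderiv_add pCons_add del: add_pCons)
  qed
  from this[of "coeff p" "degree p"] show ?thesis
    by (simp add: poly_as_sum_of_monoms)
qed

text \<open>The probabilists' (monic) Hermite polynomials. The recursion applies x - d/dx, the
  adjoint of differentiation under the Gaussian measure.\<close>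

fun hermite :: "nat \<Rightarrow> real poly" where
  "hermite 0 = 1"
| "hermite (Suc b) = pCons 0 (hermite b) - pderiv (hermite b)"

text \<open>Each step of the recursion of \<open>hermite\<close> moves one derivative over to
  \<open>p\<close>.\<close>

lemma gauss_mean_mult_hermite: "gauss_mean (p * hermite b) = gauss_mean ((pderiv ^^ b) p)"
proof (induction b arbitrary: p)
  case (Suc b)
  have "gauss_mean (p * hermite (Suc b)) = gauss_mean (pCons 0 (p * hermite b)) - gauss_mean (p * pderiv (hermite b))"
    by (simp add: gauss_mean_diff[symmetric] algebra_simps)
  also have "\<dots> = gauss_mean (pderiv p * hermite b)"
    by (simp add: gauss_mean_stein pderiv_mult gauss_mean_add mult.commute)
  finally show ?case
    by (simp add: Suc funpow_swap1)
qed simp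

lemma coeff_hermite_ge: "k \<ge> b \<Longrightarrow> coeff (hermite b) k = (if k = b then 1 else 0)"
proof (induction b arbitrary: k)
  case (Suc b)
  then obtain j where k: "k = Suc j" "j \<ge> b"
    by (cases k) auto
  then show ?case
    using Suc.IH[of j] Suc.IH[of "Suc k"] by (simp add: coeff_pderiv)
qed (auto simp: coeff_1)

lemma higher_pderiv_hermite:
  assumes "a \<le> b"
  shows "(pderiv ^^ b) (hermite a) = (if a = b then [:fact b:] else 0)"
proof (rule poly_eqI)
  fix k
  show "coeff ((pderiv ^^ b) (hermite a)) k = coeff (if a = b then [:fact b:] else 0) k"
    using assms coeff_hermite_ge[of a "b + k"] coeff_hermite_ge[of a "k + b"]
    by (auto simp: coeff_higher_pderiv pochhammer_fact[symmetric] coeff_pCons split: nat.splits)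
qed

lemma gauss_mean_hermite_hermite:
  "gauss_mean (hermite a * hermite b) = (if a = b then fact a else 0)"
proof (cases "a \<le> b")
  case True
  then show ?thesis by (simp add: gauss_mean_mult_hermite higher_pderiv_hermite)
next
  case False
  then show ?thesis
    by (simp add: mult.commute[of "hermite a"] gauss_mean_mult_hermite higher_pderiv_hermite)
qed

text \<open>Differentiating a power \<open>b\<close> times leaves a falling factorial and the
  exponent \<open>a - b\<close>. Testing a shifted monomial against a Hermite polynomial thus lowers
  its exponent, which is the source of the binomial sums matched by
  \<open>twisted_cumulant_moments\<close>.\<close>

lemma gauss_mean_power_hermite:
  "gauss_mean ([:m, 1:] ^ a * hermite b) = real (a choose b) * fact b * gauss_mean ([:m, 1:] ^ (a - b))"
proof -
  have "(pderiv ^^ b) ([:m, 1:] ^ a) = smult (real (a choose b) * fact b) ([:m, 1:] ^ (a - b))"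
  proof (induction b)
    case (Suc b)
    have "(pderiv ^^ Suc b) ([:m, 1:] ^ a) = smult (real (a choose b) * fact b * real (a - b)) ([:m, 1:] ^ (a - Suc b))"
      by (simp add: Suc pderiv_smult pderiv_power pderiv_pCons)
    moreover have "real (a choose b) * fact b * real (a - b) = real (a choose Suc b) * fact (Suc b)"
    proof -
      have "real (a - b) * real (a choose b) = real (Suc b) * real (a choose Suc b)"
        unfolding of_nat_mult[symmetric] binomial_absorb_comp binomial_absorption ..
      then show ?thesis by (simp only: fact_Suc of_nat_mult mult_ac)
    qed
    ultimately show ?case by metis
  qed simp
  then show ?thesis
    by (simp add: gauss_mean_mult_hermite gauss_mean_smult)
qed

section \<open>Polynomials in several independent Gaussian variables\<close>

text \<open>The generators are products of univariate polynomials because these are integrable by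
  independence. Sums and multiples then inherit integrability, and closure under products follows
  from that of the generators.\<close>

inductive polyfun :: "'v set \<Rightarrow> (('v \<Rightarrow> real) \<Rightarrow> real) \<Rightarrow> bool" for A where
  prod: "polyfun A (\<lambda>z. \<Prod>v\<in>A. poly (g v) (z v))"
| add: "polyfun A f \<Longrightarrow> polyfun A g \<Longrightarrow> polyfun A (\<lambda>z. f z + g z)"
| scale: "polyfun A f \<Longrightarrow> polyfun A (\<lambda>z. c * f z)"

lemma polyfun_const: "polyfun A (\<lambda>z. c)"
  using polyfun.scale[OF polyfun.prod[of A "\<lambda>_. 1"], of c] by simp

lemma polyfun_sum: "(\<And>i. i \<in> I \<Longrightarrow> polyfun A (f i)) \<Longrightarrow> polyfun A (\<lambda>z. \<Sum>i\<in>I. f i z)"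
  by (induction I rule: infinite_finite_induct) (auto intro: polyfun_const polyfun.add)

lemma polyfun_diff: "polyfun A f \<Longrightarrow> polyfun A g \<Longrightarrow> polyfun A (\<lambda>z. f z - g z)"
  using polyfun.add[OF _ polyfun.scale[of A g "-1"], of f] by simp

lemma polyfun_mult:
  assumes "polyfun A f" "polyfun A g"
  shows "polyfun A (\<lambda>z. f z * g z)"
  using assms(1)
proof induction
  case (prod p)
  from assms(2) show ?case
  proof induction
    case (prod q)
    have "polyfun A (\<lambda>z. \<Prod>v\<in>A. poly (p v * q v) (z v))"
      by (rule polyfun.prod)
    then show ?case by (simp add: prod.distrib)
  next
    case (add f g)
    then show ?case by (simp add: distrib_left polyfun.add)
  next
    case (scale f c)
    from polyfun.scale[OF scale.IH, of c] show ?case by (simp add: mult_ac)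
  qed
next
  case (add f g)
  then show ?case by (simp add: distrib_right polyfun.add)
next
  case (scale f c)
  from polyfun.scale[OF scale.IH, of c] show ?case by (simp add: mult_ac)
qed

lemma
  assumes A: "finite A"
  shows integrable_gauss_prod: "integrable (PiM A (\<lambda>_. std_gauss)) (\<lambda>z. \<Prod>v\<in>A. poly (g v) (z v))"
    and integral_gauss_prod: "(\<integral>z. (\<Prod>v\<in>A. poly (g v) (z v)) \<partial>PiM A (\<lambda>_. std_gauss)) = (\<Prod>v\<in>A. gauss_mean (g v))"
proof -
  interpret prob_space std_gauss by (rule prob_space_std_gauss)
  interpret product_sigma_finite "\<lambda>_. std_gauss" by unfold_locales
  show "integrable (PiM A (\<lambda>_. std_gauss)) (\<lambda>z. \<Prod>v\<in>A. poly (g v) (z v))"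
    using A by (rule product_integrable_prod) simp
  show "(\<integral>z. (\<Prod>v\<in>A. poly (g v) (z v)) \<partial>PiM A (\<lambda>_. std_gauss)) = (\<Prod>v\<in>A. gauss_mean (g v))"
    unfolding gauss_mean_def using A by (rule product_integral_prod) simp
qed

lemma integrable_polyfun:
  assumes "finite A" "polyfun A f"
  shows "integrable (PiM A (\<lambda>_. std_gauss)) f"
  using assms(2) by induction (auto intro: integrable_gauss_prod[OF assms(1)])

definition hermite_multi :: "'v set \<Rightarrow> ('v \<Rightarrow> nat) \<Rightarrow> ('v \<Rightarrow> real) \<Rightarrow> real" where
  "hermite_multi A b z = (\<Prod>v\<in>A. poly (hermite (b v)) (z v))"

text \<open>Exponent vectors are extensional, so that each occurs once and the set is finite for
  finite \<open>A\<close>.\<close>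

definition multi_indices :: "nat \<Rightarrow> 'v set \<Rightarrow> ('v \<Rightarrow> nat) set" where
  "multi_indices D A = {b \<in> PiE A (\<lambda>_. UNIV). (\<Sum>v\<in>A. b v) \<le> D}"

lemma finite_multi_indices:
  assumes "finite A"
  shows "finite (multi_indices D A)"
proof (rule finite_subset)
  show "multi_indices D A \<subseteq> PiE A (\<lambda>_. {..D})"
  proof
    fix b assume b: "b \<in> multi_indices D A"
    have "b v \<le> D" if "v \<in> A" for v
      using member_le_sum[of v A b] that assms b by (auto simp: multi_indices_def)
    with b show "b \<in> PiE A (\<lambda>_. {..D})"
      by (auto simp: multi_indices_def PiE_iff)
  qed
  show "finite (PiE A (\<lambda>_. {..D}))"
    using assms by (intro finite_PiE) auto
qed

text \<open>Parseval's identity: distinct Hermite products are orthogonal, and the factorials are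
  their squared norms.\<close>

lemma integral_hermite_multi_square:
  fixes c :: "('v \<Rightarrow> nat) \<Rightarrow> real"
  assumes A: "finite A"
  shows "(\<integral>z. (\<Sum>b\<in>multi_indices D A. c b * hermite_multi A b z)\<^sup>2 \<partial>PiM A (\<lambda>_. std_gauss)) =
    (\<Sum>b\<in>multi_indices D A. (c b)\<^sup>2 * (\<Prod>v\<in>A. fact (b v)))"
proof -
  let ?J = "multi_indices D A" and ?M = "PiM A (\<lambda>_. std_gauss)"
  have J: "finite ?J" using A by (rule finite_multi_indices)
  have prod: "hermite_multi A b z * hermite_multi A b' z = (\<Prod>v\<in>A. poly (hermite (b v) * hermite (b' v)) (z v))" for b b' z
    by (simp add: hermite_multi_def prod.distrib)
  have int: "integrable ?M (\<lambda>z. hermite_multi A b z * hermite_multi A b' z)" for b b'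
    unfolding prod by (rule integrable_gauss_prod[OF A])
  have orth: "(\<integral>z. hermite_multi A b z * hermite_multi A b' z \<partial>?M) = (if b = b' then \<Prod>v\<in>A. fact (b v) else 0)"
    if "b \<in> ?J" "b' \<in> ?J" for b b'
  proof -
    have "(\<integral>z. hermite_multi A b z * hermite_multi A b' z \<partial>?M) = (\<Prod>v\<in>A. if b v = b' v then fact (b v) else 0)"
      unfolding prod integral_gauss_prod[OF A] gauss_mean_hermite_hermite ..
    also have "\<dots> = (if b = b' then \<Prod>v\<in>A. fact (b v) else 0)"
    proof (cases "b = b'")
      case False
      with that obtain v where "v \<in> A" "b v \<noteq> b' v"
        by (metis (mono_tags, lifting) PiE_ext mem_Collect_eq multi_indices_def)
      then have "\<exists>v\<in>A. (if b v = b' v then fact (b v) else 0 :: real) = 0" by auto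
      with False A show ?thesis by (simp only: prod_zero if_False)
    qed simp
    finally show ?thesis .
  qed
  have "(\<integral>z. (\<Sum>b\<in>?J. c b * hermite_multi A b z)\<^sup>2 \<partial>?M) =
      (\<integral>z. (\<Sum>b\<in>?J. \<Sum>b'\<in>?J. c b * c b' * (hermite_multi A b z * hermite_multi A b' z)) \<partial>?M)"
    by (simp add: power2_eq_square sum_product mult_ac)
  also have "\<dots> = (\<Sum>b\<in>?J. \<Sum>b'\<in>?J. c b * c b' * (\<integral>z. hermite_multi A b z * hermite_multi A b' z \<partial>?M))"
    by (simp add: int)
  also have "\<dots> = (\<Sum>b\<in>?J. \<Sum>b'\<in>?J. if b = b' then c b * c b' * (\<Prod>v\<in>A. fact (b v)) else 0)"
    by (intro sum.cong refl) (simp add: orth)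
  also have "\<dots> = (\<Sum>b\<in>?J. (c b)\<^sup>2 * (\<Prod>v\<in>A. fact (b v)))"
    using J by (simp add: power2_eq_square)
  finally show ?thesis .
qed

lemma integral_shifted_power_hermite_multi:
  assumes A: "finite A"
  shows "(\<integral>z. (\<Prod>v\<in>A. (m v + z v) ^ a v) * hermite_multi A b z \<partial>PiM A (\<lambda>_. std_gauss)) =
    real (\<Prod>v\<in>A. a v choose b v) * (\<Prod>v\<in>A. fact (b v)) *
      (\<integral>z. (\<Prod>v\<in>A. (m v + z v) ^ (a v - b v)) \<partial>PiM A (\<lambda>_. std_gauss))"
proof -
  let ?M = "PiM A (\<lambda>_. std_gauss)"
  have "(\<integral>z. (\<Prod>v\<in>A. (m v + z v) ^ a v) * hermite_multi A b z \<partial>?M) =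
      (\<integral>z. (\<Prod>v\<in>A. poly ([:m v, 1:] ^ a v * hermite (b v)) (z v)) \<partial>?M)"
    by (simp add: hermite_multi_def prod.distrib)
  also have "\<dots> = real (\<Prod>v\<in>A. a v choose b v) * (\<Prod>v\<in>A. fact (b v)) *
      (\<Prod>v\<in>A. gauss_mean ([:m v, 1:] ^ (a v - b v)))"
    unfolding integral_gauss_prod[OF A] gauss_mean_power_hermite by (simp add: prod.distrib)
  also have "(\<Prod>v\<in>A. gauss_mean ([:m v, 1:] ^ (a v - b v))) = (\<integral>z. (\<Prod>v\<in>A. (m v + z v) ^ (a v - b v)) \<partial>?M)"
    unfolding integral_gauss_prod[OF A, symmetric] by simp
  finally show ?thesis .
qed

lemma polyfun_shifted_power: "polyfun A (\<lambda>z. \<Prod>v\<in>A. (m v + z v) ^ a v)"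
  using polyfun.prod[of A "\<lambda>v. [:m v, 1:] ^ a v"] by simp

lemma polyfun_hermite_multi: "polyfun A (hermite_multi A b)"
  using polyfun.prod[of A "\<lambda>v. hermite (b v)"] by (simp add: hermite_multi_def[abs_def])

text \<open>
  \<open>c b\<close> are the unnormalised Hermite coefficients of a function of the noise alone that has
  the same inner product as \<open>x\<close> with every monomial of degree at most \<open>D\<close> in the observation.
\<close>

lemma low_degree_risk_lower_bound:
  fixes P :: "'p set" and X :: "'p \<Rightarrow> 'v \<Rightarrow> real" and x :: "'p \<Rightarrow> real" and c :: "('v \<Rightarrow> nat) \<Rightarrow> real"
    and C :: "'i \<Rightarrow> real" and a :: "'i \<Rightarrow> 'v \<Rightarrow> nat"
  assumes A: "finite A" and P: "finite P" and K: "finite K"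
    and moments: "\<And>a y. (\<Sum>v\<in>A. a v) \<le> D \<Longrightarrow>
      (\<Sum>b\<in>PiE A (\<lambda>v. {..a v}). real (\<Prod>v\<in>A. a v choose b v) * c b *
         (\<Sum>p\<in>P. \<Prod>v\<in>A. (X p v + y v) ^ (a v - b v))) =
      (\<Sum>p\<in>P. x p * (\<Prod>v\<in>A. (X p v + y v) ^ a v))"
    and deg: "\<And>k. k \<in> K \<Longrightarrow> (\<Sum>v\<in>A. a k v) \<le> D"
  defines "f \<equiv> \<lambda>p z. \<Sum>k\<in>K. C k * (\<Prod>v\<in>A. (X p v + z v) ^ a k v)"
  shows "(\<Sum>p\<in>P. \<integral>z. (f p z - x p)\<^sup>2 \<partial>PiM A (\<lambda>_. std_gauss)) \<ge>
    (\<Sum>p\<in>P. (x p)\<^sup>2) - real (card P) * (\<Sum>b\<in>multi_indices D A. (c b)\<^sup>2 / (\<Prod>v\<in>A. fact (b v)))"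
proof -
  let ?J = "multi_indices D A" and ?M = "PiM A (\<lambda>_. std_gauss)"
  let ?fact = "\<lambda>b. (\<Prod>v\<in>A. fact (b v)) :: real"
  interpret MP: prob_space ?M
    by (rule prob_space_PiM) (rule prob_space_std_gauss)
  have J: "finite ?J" using A by (rule finite_multi_indices)
  have fact_nz: "?fact b \<noteq> 0" for b
    using A by simp
  \<comment> \<open>Dividing by the squared norm of \<open>hermite_multi A b\<close> makes
    \<open>c b\<close> the inner product of \<open>W\<close> with that Hermite product.\<close>
  define W where "W z = (\<Sum>b\<in>?J. c b / ?fact b * hermite_multi A b z)" for z
  have W: "polyfun A W"
    unfolding W_def[abs_def] by (intro polyfun_sum polyfun.scale polyfun_hermite_multi)
  have f: "polyfun A (f p)" for p
    unfolding f_def by (intro polyfun_sum polyfun.scale polyfun_shifted_power)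
  note int = integrable_polyfun[OF A]
  have W_mono: "(\<Sum>p\<in>P. \<integral>z. (\<Prod>v\<in>A. (X p v + z v) ^ a k v) * W z \<partial>?M) =
      (\<Sum>p\<in>P. x p * (\<integral>z. (\<Prod>v\<in>A. (X p v + z v) ^ a k v) \<partial>?M))" if k: "k \<in> K" for k
  proof -
    let ?B = "PiE A (\<lambda>v. {..a k v})"
    have B: "?B \<subseteq> ?J"
    proof
      fix b assume b: "b \<in> ?B"
      then have "(\<Sum>v\<in>A. b v) \<le> (\<Sum>v\<in>A. a k v)"
        by (intro sum_mono) (auto simp: PiE_iff)
      with b deg[OF k] show "b \<in> ?J"
        by (auto simp: multi_indices_def PiE_iff)
    qed
    \<comment> \<open>Indices not below \<open>a k\<close> contribute nothing, so the sum over all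
      weights up to \<open>D\<close> shrinks to the range that occurs in
      \<open>moments\<close>.\<close>
    have zero: "(\<Prod>v\<in>A. a k v choose b v) = 0" if "b \<in> ?J - ?B" for b
    proof -
      from that obtain v where "v \<in> A" "b v > a k v"
        by (auto simp: multi_indices_def PiE_iff not_le)
      then show ?thesis using A by (auto intro!: prod_zero bexI[of _ v])
    qed
    have "(\<Sum>p\<in>P. \<integral>z. (\<Prod>v\<in>A. (X p v + z v) ^ a k v) * W z \<partial>?M) =
      (\<Sum>p\<in>P. \<integral>z. (\<Sum>b\<in>?J. c b / ?fact b * ((\<Prod>v\<in>A. (X p v + z v) ^ a k v) * hermite_multi A b z)) \<partial>?M)"
      by (simp add: W_def sum_distrib_left mult_ac)
    also have "\<dots> = (\<Sum>p\<in>P. \<Sum>b\<in>?J. c b / ?fact b * (\<integral>z. (\<Prod>v\<in>A. (X p v + z v) ^ a k v) * hermite_multi A b z \<partial>?M))"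
      by (intro sum.cong refl, subst Bochner_Integration.integral_sum)
        (intro int polyfun_mult polyfun.scale polyfun_shifted_power polyfun_hermite_multi, simp)
    also have "\<dots> = (\<Sum>p\<in>P. \<Sum>b\<in>?J. real (\<Prod>v\<in>A. a k v choose b v) * c b *
        (\<integral>z. (\<Prod>v\<in>A. (X p v + z v) ^ (a k v - b v)) \<partial>?M))"
      unfolding integral_shifted_power_hermite_multi[OF A] using fact_nz
      by (intro sum.cong refl) (simp add: field_simps)
    also have "\<dots> = (\<Sum>p\<in>P. \<Sum>b\<in>?B. real (\<Prod>v\<in>A. a k v choose b v) * c b *
        (\<integral>z. (\<Prod>v\<in>A. (X p v + z v) ^ (a k v - b v)) \<partial>?M))"
      by (rule sum.cong[OF refl], rule sum.mono_neutral_right[OF J B], rule ballI)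
        (simp only: zero of_nat_0 mult_zero_left)
    also have "\<dots> = (\<integral>z. (\<Sum>b\<in>?B. real (\<Prod>v\<in>A. a k v choose b v) * c b *
         (\<Sum>p\<in>P. \<Prod>v\<in>A. (X p v + z v) ^ (a k v - b v))) \<partial>?M)"
      by (subst sum.swap, subst Bochner_Integration.integral_sum,
          intro int polyfun.scale polyfun_sum polyfun_shifted_power, rule sum.cong[OF refl],
          simp only: integral_mult_right_zero sum_distrib_left[symmetric],
          subst Bochner_Integration.integral_sum, intro int polyfun_shifted_power, rule refl)
    also have "\<dots> = (\<integral>z. (\<Sum>p\<in>P. x p * (\<Prod>v\<in>A. (X p v + z v) ^ a k v)) \<partial>?M)"
      unfolding moments[OF deg[OF k]] ..
    also have "\<dots> = (\<Sum>p\<in>P. x p * (\<integral>z. (\<Prod>v\<in>A. (X p v + z v) ^ a k v) \<partial>?M))"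
      by (subst Bochner_Integration.integral_sum) (auto intro!: int polyfun.scale polyfun_shifted_power)
    finally show ?thesis .
  qed
  have inner: "(\<Sum>p\<in>P. \<integral>z. f p z * W z \<partial>?M) = (\<Sum>p\<in>P. x p * (\<integral>z. f p z \<partial>?M))"
  proof -
    have "(\<Sum>p\<in>P. \<integral>z. f p z * W z \<partial>?M) =
        (\<Sum>p\<in>P. \<integral>z. (\<Sum>k\<in>K. C k * ((\<Prod>v\<in>A. (X p v + z v) ^ a k v) * W z)) \<partial>?M)"
      by (simp only: f_def sum_distrib_right mult.assoc)
    also have "\<dots> = (\<Sum>p\<in>P. \<Sum>k\<in>K. C k * (\<integral>z. (\<Prod>v\<in>A. (X p v + z v) ^ a k v) * W z \<partial>?M))"
      by (intro sum.cong refl, subst Bochner_Integration.integral_sum)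
        (auto intro!: int polyfun_mult polyfun.scale polyfun_shifted_power W)
    also have "\<dots> = (\<Sum>k\<in>K. C k * (\<Sum>p\<in>P. \<integral>z. (\<Prod>v\<in>A. (X p v + z v) ^ a k v) * W z \<partial>?M))"
      by (subst sum.swap) (simp only: sum_distrib_left)
    also have "\<dots> = (\<Sum>k\<in>K. C k * (\<Sum>p\<in>P. x p * (\<integral>z. (\<Prod>v\<in>A. (X p v + z v) ^ a k v) \<partial>?M)))"
      by (intro sum.cong refl) (simp only: W_mono)
    also have "\<dots> = (\<Sum>p\<in>P. x p * (\<Sum>k\<in>K. C k * (\<integral>z. (\<Prod>v\<in>A. (X p v + z v) ^ a k v) \<partial>?M)))"
      unfolding sum_distrib_left by (subst sum.swap) (simp only: mult_ac)
    also have "\<dots> = (\<Sum>p\<in>P. x p * (\<integral>z. f p z \<partial>?M))"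
      unfolding f_def by (subst Bochner_Integration.integral_sum)
        (auto intro!: int polyfun.scale polyfun_shifted_power)
    finally show ?thesis .
  qed
  have norm: "(\<integral>z. (W z)\<^sup>2 \<partial>?M) = (\<Sum>b\<in>?J. (c b)\<^sup>2 / ?fact b)"
    unfolding W_def integral_hermite_multi_square[OF A]
    using fact_nz by (intro sum.cong refl) (simp add: power2_eq_square)
  \<comment> \<open>The integral of (f - W)^2 is nonnegative. As \<open>W\<close> pairs with the
    estimator like \<open>x\<close> only after summation over \<open>p\<close>, both cross terms are
    kept here and cancel later through \<open>inner\<close>.\<close>
  have pt: "(\<integral>z. (f p z - x p)\<^sup>2 \<partial>?M) \<ge>
      2 * (\<integral>z. f p z * W z \<partial>?M) - 2 * x p * (\<integral>z. f p z \<partial>?M) + (x p)\<^sup>2 - (\<integral>z. (W z)\<^sup>2 \<partial>?M)" for p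
  proof -
    have "0 \<le> (\<integral>z. (f p z - W z)\<^sup>2 \<partial>?M)" by simp
    also have "\<dots> = (\<integral>z. (f p z - x p)\<^sup>2 + (- 2 * (f p z * W z) + (2 * x p) * f p z + (W z)\<^sup>2 + (- (x p)\<^sup>2)) \<partial>?M)"
      by (intro Bochner_Integration.integral_cong refl) (simp add: power2_eq_square algebra_simps)
    also have "\<dots> = (\<integral>z. (f p z - x p)\<^sup>2 \<partial>?M) + (- 2 * (\<integral>z. f p z * W z \<partial>?M)
        + (2 * x p) * (\<integral>z. f p z \<partial>?M) + (\<integral>z. (W z)\<^sup>2 \<partial>?M) + (- (x p)\<^sup>2))"
      unfolding power2_eq_square
      by (subst Bochner_Integration.integral_add,
          (intro int polyfun_mult polyfun_diff polyfun.add polyfun.scale polyfun_const f W)+)+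
         (simp add: MP.prob_space)
    finally show ?thesis by simp
  qed
  have "(\<Sum>p\<in>P. 2 * (\<integral>z. f p z * W z \<partial>?M) - 2 * x p * (\<integral>z. f p z \<partial>?M) + (x p)\<^sup>2 - (\<integral>z. (W z)\<^sup>2 \<partial>?M))
      \<le> (\<Sum>p\<in>P. \<integral>z. (f p z - x p)\<^sup>2 \<partial>?M)"
    by (intro sum_mono pt)
  moreover have "(\<Sum>p\<in>P. 2 * (\<integral>z. f p z * W z \<partial>?M) - 2 * x p * (\<integral>z. f p z \<partial>?M) + (x p)\<^sup>2 - (\<integral>z. (W z)\<^sup>2 \<partial>?M))
     = 2 * (\<Sum>p\<in>P. \<integral>z. f p z * W z \<partial>?M) - 2 * (\<Sum>p\<in>P. x p * (\<integral>z. f p z \<partial>?M))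
       + (\<Sum>p\<in>P. (x p)\<^sup>2) - real (card P) * (\<integral>z. (W z)\<^sup>2 \<partial>?M)"
    by (simp add: sum.distrib sum_subtractf sum_distrib_left mult.assoc)
  ultimately show ?thesis
    unfolding inner norm by simp
qed

section \<open>Exposing the copies vertex by vertex\<close>

locale permutation_copies =
  fixes n N \<rho> :: nat
begin

definition copies :: "(nat \<Rightarrow> nat \<Rightarrow> nat) set" where
  "copies = PiE {..<N} (\<lambda>_. {p. p permutes {1..n}})"

definition cnt :: "((nat \<Rightarrow> nat \<Rightarrow> nat) \<Rightarrow> bool) \<Rightarrow> real" where
  "cnt S = real (card {w \<in> copies. S w})"

text \<open>Measurability with respect to what has been exposed, namely the positions of
  \<open>A\<close> in all copies. It lets counting replace conditional probabilities.\<close>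

definition depends_on :: "nat set \<Rightarrow> ((nat \<Rightarrow> nat \<Rightarrow> nat) \<Rightarrow> 'a) \<Rightarrow> bool" where
  "depends_on A f \<longleftrightarrow> (\<forall>w\<in>copies. \<forall>w'\<in>copies. (\<forall>i<N. \<forall>u\<in>A. w i u = w' i u) \<longrightarrow> f w = f w')"

definition near :: "nat \<times> nat \<Rightarrow> (nat \<Rightarrow> nat) \<Rightarrow> bool" where
  "near = (\<lambda>(u, v) p. \<bar>int (p u) - int (p v)\<bar> \<le> int \<rho>)"

text \<open>One copy per edge suffices: only if all copies fail is the twisted sum of the edge
  forced to vanish.\<close>

definition all_near :: "(nat \<times> nat) set \<Rightarrow> (nat \<Rightarrow> nat \<Rightarrow> nat) \<Rightarrow> bool" where
  "all_near F w \<longleftrightarrow> (\<forall>e\<in>F. \<exists>i<N. near e (w i))"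

text \<open>Positions are compared across different copies, because a shift on one component puts
  its positions in one copy beside the positions of the other vertices in another copy.\<close>

definition meet :: "nat set \<Rightarrow> nat set \<Rightarrow> (nat \<Rightarrow> nat \<Rightarrow> nat) \<Rightarrow> bool" where
  "meet A B w \<longleftrightarrow> (\<exists>i<N. \<exists>j<N. \<exists>u\<in>A. \<exists>v\<in>B. w i u = w j v)"

lemma finite_copies [simp]: "finite copies"
  unfolding copies_def by (intro finite_PiE) (auto intro: finite_permutations)

lemma copies_permutes: "w \<in> copies \<Longrightarrow> i < N \<Longrightarrow> w i permutes {1..n}"
  by (auto simp: copies_def PiE_iff)

lemma cnt_nonneg [simp]: "cnt S \<ge> 0"
  by (simp add: cnt_def)

lemma cnt_mono: "(\<And>w. w \<in> copies \<Longrightarrow> S w \<Longrightarrow> T w) \<Longrightarrow> cnt S \<le> cnt T"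
  unfolding cnt_def of_nat_le_iff by (intro card_mono) auto

lemma cnt_UN_le:
  assumes "finite K" and "\<And>w. w \<in> copies \<Longrightarrow> S w \<Longrightarrow> \<exists>k\<in>K. T k w"
  shows "cnt S \<le> (\<Sum>k\<in>K. cnt (T k))"
proof -
  have "card {w \<in> copies. S w} \<le> card (\<Union>k\<in>K. {w \<in> copies. T k w})"
    using assms by (intro card_mono) auto
  also have "\<dots> \<le> (\<Sum>k\<in>K. card {w \<in> copies. T k w})"
    using assms(1) by (rule card_UN_le)
  finally show ?thesis
    unfolding cnt_def of_nat_sum[symmetric] of_nat_le_iff .
qed

lemma depends_onD:
  assumes "depends_on A f" "w \<in> copies" "w' \<in> copies" "\<And>i u. i < N \<Longrightarrow> u \<in> A \<Longrightarrow> w i u = w' i u"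
  shows "f w = f w'"
proof -
  have "\<forall>i<N. \<forall>u\<in>A. w i u = w' i u"
    using assms(4) by blast
  with assms(1-3) show ?thesis
    unfolding depends_on_def by meson
qed

lemma depends_on_mono:
  assumes "depends_on A f" "A \<subseteq> B"
  shows "depends_on B f"
  unfolding depends_on_def
proof (intro ballI impI)
  fix w w' assume "w \<in> copies" "w' \<in> copies" "\<forall>i<N. \<forall>u\<in>B. w i u = w' i u"
  with assms(2) show "f w = f w'"
    by (intro depends_onD[OF assms(1), of w w']) auto
qed

lemma depends_on_conj:
  assumes "depends_on A S" "depends_on A T"
  shows "depends_on A (\<lambda>w. S w \<and> T w)"
  unfolding depends_on_def
proof (intro ballI impI)
  fix w w' assume w: "w \<in> copies" "w' \<in> copies" "\<forall>i<N. \<forall>u\<in>A. w i u = w' i u"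
  then have "S w = S w'" "T w = T w'"
    by (simp_all add: depends_onD[OF assms(1), of w w'] depends_onD[OF assms(2), of w w'])
  then show "(S w \<and> T w) = (S w' \<and> T w')" by simp
qed

lemma depends_on_all_near:
  assumes "F \<subseteq> A \<times> A"
  shows "depends_on A (all_near F)"
proof -
  have "near e (w i) = near e (w' i)" if "\<forall>i<N. \<forall>u\<in>A. w i u = w' i u" "e \<in> F" "i < N" for e i w w'
    using assms that by (cases e) (auto simp: near_def)
  then have "all_near F w = all_near F w'" if "\<forall>i<N. \<forall>u\<in>A. w i u = w' i u" for w w'
    using that unfolding all_near_def by (intro ball_cong refl ex_cong) auto
  then show ?thesis
    unfolding depends_on_def by simp
qed

lemma depends_on_ex_near: "u \<in> A \<Longrightarrow> v \<in> A \<Longrightarrow> depends_on A (\<lambda>w. \<exists>i<N. near (u, v) (w i))"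
  using depends_on_all_near[of "{(u, v)}" A] by (simp add: all_near_def[abs_def])

lemma depends_on_meet:
  assumes "B \<subseteq> A" "C \<subseteq> A"
  shows "depends_on A (meet B C)"
  unfolding depends_on_def
proof (intro ballI impI)
  fix w w' :: "nat \<Rightarrow> nat \<Rightarrow> nat" assume "\<forall>i<N. \<forall>u\<in>A. w i u = w' i u"
  then have "w i u = w' i u" "w j v = w' j v" if "i < N" "j < N" "u \<in> B" "v \<in> C" for i j u v
    using assms that by blast+
  then have "(w i u = w j v) = (w' i u = w' j v)" if "i < N" "j < N" "u \<in> B" "v \<in> C" for i j u v
    using that by metis
  then show "meet B C w = meet B C w'"
    unfolding meet_def by (intro ex_cong conj_cong refl bex_cong) auto
qed

lemma copies_transpose:
  assumes "w \<in> copies" "i < N" "u \<in> {1..n}" "v \<in> {1..n}"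
  shows "w(i := w i \<circ> Transposition.transpose u v) \<in> copies"
  using assms permutes_compose[OF permutes_swap_id[of u "{1..n}" v] copies_permutes[of w i]]
  by (auto simp: copies_def PiE_iff extensional_def)

text \<open>Precomposing copy \<open>i\<close> with transpositions of \<open>v\<close> gives \<open>n - card A\<close> disjoint events of equal size.\<close>

lemma expose_position:
  assumes i: "i < N" and A: "A \<subseteq> {1..n}" and v: "v \<in> {1..n} - A"
    and S: "depends_on A S" and g: "depends_on A g"
  shows "(real n - real (card A)) * cnt (\<lambda>w. S w \<and> w i v = g w) \<le> cnt S"
proof -
  let ?T = "\<lambda>u. {w \<in> copies. S w \<and> w i u = g w}"
  have card_eq: "card (?T u) = card (?T v)" if u: "u \<in> {1..n} - A" for u
  proof -
    let ?f = "\<lambda>w. w(i := w i \<circ> Transposition.transpose u v)"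
    have inv: "?f (?f w) = w" for w :: "nat \<Rightarrow> nat \<Rightarrow> nat"
      by (auto simp: fun_eq_iff)
    have f: "?f w \<in> copies" "S (?f w) = S w" "g (?f w) = g w" if w: "w \<in> copies" for w
    proof -
      show "?f w \<in> copies"
        using copies_transpose[OF w i] u v by simp
      moreover have "?f w j x = w j x" if "x \<in> A" for j x
        using that u v by (auto simp: Transposition.transpose_def)
      ultimately have "\<And>j x. x \<in> A \<Longrightarrow> ?f w j x = w j x" "?f w \<in> copies"
        by blast+
      then show "S (?f w) = S w" "g (?f w) = g w"
        by (intro depends_onD[OF S _ w] depends_onD[OF g _ w]; blast)+
    qed
    have "bij_betw ?f (?T u) (?T v)"
    proof (rule bij_betw_byWitness[where f' = ?f])
      have "?f w i v = w i u" "?f w i u = w i v" for w :: "nat \<Rightarrow> nat \<Rightarrow> nat"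
        by simp_all
      then show "?f ` ?T u \<subseteq> ?T v" "?f ` ?T v \<subseteq> ?T u"
        using f by fastforce+
    qed (intro ballI inv)+
    then show ?thesis by (rule bij_betw_same_card)
  qed
  have "(n - card A) * card (?T v) = (\<Sum>u\<in>{1..n} - A. card (?T u))"
    using A by (simp add: card_eq card_Diff_subset finite_subset)
  also have "\<dots> = card (\<Union>u\<in>{1..n} - A. ?T u)"
  proof (rule card_UN_disjoint[symmetric])
    \<comment> \<open>Two of these events together would give \<open>w i u = w i u'\<close>, against
      injectivity of \<open>w i\<close>.\<close>
    show "\<forall>u\<in>{1..n} - A. \<forall>u'\<in>{1..n} - A. u \<noteq> u' \<longrightarrow> ?T u \<inter> ?T u' = {}"
      using i by (auto dest!: copies_permutes[of _ i] dest: permutes_inj simp: inj_def)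
  qed auto
  also have "\<dots> \<le> card {w \<in> copies. S w}"
    by (intro card_mono) auto
  finally have "real ((n - card A) * card (?T v)) \<le> real (card {w \<in> copies. S w})"
    by (simp only: of_nat_le_iff)
  moreover have "card A \<le> n"
    using card_mono[OF _ A] by simp
  ultimately show ?thesis
    unfolding cnt_def by (simp add: of_nat_diff)
qed

lemma expose_position_div:
  assumes "i < N" "A \<subseteq> {1..n}" "v \<in> {1..n} - A" "depends_on A S" "depends_on A g"
    and m: "0 < m" "m + real (card A) \<le> real n"
  shows "cnt (\<lambda>w. S w \<and> w i v = g w) \<le> cnt S / m"
proof -
  have "m * cnt (\<lambda>w. S w \<and> w i v = g w) \<le> (real n - real (card A)) * cnt (\<lambda>w. S w \<and> w i v = g w)"
    using m by (intro mult_right_mono) auto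
  also have "\<dots> \<le> cnt S"
    by (rule expose_position) fact+
  finally show ?thesis using m by (simp add: field_simps)
qed

text \<open>Once \<open>u\<close> is exposed, each copy and each admissible difference prescribes a
  single position of \<open>v\<close>; the rest is a union bound.\<close>

lemma expose_near:
  assumes A: "A \<subseteq> {1..n}" and u: "u \<in> A" and v: "v \<in> {1..n} - A" and S: "depends_on A S"
    and m: "0 < m" "m + real (card A) \<le> real n"
  shows "cnt (\<lambda>w. S w \<and> (\<exists>i<N. near (u, v) (w i))) \<le> (2 * real \<rho> * real N / m) * cnt S"
proof -
  \<comment> \<open>Difference 0 is excluded as \<open>u\<close> and \<open>v\<close> are distinct.
    This gives \<open>2 * \<rho>\<close> differences instead of \<open>2 * \<rho> + 1\<close>, a
    bound proportional to \<rho>.\<close>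
  let ?D = "{- int \<rho>..int \<rho>} - {0}"
  have dep: "depends_on A (\<lambda>w. nat (int (w i u) + d))" if "i < N" for i d
    using u that by (auto simp: depends_on_def)
  have "cnt (\<lambda>w. S w \<and> (\<exists>i<N. near (u, v) (w i))) \<le>
      (\<Sum>k\<in>{..<N} \<times> ?D. cnt (\<lambda>w. S w \<and> w (fst k) v = nat (int (w (fst k) u) + snd k)))"
  proof (rule cnt_UN_le)
    fix w assume w: "w \<in> copies" "S w \<and> (\<exists>i<N. near (u, v) (w i))"
    then obtain i where i: "i < N" "near (u, v) (w i)" by blast
    have "w i u \<noteq> w i v"
      using permutes_inj[OF copies_permutes[OF w(1) i(1)]] u v by (auto dest: injD)
    then show "\<exists>k\<in>{..<N} \<times> ?D. S w \<and> w (fst k) v = nat (int (w (fst k) u) + snd k)"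
      using w i by (intro bexI[of _ "(i, int (w i v) - int (w i u))"]) (auto simp: near_def)
  qed auto
  also have "\<dots> \<le> (\<Sum>k\<in>{..<N} \<times> ?D. cnt S / m)"
    using A v S m dep by (intro sum_mono expose_position_div) auto
  also have "\<dots> = (2 * real \<rho> * real N / m) * cnt S"
    by (simp add: card_cartesian_product)
  finally show ?thesis .
qed

text \<open>The copy of \<open>v\<close> and the copy of the vertex it hits are chosen separately,
  hence the square of \<open>N\<close>.\<close>

lemma expose_meet:
  assumes A: "A \<subseteq> {1..n}" and B: "B \<subseteq> A" and v: "v \<in> {1..n} - A" and S: "depends_on A S"
    and m: "0 < m" "m + real (card A) \<le> real n"
  shows "cnt (\<lambda>w. S w \<and> meet {v} B w) \<le> ((real N)\<^sup>2 * real (card B) / m) * cnt S"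
proof -
  have fin: "finite B"
    using A B finite_subset by (metis finite_atLeastAtMost)
  have dep: "depends_on A (\<lambda>w. w j u)" if "j < N" "u \<in> B" for j u
    using B that by (auto simp: depends_on_def)
  have "cnt (\<lambda>w. S w \<and> meet {v} B w) \<le>
      (\<Sum>k\<in>{..<N} \<times> {..<N} \<times> B. cnt (\<lambda>w. S w \<and> w (fst k) v = w (fst (snd k)) (snd (snd k))))"
    using fin by (intro cnt_UN_le) (fastforce simp: meet_def)+
  also have "\<dots> \<le> (\<Sum>k\<in>{..<N} \<times> {..<N} \<times> B. cnt S / m)"
    using A v S m dep by (intro sum_mono expose_position_div) auto
  also have "\<dots> = ((real N)\<^sup>2 * real (card B) / m) * cnt S"
    by (simp add: card_cartesian_product power2_eq_square)
  finally show ?thesis .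
qed

text \<open>\<open>B - A\<close> is exposed along a spanning forest growing out of \<open>A\<close>:
  \<open>expand\<close> always supplies a new vertex adjacent to an exposed one, and
  \<open>expose_near\<close> charges that edge. Edges outside the forest are ignored.\<close>

lemma grow_all_near:
  assumes "A \<subseteq> B" "B \<subseteq> {1..n}" "depends_on A S"
    and m: "0 < m" "m + real (card B) \<le> real n"
    and expand: "\<And>A'. A \<subseteq> A' \<Longrightarrow> A' \<subset> B \<Longrightarrow> \<exists>u\<in>A'. \<exists>v\<in>B - A'. (u, v) \<in> F \<or> (v, u) \<in> F"
  shows "cnt (\<lambda>w. S w \<and> all_near F w) \<le> (2 * real \<rho> * real N / m) ^ card (B - A) * cnt S"
  using assms(1,3) expand
proof (induction "card (B - A)" arbitrary: A S)
  case 0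
  show ?case using 0(1)[symmetric] by (auto intro!: cnt_mono)
next
  case (Suc k)
  let ?p = "2 * real \<rho> * real N / m"
  have fin: "finite B"
    using assms(2) finite_subset by (metis finite_atLeastAtMost)
  have "A \<subset> B" using Suc.prems(1) Suc.hyps(2) by auto
  then obtain u v where uv: "u \<in> A" "v \<in> B - A" "(u, v) \<in> F \<or> (v, u) \<in> F"
    using Suc.prems(3)[of A] by blast
  let ?S = "\<lambda>w. S w \<and> (\<exists>i<N. near (u, v) (w i))"
  have k: "k = card (B - insert v A)"
  proof -
    have "B - insert v A = (B - A) - {v}" by blast
    then show ?thesis
      using card_Diff_singleton[OF uv(2)] Suc.hyps(2) by simp
  qed
  have "cnt (\<lambda>w. S w \<and> all_near F w) \<le> cnt (\<lambda>w. ?S w \<and> all_near F w)"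
  proof (rule cnt_mono)
    fix w assume w: "S w \<and> all_near F w"
    have "near (v, u) p \<Longrightarrow> near (u, v) p" for p
      by (auto simp: near_def)
    moreover have "(\<exists>i<N. near (u, v) (w i)) \<or> (\<exists>i<N. near (v, u) (w i))"
      using w uv(3) unfolding all_near_def by blast
    ultimately show "?S w \<and> all_near F w"
      using w by blast
  qed
  also have "\<dots> \<le> ?p ^ card (B - insert v A) * cnt ?S"
  proof (rule Suc.hyps(1)[OF k])
    show "depends_on (insert v A) ?S"
      by (intro depends_on_conj depends_on_ex_near depends_on_mono[OF Suc.prems(2)]) (use uv in auto)
  qed (use Suc.prems uv in auto)
  also have "\<dots> \<le> ?p ^ card (B - insert v A) * (?p * cnt S)"
  proof (rule mult_left_mono)
    have "card A \<le> card B" using Suc.prems fin by (intro card_mono) auto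
    then show "cnt ?S \<le> ?p * cnt S"
      using Suc.prems assms(2) uv m by (intro expose_near[of A]) auto
  qed (use m in auto)
  also have "\<dots> = ?p ^ card (B - A) * cnt S"
    unfolding Suc.hyps(2)[symmetric] k[symmetric] by simp
  finally show ?case .
qed

end

section \<open>Connected components\<close>

text \<open>Reachability restricted to \<open>V\<close> is an equivalence on \<open>V\<close>, so
  that components become a quotient and isolated vertices form classes of their own.\<close>

definition connection :: "'a set \<Rightarrow> ('a \<times> 'a) set \<Rightarrow> ('a \<times> 'a) set" where
  "connection V E = {(a, b) \<in> V \<times> V. (a, b) \<in> (E \<union> E\<inverse>)\<^sup>*}"

abbreviation graph_components :: "'a set \<Rightarrow> ('a \<times> 'a) set \<Rightarrow> 'a set set" where
  "graph_components V E \<equiv> V // connection V E"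

lemma equiv_connection: "equiv V (connection V E)"
proof (rule equivI)
  have "sym ((E \<union> E\<inverse>)\<^sup>*)"
    by (rule sym_rtrancl[OF sym_Un_converse])
  then show "sym (connection V E)"
    unfolding connection_def sym_def by blast
  show "refl_on V (connection V E)"
    unfolding connection_def refl_on_def by blast
  show "trans (connection V E)"
    unfolding connection_def trans_def by (auto intro: rtrancl_trans)
qed (auto simp: connection_def)

lemmas component_disj = quotient_disj[OF equiv_connection]
lemmas Union_components = Union_quotient[OF equiv_connection]
lemmas component_nonempty = in_quotient_imp_non_empty[OF equiv_connection]
lemmas component_subset = in_quotient_imp_subset[OF equiv_connection]

lemma finite_components: "finite V \<Longrightarrow> finite (graph_components V E)"
  by (rule finite_quotient[OF _ equiv_type[OF equiv_connection]])

lemma component_closed: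
  assumes "E \<subseteq> V \<times> V" "c \<in> graph_components V E" "(u, v) \<in> E"
  shows "u \<in> c \<longleftrightarrow> v \<in> c"
proof -
  have "(u, v) \<in> connection V E"
    using assms by (auto simp: connection_def)
  then show ?thesis
    using in_quotient_imp_closed[OF equiv_connection assms(2)] equiv_connection[of V E]
    by (meson equiv_def symD)
qed

lemma edges_within_components:
  assumes "E \<subseteq> V \<times> V" "D \<subseteq> graph_components V E"
  shows "{e \<in> E. fst e \<in> \<Union>D} \<subseteq> \<Union>D \<times> \<Union>D"
proof
  fix e assume "e \<in> {e \<in> E. fst e \<in> \<Union>D}"
  then obtain c where c: "e \<in> E" "c \<in> D" "fst e \<in> c" by blast
  have "snd e \<in> c"
    using component_closed[OF assms(1), of c "fst e" "snd e"] c assms(2) by auto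
  with c show "e \<in> \<Union>D \<times> \<Union>D" by (cases e) auto
qed

text \<open>A path inside \<open>c\<close> from \<open>u\<close> to a vertex outside
  \<open>A\<close> has to leave \<open>A\<close> along some edge. This provides the hypothesis
  \<open>expand\<close> of \<open>grow_all_near\<close>.\<close>

lemma component_expand:
  assumes E: "E \<subseteq> V \<times> V" and c: "c \<in> graph_components V E" and u: "u \<in> c" "u \<in> A" and nsub: "\<not> c \<subseteq> A"
  shows "\<exists>a\<in>A \<inter> c. \<exists>b\<in>c - A. (a, b) \<in> E \<or> (b, a) \<in> E"
proof -
  obtain v where v: "v \<in> c" "v \<notin> A" using nsub by blast
  then have "(u, v) \<in> connection V E"
    using in_quotient_imp_in_rel[OF equiv_connection c] u by blast
  then have "(u, v) \<in> (E \<union> E\<inverse>)\<^sup>*"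
    by (simp add: connection_def)
  then have "v \<in> c \<and> (v \<in> A \<or> (\<exists>a\<in>A \<inter> c. \<exists>b\<in>c - A. (a, b) \<in> E \<or> (b, a) \<in> E))"
  proof induction
    case (step y z)
    have "z \<in> c"
      using step component_closed[OF E c] by blast
    with step show ?case by blast
  qed (use u in blast)
  with v show ?thesis by blast
qed

text \<open>The first sum is the size of a spanning forest, that is, the exponent of the edge factor
  in the counts.\<close>

lemma sum_card_components:
  assumes "finite V"
  shows "(\<Sum>c\<in>graph_components V E. card c - 1) + card (graph_components V E) = card V"
proof -
  have fin: "finite c" if "c \<in> graph_components V E" for c
    using component_subset[OF that] assms finite_subset by blast
  have "pairwise disjnt (graph_components V E)"
    unfolding pairwise_def disjnt_def using component_disj by blast
  then have "card (\<Union>(graph_components V E)) = (\<Sum>c\<in>graph_components V E. card c)"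
    using fin by (intro card_Union_disjoint)
  then have "card V = (\<Sum>c\<in>graph_components V E. card c)"
    by (simp only: Union_components)
  also have "\<dots> = (\<Sum>c\<in>graph_components V E. (card c - 1) + 1)"
  proof (intro sum.cong refl)
    fix c assume c: "c \<in> graph_components V E"
    have "c \<noteq> {}"
      using component_nonempty[OF c] .
    with fin[OF c] have "card c > 0" by (simp add: card_gt_0_iff)
    then show "card c = card c - 1 + 1" by simp
  qed
  finally show ?thesis unfolding sum.distrib by simp
qed

text \<open>Either the complement of a maximal independent set containing \<open>a\<close>, or that set without \<open>a\<close>, is large enough.\<close>

lemma half_dominated:
  fixes rel :: "'a \<Rightarrow> 'a \<Rightarrow> bool"
  assumes fin: "finite K" and a: "a \<in> K" and sym: "\<And>x y. rel x y \<Longrightarrow> rel y x"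
    and nb: "\<And>x. x \<in> K - {a} \<Longrightarrow> \<exists>y\<in>K - {x}. rel x y"
  shows "\<exists>R\<subseteq>K - {a}. card K - 1 \<le> 2 * card R \<and> (\<forall>x\<in>R. \<exists>y\<in>K - R. rel x y)"
proof -
  define Ind where "Ind = {I. I \<subseteq> K \<and> a \<in> I \<and> (\<forall>x\<in>I. \<forall>y\<in>I. x \<noteq> y \<longrightarrow> \<not> rel x y)}"
  have "finite Ind" using fin unfolding Ind_def by simp
  moreover have "{a} \<in> Ind" using a by (simp add: Ind_def)
  ultimately obtain I where I: "I \<in> Ind" and max: "\<And>J. J \<in> Ind \<Longrightarrow> I \<subseteq> J \<Longrightarrow> J = I"
    using finite_has_maximal[of Ind] by (metis empty_iff)
  have IK: "I \<subseteq> K" "a \<in> I" using I by (auto simp: Ind_def)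
  have out: "\<exists>y\<in>I. rel x y" if x: "x \<in> K - I" for x
  proof (rule ccontr)
    assume "\<not> (\<exists>y\<in>I. rel x y)"
    then have "insert x I \<in> Ind"
      using I x sym by (auto simp: Ind_def)
    with max x show False by blast
  qed
  \<comment> \<open>Independence of \<open>I\<close> forces the element related to \<open>x\<close>
    out of \<open>I\<close>.\<close>
  have inn: "\<exists>y\<in>K - I. rel x y" if x: "x \<in> I - {a}" for x
  proof -
    obtain y where "y \<in> K - {x}" "rel x y" using nb[of x] x IK by blast
    with I x show ?thesis by (auto simp: Ind_def)
  qed
  have cards: "card (K - I) + card (I - {a}) = card K - 1"
  proof -
    have "finite I" "card I \<le> card K" "card I > 0"
      using fin IK finite_subset card_mono by (blast, blast, metis card_gt_0_iff empty_iff)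
    then show ?thesis
      using IK by (simp add: card_Diff_subset)
  qed
  show ?thesis
  proof (cases "card (K - I) \<ge> card (I - {a})")
    case True
    then show ?thesis using cards out IK by (intro exI[of _ "K - I"]) auto
  next
    case False
    then show ?thesis using cards inn IK by (intro exI[of _ "I - {a}"]) auto
  qed
qed

context permutation_copies
begin

text \<open>\<open>S\<close> may already constrain the starting vertex \<open>u\<close>. In this way
  a collision at \<open>u\<close> is imposed before the other \<open>card c - 1\<close> vertices are
  exposed.\<close>

lemma grow_component:
  assumes E: "E \<subseteq> V \<times> V" and V: "V \<subseteq> {1..n}" and c: "c \<in> graph_components V E" and u: "u \<in> c"
    and B: "B \<subseteq> V" "B \<inter> c = {}" and S: "depends_on (insert u B) S"
    and m: "0 < m" "m + real (card V) \<le> real n"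
  shows "cnt (\<lambda>w. S w \<and> all_near {e \<in> E. fst e \<in> c} w) \<le> (2 * real \<rho> * real N / m) ^ (card c - 1) * cnt S"
proof -
  have cV: "c \<subseteq> V" using component_subset[OF c] .
  have fin: "finite V" using V finite_subset by (metis finite_atLeastAtMost)
  have "card (B \<union> c - insert u B) = card c - 1"
  proof -
    have "B \<union> c - insert u B = c - {u}" using B u by blast
    then show ?thesis using u by simp
  qed
  moreover have "cnt (\<lambda>w. S w \<and> all_near {e \<in> E. fst e \<in> c} w) \<le>
      (2 * real \<rho> * real N / m) ^ card (B \<union> c - insert u B) * cnt S"
  proof (rule grow_all_near[OF _ _ S m(1)])
    show "m + real (card (B \<union> c)) \<le> real n"
      using m card_mono[OF fin, of "B \<union> c"] B cV by force
    fix A' assume A': "insert u B \<subseteq> A'" "A' \<subset> B \<union> c"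
    then have "\<exists>a\<in>A' \<inter> c. \<exists>b\<in>c - A'. (a, b) \<in> E \<or> (b, a) \<in> E"
      using u by (intro component_expand[OF E c, of u]) auto
    then show "\<exists>u\<in>A'. \<exists>v\<in>B \<union> c - A'. (u, v) \<in> {e \<in> E. fst e \<in> c} \<or> (v, u) \<in> {e \<in> E. fst e \<in> c}"
      by fastforce
  qed (use u B cV V in auto)
  ultimately show ?thesis by simp
qed

text \<open>The first vertex of each component is free, and each further vertex costs one edge
  factor.\<close>

lemma count_components:
  assumes E: "E \<subseteq> V \<times> V" and V: "V \<subseteq> {1..n}"
    and m: "0 < m" "m + real (card V) \<le> real n"
    and D: "finite D" "D \<subseteq> graph_components V E"
  shows "cnt (all_near {e \<in> E. fst e \<in> \<Union>D}) \<le>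
    (2 * real \<rho> * real N / m) ^ (\<Sum>c\<in>D. card c - 1) * cnt (\<lambda>_. True)"
  using D
proof (induction D)
  case empty
  show ?case by (auto intro: cnt_mono)
next
  case (insert c D)
  let ?p = "2 * real \<rho> * real N / m" and ?S = "all_near {e \<in> E. fst e \<in> \<Union>D}"
  have c: "c \<in> graph_components V E" using insert.prems by simp
  then obtain u where u: "u \<in> c" using component_nonempty by blast
  have disj: "\<Union>D \<inter> c = {}"
    using component_disj[OF c] insert by blast
  have DV: "\<Union>D \<subseteq> V"
    using insert.prems component_subset by blast
  have dep: "depends_on (\<Union>D) ?S"
    using insert.prems by (intro depends_on_all_near edges_within_components[OF E]) auto
  have "cnt (all_near {e \<in> E. fst e \<in> \<Union>(insert c D)}) \<le> cnt (\<lambda>w. ?S w \<and> all_near {e \<in> E. fst e \<in> c} w)"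
    by (rule cnt_mono) (auto simp: all_near_def)
  also have "\<dots> \<le> ?p ^ (card c - 1) * cnt ?S"
    by (rule grow_component[OF E V c u DV disj depends_on_mono[OF dep] m]) auto
  also have "\<dots> \<le> ?p ^ (card c - 1) * (?p ^ (\<Sum>c\<in>D. card c - 1) * cnt (\<lambda>_. True))"
    using insert m by (intro mult_left_mono) auto
  finally show ?case
    using insert.hyps by (simp add: power_add mult.assoc)
qed

text \<open>The components outside \<open>R\<close> are exposed with no collision required. Those in
  \<open>R\<close> follow one at a time: choose the colliding vertex, in at most
  \<open>card V\<close> ways, expose it onto a position already taken, and grow its component from
  there. All collision targets lie outside \<open>R\<close>, so they are exposed beforehand in
  whatever order \<open>R\<close> is treated.\<close>

lemma count_colliding_components:
  assumes E: "E \<subseteq> V \<times> V" and V: "V \<subseteq> {1..n}"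
    and m: "0 < m" "m + real (card V) \<le> real n"
    and R: "R \<subseteq> graph_components V E"
  defines "p \<equiv> 2 * real \<rho> * real N / m" and "q \<equiv> (real N)\<^sup>2 * (real (card V))\<^sup>2 / m"
  shows "cnt (\<lambda>w. all_near E w \<and> (\<forall>c\<in>R. meet c (\<Union>(graph_components V E - R)) w)) \<le>
    q ^ card R * p ^ (card V - card (graph_components V E)) * cnt (\<lambda>_. True)"
proof -
  let ?C = "graph_components V E"
  define B1 where "B1 = \<Union>(?C - R)"
  have fin: "finite V" using V finite_subset by (metis finite_atLeastAtMost)
  have finC: "finite ?C" using fin by (rule finite_components)
  have finR: "finite R" using finC R finite_subset by blast
  have p: "p \<ge> 0" and q: "q \<ge> 0" using m by (auto simp: p_def q_def)
  have B1V: "B1 \<subseteq> V" unfolding B1_def using component_subset by blast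
  have closed: "{e \<in> E. fst e \<in> \<Union>D} \<subseteq> \<Union>D \<times> \<Union>D" if "D \<subseteq> ?C" for D
    using E that by (rule edges_within_components)
  have "cnt (\<lambda>w. all_near {e \<in> E. fst e \<in> B1} w \<and> all_near {e \<in> E. fst e \<in> \<Union>D} w \<and> (\<forall>c\<in>D. meet c B1 w)) \<le>
    q ^ card D * p ^ (\<Sum>c\<in>D. card c - 1) * (p ^ (\<Sum>c\<in>?C - R. card c - 1) * cnt (\<lambda>_. True))"
    if "D \<subseteq> R" for D
    using finite_subset[OF that finR] that
  proof (induction D)
    case empty
    have "cnt (all_near {e \<in> E. fst e \<in> B1}) \<le> p ^ (\<Sum>c\<in>?C - R. card c - 1) * cnt (\<lambda>_. True)"
      unfolding B1_def p_def using finC by (intro count_components[OF E V m]) auto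
    moreover have "all_near {} w" for w
      by (simp add: all_near_def)
    ultimately show ?case by simp
  next
    case (insert c D)
    define S where "S = (\<lambda>w. all_near {e \<in> E. fst e \<in> B1} w \<and> all_near {e \<in> E. fst e \<in> \<Union>D} w \<and> (\<forall>c\<in>D. meet c B1 w))"
    let ?rest = "q ^ card D * p ^ (\<Sum>c\<in>D. card c - 1) * (p ^ (\<Sum>c\<in>?C - R. card c - 1) * cnt (\<lambda>_. True))"
    have c: "c \<in> ?C" using insert.prems R by auto
    define B where "B = B1 \<union> \<Union>D"
    have DC: "D \<subseteq> ?C" using insert.prems R by auto
    have DV: "B \<subseteq> V"
      using DC component_subset B1V unfolding B_def by blast
    have disj: "B \<inter> c = {}"
      using component_disj[OF c] insert DC unfolding B_def B1_def by blast
    have dep: "depends_on B S"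
    proof -
      have "depends_on B (all_near {e \<in> E. fst e \<in> B1})"
        by (rule depends_on_mono[of B1], rule depends_on_all_near)
          (use closed[of "?C - R"] in \<open>auto simp: B1_def B_def\<close>)
      moreover have "depends_on B (all_near {e \<in> E. fst e \<in> \<Union>D})"
        by (rule depends_on_mono[of "\<Union>D"], rule depends_on_all_near)
          (use closed[OF DC] in \<open>auto simp: B_def\<close>)
      moreover have "depends_on B (\<lambda>w. \<forall>c\<in>D. meet c B1 w)"
      proof -
        have "depends_on B (meet c B1)" if "c \<in> D" for c
          using that by (intro depends_on_meet) (auto simp: B_def)
        then have "(\<forall>c\<in>D. meet c B1 w) = (\<forall>c\<in>D. meet c B1 w')"
          if "w \<in> copies" "w' \<in> copies" "\<forall>i<N. \<forall>u\<in>B. w i u = w' i u" for w w'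
          using that by (intro ball_cong refl depends_onD[of B "meet _ B1"]) auto
        then show ?thesis
          unfolding depends_on_def by blast
      qed
      ultimately show ?thesis
        unfolding S_def by (intro depends_on_conj)
    qed
    have cV: "c \<subseteq> V" using component_subset[OF c] .
    have finc: "finite c" using cV fin finite_subset by blast
    have each: "cnt (\<lambda>w. (S w \<and> meet {u} B1 w) \<and> all_near {e \<in> E. fst e \<in> c} w) \<le>
        p ^ (card c - 1) * ((real N)\<^sup>2 * real (card V) / m * cnt S)" if u: "u \<in> c" for u
    proof -
      have "cnt (\<lambda>w. (S w \<and> meet {u} B1 w) \<and> all_near {e \<in> E. fst e \<in> c} w) \<le>
          p ^ (card c - 1) * cnt (\<lambda>w. S w \<and> meet {u} B1 w)"
        unfolding p_def
        by (rule grow_component[OF E V c u DV disj _ m],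
            intro depends_on_conj depends_on_mono[OF dep] depends_on_meet) (auto simp: B_def)
      also have "cnt (\<lambda>w. S w \<and> meet {u} B1 w) \<le> (real N)\<^sup>2 * real (card B1) / m * cnt S"
      proof (rule expose_meet[OF _ _ _ dep m(1)])
        show "m + real (card B) \<le> real n"
          using m card_mono[OF fin DV] by linarith
      qed (use DV V disj u cV in \<open>auto simp: B_def\<close>)
      also have "\<dots> \<le> (real N)\<^sup>2 * real (card V) / m * cnt S"
        using m card_mono[OF fin B1V] by (intro mult_right_mono divide_right_mono mult_left_mono) auto
      finally show ?thesis using p by (simp add: mult_left_mono)
    qed
    have "cnt (\<lambda>w. all_near {e \<in> E. fst e \<in> B1} w \<and> all_near {e \<in> E. fst e \<in> \<Union>(insert c D)} w \<and>
        (\<forall>c\<in>insert c D. meet c B1 w)) \<le>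
      (\<Sum>u\<in>c. cnt (\<lambda>w. (S w \<and> meet {u} B1 w) \<and> all_near {e \<in> E. fst e \<in> c} w))"
    proof (rule cnt_UN_le[OF finc])
      fix w assume "all_near {e \<in> E. fst e \<in> B1} w \<and> all_near {e \<in> E. fst e \<in> \<Union>(insert c D)} w \<and>
        (\<forall>c\<in>insert c D. meet c B1 w)"
      then show "\<exists>u\<in>c. (S w \<and> meet {u} B1 w) \<and> all_near {e \<in> E. fst e \<in> c} w"
        unfolding S_def all_near_def meet_def by auto
    qed
    also have "\<dots> \<le> (\<Sum>u\<in>c. p ^ (card c - 1) * ((real N)\<^sup>2 * real (card V) / m * cnt S))"
      by (intro sum_mono each)
    also have "\<dots> = real (card c) * (p ^ (card c - 1) * ((real N)\<^sup>2 * real (card V) / m * cnt S))"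
      by simp
    also have "\<dots> \<le> real (card V) * (p ^ (card c - 1) * ((real N)\<^sup>2 * real (card V) / m * cnt S))"
      using card_mono[OF fin cV] p m by (intro mult_right_mono) auto
    also have "\<dots> = q * p ^ (card c - 1) * cnt S"
      by (simp add: q_def power2_eq_square)
    also have "\<dots> \<le> q * p ^ (card c - 1) * ?rest"
      using insert p q unfolding S_def by (intro mult_left_mono) auto
    finally show ?case
      using insert.hyps by (simp add: power_add mult_ac)
  qed
  from this[of R] have "cnt (\<lambda>w. all_near {e \<in> E. fst e \<in> B1} w \<and> all_near {e \<in> E. fst e \<in> \<Union>R} w \<and> (\<forall>c\<in>R. meet c B1 w))
    \<le> q ^ card R * (p ^ ((\<Sum>c\<in>?C - R. card c - 1) + (\<Sum>c\<in>R. card c - 1)) * cnt (\<lambda>_. True))"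
    by (simp add: power_add mult_ac)
  moreover have "(\<Sum>c\<in>?C - R. card c - 1) + (\<Sum>c\<in>R. card c - 1) = card V - card ?C"
    using sum.subset_diff[OF R finC, of "\<lambda>c. card c - 1"] sum_card_components[OF fin, of E] by simp
  moreover have "cnt (\<lambda>w. all_near E w \<and> (\<forall>c\<in>R. meet c B1 w)) \<le>
      cnt (\<lambda>w. all_near {e \<in> E. fst e \<in> B1} w \<and> all_near {e \<in> E. fst e \<in> \<Union>R} w \<and> (\<forall>c\<in>R. meet c B1 w))"
    by (rule cnt_mono) (auto simp: all_near_def)
  ultimately show ?thesis
    unfolding B1_def by (simp add: mult.assoc)
qed

end

section \<open>Vanishing of contributions with a free component\<close>

lemma extend_to_permutation:
  assumes "finite S" "V \<subseteq> S" "f ` V \<subseteq> S" "inj_on f V"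
  shows "\<exists>p. p permutes S \<and> (\<forall>v\<in>V. p v = f v)"
proof -
  have "card (f ` V) = card V" using assms(4) by (rule card_image)
  moreover have "finite V" using assms finite_subset by blast
  ultimately have "card (S - V) = card (S - f ` V)"
    using assms by (simp add: card_Diff_subset)
  then obtain h where h: "bij_betw h (S - V) (S - f ` V)"
    using assms(1) finite_same_card_bij by (metis finite_Diff)
  define p where "p v = (if v \<in> V then f v else if v \<in> S then h v else v)" for v
  have "bij_betw p V (f ` V)"
    using assms(4) by (subst bij_betw_cong[of V p f]) (auto simp: p_def bij_betw_def)
  moreover have "bij_betw p (S - V) (S - f ` V)"
    using h by (subst bij_betw_cong[of "S - V" p h]) (auto simp: p_def)
  ultimately have "bij_betw p (V \<union> (S - V)) (f ` V \<union> (S - f ` V))"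
    by (rule bij_betw_combine) blast
  moreover have "V \<union> (S - V) = S" "f ` V \<union> (S - f ` V) = S" using assms by blast+
  ultimately have "p permutes S"
    using assms(2) by (intro bij_imp_permutes) (auto simp: p_def)
  then show ?thesis by (intro exI[of _ p]) (simp add: p_def)
qed

lemma cyclic_shift_permutes:
  "(\<lambda>i. if i < N then if Suc i = N then 0 else Suc i else i) permutes {..<N}" (is "?s permutes _")
proof (rule bij_imp_permutes)
  show "bij_betw ?s {..<N} {..<N}"
    by (rule bij_betw_byWitness[where f' = "\<lambda>i. if i = 0 then N - 1 else i - 1"]) auto
qed auto

context permutation_copies
begin

lemma meet_sym: "meet A B w \<Longrightarrow> meet B A w"
  unfolding meet_def by metis

text \<open>Meeting the rest of \<open>V\<close> means meeting some other component, which is a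
  symmetric relation, so \<open>half_dominated\<close> supplies a suitable \<open>R\<close>. The
  right side is the union bound over all candidates.\<close>

lemma count_no_free_component:
  assumes E: "E \<subseteq> V \<times> V" and V: "V \<subseteq> {1..n}"
    and m: "0 < m" "m + real (card V) \<le> real n"
    and c0: "c0 \<in> graph_components V E"
  defines "p \<equiv> 2 * real \<rho> * real N / m" and "q \<equiv> (real N)\<^sup>2 * (real (card V))\<^sup>2 / m"
  shows "cnt (\<lambda>w. all_near E w \<and> (\<forall>c\<in>graph_components V E - {c0}. meet c (V - c) w)) \<le>
    (\<Sum>R\<in>{R. R \<subseteq> graph_components V E - {c0} \<and> card (graph_components V E) - 1 \<le> 2 * card R}.
      q ^ card R * p ^ (card V - card (graph_components V E)) * cnt (\<lambda>_. True))"
proof -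
  let ?C = "graph_components V E"
  let ?Rs = "{R. R \<subseteq> ?C - {c0} \<and> card ?C - 1 \<le> 2 * card R}"
  have fin: "finite V" using V finite_subset by (metis finite_atLeastAtMost)
  have finC: "finite ?C" using fin by (rule finite_components)
  have "cnt (\<lambda>w. all_near E w \<and> (\<forall>c\<in>?C - {c0}. meet c (V - c) w)) \<le>
      (\<Sum>R\<in>?Rs. cnt (\<lambda>w. all_near E w \<and> (\<forall>c\<in>R. meet c (\<Union>(?C - R)) w)))"
  proof (rule cnt_UN_le)
    show "finite ?Rs" using finC by simp
    fix w assume w: "all_near E w \<and> (\<forall>c\<in>?C - {c0}. meet c (V - c) w)"
    have "\<exists>d\<in>?C - {c}. meet c d w" if c: "c \<in> ?C - {c0}" for c
    proof -
      have "meet c (V - c) w" using w c by blast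
      then obtain i j u v where ij: "i < N" "j < N" "u \<in> c" "v \<in> V - c" "w i u = w j v"
        unfolding meet_def by blast
      then obtain d where "d \<in> ?C" "v \<in> d" using Union_components[of V E] by blast
      then show ?thesis using ij unfolding meet_def by blast
    qed
    then have "\<exists>R\<subseteq>?C - {c0}. card ?C - 1 \<le> 2 * card R \<and> (\<forall>c\<in>R. \<exists>d\<in>?C - R. meet c d w)"
      by (intro half_dominated[OF finC c0]) (auto intro: meet_sym)
    then obtain R where R: "R \<in> ?Rs" "\<And>c. c \<in> R \<Longrightarrow> \<exists>d\<in>?C - R. meet c d w" by blast
    have "meet c (\<Union>(?C - R)) w" if "c \<in> R" for c
      using R(2)[OF that] unfolding meet_def by blast
    then show "\<exists>R\<in>?Rs. all_near E w \<and> (\<forall>c\<in>R. meet c (\<Union>(?C - R)) w)"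
      using R(1) w by blast
  qed
  also have "\<dots> \<le> (\<Sum>R\<in>?Rs. q ^ card R * p ^ (card V - card ?C) * cnt (\<lambda>_. True))"
    unfolding p_def q_def by (intro sum_mono count_colliding_components[OF E V m]) auto
  finally show ?thesis .
qed

section \<open>Shifting the copies on one component\<close>

text \<open>A fibre of the map that restricts all copies to \<open>V\<close>.\<close>

definition agreeing :: "nat set \<Rightarrow> (nat \<Rightarrow> nat \<Rightarrow> nat) \<Rightarrow> (nat \<Rightarrow> nat \<Rightarrow> nat) set" where
  "agreeing V w = {x \<in> copies. \<forall>i<N. \<forall>u\<in>V. x i u = w i u}"

text \<open>Composing copy \<open>i\<close> with \<open>w' i \<circ> inv (w i)\<close> sends one
  fibre injectively into the other. By symmetry all fibres have the same size.\<close>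

lemma card_agreeing_le:
  assumes "w \<in> copies" "w' \<in> copies"
  shows "card (agreeing V w) \<le> card (agreeing V w')"
proof (rule card_inj_on_le)
  let ?f = "\<lambda>x. \<lambda>i\<in>{..<N}. w' i \<circ> inv (w i) \<circ> x i"
  note perm = copies_permutes[OF assms(1)] copies_permutes[OF assms(2)]
  show "inj_on ?f (agreeing V w)"
  proof (rule inj_onI)
    fix x y assume x: "x \<in> agreeing V w" and y: "y \<in> agreeing V w" and eq: "?f x = ?f y"
    show "x = y"
    proof
      fix i
      show "x i = y i"
      proof (cases "i < N")
        case True
        have "(w' i \<circ> inv (w i)) \<circ> x i = (w' i \<circ> inv (w i)) \<circ> y i"
          using fun_cong[OF eq, of i] True by simp
        moreover have "inj (w' i \<circ> inv (w i))"
          using permutes_inj[OF permutes_compose[OF permutes_inv[OF perm(1)[OF True]] perm(2)[OF True]]] .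
        ultimately show ?thesis
          by (metis (no_types, lifting) comp_apply ext injD)
      next
        case False
        then show ?thesis using x y by (auto simp: agreeing_def copies_def PiE_iff extensional_def)
      qed
    qed
  qed
  show "?f ` agreeing V w \<subseteq> agreeing V w'"
  proof
    fix y assume "y \<in> ?f ` agreeing V w"
    then obtain x where x: "x \<in> agreeing V w" "y = ?f x" by blast
    have "x \<in> copies" using x by (simp add: agreeing_def)
    then have "y \<in> copies"
      using perm unfolding x(2) copies_def
      by (auto intro!: permutes_compose permutes_inv copies_permutes[OF \<open>x \<in> copies\<close>] simp: PiE_iff)
    moreover have "y i u = w' i u" if "i < N" "u \<in> V" for i u
    proof -
      have "x i u = w i u" using x(1) that by (simp add: agreeing_def)
      then show ?thesis
        using that permutes_inj[OF perm(1)[OF that(1)]] by (simp add: x(2) inv_f_f)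
    qed
    ultimately show "y \<in> agreeing V w'" by (simp add: agreeing_def)
  qed
  show "finite (agreeing V w')" by (simp add: agreeing_def)
qed

text \<open>A relation and not a map: a shift determines the new copies only on \<open>V\<close>,
  and there is no canonical extension to the other points.\<close>

definition shifted :: "(nat \<Rightarrow> nat) \<Rightarrow> nat set \<Rightarrow> nat set \<Rightarrow> (nat \<Rightarrow> nat \<Rightarrow> nat) \<Rightarrow> (nat \<Rightarrow> nat \<Rightarrow> nat) \<Rightarrow> bool" where
  "shifted s c V w w' \<longleftrightarrow> (\<forall>i<N. (\<forall>u\<in>c. w' i u = w (s i) u) \<and> (\<forall>u\<in>V - c. w' i u = w i u))"

text \<open>If nothing meets, the positions of \<open>c\<close> in copy \<open>s i\<close> avoid
  those of the other vertices in copy \<open>i\<close>, so the spliced map is injective and extends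
  to a permutation.\<close>

lemma ex_shifted:
  assumes V: "V \<subseteq> {1..n}" "c \<subseteq> V" and s: "s permutes {..<N}"
    and w: "w \<in> copies" "\<not> meet c (V - c) w"
  shows "\<exists>w'\<in>copies. shifted s c V w w'"
proof -
  have "\<exists>p. p permutes {1..n} \<and> (\<forall>v\<in>V. p v = (if v \<in> c then w (s i) v else w i v))" if i: "i < N" for i
  proof (rule extend_to_permutation)
    have si: "s i < N" using permutes_in_image[OF s, of i] i by simp
    note p = copies_permutes[OF w(1) i] copies_permutes[OF w(1) si]
    show "(\<lambda>v. if v \<in> c then w (s i) v else w i v) ` V \<subseteq> {1..n}"
      using permutes_in_image[OF p(1)] permutes_in_image[OF p(2)] V by (auto split: if_splits)
    have cross: "w (s i) u \<noteq> w i v" if "u \<in> c" "v \<in> V - c" for u v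
      using w(2) that i si unfolding meet_def by blast
    show "inj_on (\<lambda>v. if v \<in> c then w (s i) v else w i v) V"
    proof (rule inj_onI)
      fix u v assume uv: "u \<in> V" "v \<in> V" "(if u \<in> c then w (s i) u else w i u) = (if v \<in> c then w (s i) v else w i v)"
      show "u = v"
        using uv cross[of u v] cross[of v u] injD[OF permutes_inj[OF p(1)], of u v]
          injD[OF permutes_inj[OF p(2)], of u v]
        by (cases "u \<in> c"; cases "v \<in> c") auto
    qed
  qed (use V in auto)
  then obtain p where p: "\<And>i. i < N \<Longrightarrow> p i permutes {1..n}"
    "\<And>i v. i < N \<Longrightarrow> v \<in> V \<Longrightarrow> p i v = (if v \<in> c then w (s i) v else w i v)"
    by metis
  show ?thesis
  proof (rule bexI)
    show "(\<lambda>i\<in>{..<N}. p i) \<in> copies" using p(1) by (simp add: copies_def PiE_iff)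
    show "shifted s c V w (\<lambda>i\<in>{..<N}. p i)"
      using p(2) V(2) by (auto simp: shifted_def)
  qed
qed

lemma shifted_image:
  assumes "s permutes {..<N}" "shifted s c V w w'" "u \<in> V"
  shows "(\<lambda>i. w' i u) ` {..<N} = (\<lambda>i. w i u) ` {..<N}"
proof (cases "u \<in> c")
  case True
  have "(\<lambda>i. w' i u) ` {..<N} = (\<lambda>i. w i u) ` s ` {..<N}"
    unfolding image_image using assms True by (intro image_cong) (auto simp: shifted_def)
  then show ?thesis by (simp add: permutes_image[OF assms(1)])
next
  case False
  then show ?thesis using assms by (intro image_cong) (auto simp: shifted_def)
qed

text \<open>\<open>meet\<close> sees only the set of positions that each vertex takes over all
  copies, and these sets are invariant under a shift.\<close>

lemma shifted_meet:
  assumes s: "s permutes {..<N}" "shifted s c V w w'" and AB: "A \<subseteq> V" "B \<subseteq> V"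
  shows "meet A B w' \<longleftrightarrow> meet A B w"
proof -
  have "meet A B w \<longleftrightarrow> (\<exists>u\<in>A. \<exists>v\<in>B. (\<lambda>i. w i u) ` {..<N} \<inter> (\<lambda>i. w i v) ` {..<N} \<noteq> {})" for w
  proof -
    have "(\<lambda>i. w i u) ` {..<N} \<inter> (\<lambda>i. w i v) ` {..<N} \<noteq> {} \<longleftrightarrow> (\<exists>i<N. \<exists>j<N. w i u = w j v)" for u v
      by (auto simp: disjoint_iff image_iff)
    then show ?thesis unfolding meet_def by meson
  qed
  moreover have "(\<lambda>i. w' i u) ` {..<N} = (\<lambda>i. w i u) ` {..<N}" if "u \<in> A \<union> B" for u
    using that AB by (intro shifted_image[OF s]) auto
  ultimately show ?thesis by simp
qed

text \<open>Double counting over pairs related by \<open>shifted\<close>: every configuration has as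
  many successors as predecessors, namely the common size \<open>H\<close> of the fibres, so the sum
  equals \<open>a\<close> times itself.\<close>

lemma sum_eq_0_by_shift:
  fixes F :: "(nat \<Rightarrow> nat \<Rightarrow> nat) \<Rightarrow> complex"
  assumes V: "V \<subseteq> {1..n}" "c \<subseteq> V" and s: "s permutes {..<N}"
    and F: "\<And>w w'. w \<in> copies \<Longrightarrow> w' \<in> copies \<Longrightarrow> shifted s c V w w' \<Longrightarrow> F w = a * F w'"
    and a: "a \<noteq> 1"
  shows "(\<Sum>w\<in>{w \<in> copies. \<not> meet c (V - c) w}. F w) = 0"
proof -
  let ?G = "{w \<in> copies. \<not> meet c (V - c) w}"
  have inv: "inv s permutes {..<N}" using s by (rule permutes_inv)
  have G_iff: "w' \<in> ?G \<longleftrightarrow> w \<in> ?G" if "w \<in> copies" "w' \<in> copies" "shifted s c V w w'" for w w'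
    using shifted_meet[OF s that(3), of c "V - c"] V that by auto
  have fwd: "\<exists>x\<in>copies. {w' \<in> ?G. shifted s c V w w'} = agreeing V x" if w: "w \<in> ?G" for w
  proof -
    obtain x where x: "x \<in> copies" "shifted s c V w x"
      using ex_shifted[OF V s, of w] w by auto
    have "shifted s c V w w' \<longleftrightarrow> (\<forall>i<N. \<forall>u\<in>V. w' i u = x i u)" for w'
    proof -
      have "(\<forall>u\<in>c. w' i u = w (s i) u) \<and> (\<forall>u\<in>V - c. w' i u = w i u) \<longleftrightarrow> (\<forall>u\<in>V. w' i u = x i u)"
        if "i < N" for i
        using x(2) that V(2) unfolding shifted_def by (metis DiffE DiffI subsetD)
      then show ?thesis unfolding shifted_def by simp
    qed
    then have "{w' \<in> ?G. shifted s c V w w'} = agreeing V x"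
      using G_iff[of w] w unfolding agreeing_def by blast
    with x show ?thesis by blast
  qed
  \<comment> \<open>The predecessors of \<open>w'\<close> are, on \<open>V\<close>, its shifts by
    the inverse of \<open>s\<close>, so they form a fibre as well.\<close>
  have bwd: "\<exists>x\<in>copies. {w \<in> ?G. shifted s c V w w'} = agreeing V x" if w': "w' \<in> ?G" for w'
  proof -
    obtain x where x: "x \<in> copies" "shifted (inv s) c V w' x"
      using ex_shifted[OF V inv, of w'] w' by auto
    have "shifted s c V w w' \<longleftrightarrow> (\<forall>i<N. \<forall>u\<in>V. w i u = x i u)" for w
    proof
      assume L: "shifted s c V w w'"
      show "\<forall>i<N. \<forall>u\<in>V. w i u = x i u"
      proof (intro allI impI ballI)
        fix i u assume iu: "i < N" "u \<in> V"
        have si: "inv s i < N" using permutes_in_image[OF inv, of i] iu by simp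
        show "w i u = x i u"
          using L x(2) iu si permutes_inverses(1)[OF s, of i] unfolding shifted_def
          by (cases "u \<in> c") auto
      qed
    next
      assume R: "\<forall>i<N. \<forall>u\<in>V. w i u = x i u"
      show "shifted s c V w w'"
        unfolding shifted_def
      proof (intro allI impI conjI ballI)
        fix i u assume iu: "i < N" "u \<in> c"
        have si: "s i < N" using permutes_in_image[OF s, of i] iu by simp
        have "w (s i) u = x (s i) u" using R si iu V by blast
        also have "\<dots> = w' i u"
          using x(2) si iu permutes_inverses(2)[OF s, of i] unfolding shifted_def by auto
        finally show "w' i u = w (s i) u" ..
      next
        fix i u assume iu: "i < N" "u \<in> V - c"
        then have "w i u = x i u" using R by blast
        then show "w' i u = w i u" using x(2) iu unfolding shifted_def by auto
      qed
    qed
    then have "{w \<in> ?G. shifted s c V w w'} = agreeing V x"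
      using G_iff[of _ w'] w' unfolding agreeing_def by blast
    with x show ?thesis by blast
  qed
  show ?thesis
  proof (cases "?G = {}")
    case False
    then obtain w0 where w0: "w0 \<in> copies" by blast
    define H where "H = card (agreeing V w0)"
    have "w0 \<in> agreeing V w0" using w0 by (simp add: agreeing_def)
    then have H: "H > 0"
      unfolding H_def card_gt_0_iff by (auto simp: agreeing_def)
    have H_eq: "card (agreeing V x) = H" if "x \<in> copies" for x
      unfolding H_def using card_agreeing_le[OF that w0] card_agreeing_le[OF w0 that] by (rule antisym)
    have card_fwd: "card {w' \<in> ?G. shifted s c V w w'} = H" if "w \<in> ?G" for w
      using fwd[OF that] H_eq by auto
    have card_bwd: "card {w \<in> ?G. shifted s c V w w'} = H" if "w' \<in> ?G" for w'
      using bwd[OF that] H_eq by auto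
    have "of_nat H * sum F ?G = (\<Sum>w\<in>?G. \<Sum>w'\<in>{w' \<in> ?G. shifted s c V w w'}. F w)"
      by (simp only: sum_constant card_fwd sum_distrib_left cong: sum.cong)
    also have "\<dots> = (\<Sum>w\<in>?G. \<Sum>w'\<in>{w' \<in> ?G. shifted s c V w w'}. a * F w')"
      by (intro sum.cong refl F) auto
    also have "\<dots> = (\<Sum>w'\<in>?G. \<Sum>w\<in>{w \<in> ?G. shifted s c V w w'}. a * F w')"
      by (rule sum.swap_restrict) auto
    also have "\<dots> = of_nat H * (a * sum F ?G)"
      by (simp only: sum_constant card_bwd sum_distrib_left cong: sum.cong)
    finally have "of_nat H * ((1 - a) * sum F ?G) = 0"
      by (simp add: algebra_simps)
    then show ?thesis using H a by simp
  next
    case True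
    then show ?thesis by (simp only: sum.empty)
  qed
qed

definition twisted_edge :: "complex \<Rightarrow> real \<Rightarrow> (nat \<Rightarrow> nat \<Rightarrow> nat) \<Rightarrow> nat \<times> nat \<Rightarrow> complex" where
  "twisted_edge z lam w e = (\<Sum>i<N. z ^ i * of_real (lam * of_bool (near e (w i))))"

lemma norm_twisted_edge_le:
  assumes "lam \<ge> 0" "norm z = 1"
  shows "norm (twisted_edge z lam w e) \<le> (if \<exists>i<N. near e (w i) then lam * real N else 0)"
proof (cases "\<exists>i<N. near e (w i)")
  case True
  have "norm (twisted_edge z lam w e) \<le> (\<Sum>i<N. lam)"
    unfolding twisted_edge_def
    by (rule sum_norm_le) (use assms in \<open>auto simp: norm_mult norm_power\<close>)
  with True show ?thesis by (simp add: mult.commute)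
next
  case False
  then have "twisted_edge z lam w e = 0"
    by (simp add: twisted_edge_def)
  then show ?thesis unfolding if_not_P[OF False] by simp
qed

text \<open>Configurations are sorted by the set \<open>Fr w\<close> of components other than
  \<open>c0\<close> that meet nothing else. A shift along one of them preserves this set, so each
  class with a nonempty set cancels on its own. Sorting by the whole set makes the classes disjoint.
  The remaining terms are bounded in absolute value.\<close>

lemma norm_twisted_sum_le:
  fixes b :: "nat \<times> nat \<Rightarrow> nat" and z :: complex
  assumes A: "A \<subseteq> {1..n} \<times> {1..n}" and ij: "i0 \<in> {1..n}" "j0 \<in> {1..n}"
    and lam: "lam \<ge> 0" and N: "N > 0" and z: "norm z = 1" "z ^ N = 1"
    and prim: "\<And>k. 0 < k \<Longrightarrow> k < N \<Longrightarrow> z ^ k \<noteq> 1"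
    and b: "(\<Sum>e\<in>A. b e) < N"
  defines "E \<equiv> insert (i0, j0) {e \<in> A. b e > 0}"
  defines "V \<equiv> fst ` E \<union> snd ` E"
  assumes c0: "c0 \<in> graph_components V E" "i0 \<in> c0"
  shows "norm (\<Sum>w\<in>copies. of_bool (near (i0, j0) (w 0)) * (\<Prod>e\<in>A. twisted_edge z lam w e ^ b e)) \<le>
    (lam * real N) ^ (\<Sum>e\<in>A. b e) *
      cnt (\<lambda>w. all_near E w \<and> (\<forall>c\<in>graph_components V E - {c0}. meet c (V - c) w))"
proof -
  let ?C = "graph_components V E"
  let ?L = "twisted_edge z lam"
  define \<Phi> where "\<Phi> w = of_bool (near (i0, j0) (w 0)) * (\<Prod>e\<in>A. ?L w e ^ b e)" for w
  define Fr where "Fr w = {c \<in> ?C - {c0}. \<not> meet c (V - c) w}" for w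
  have finA: "finite A" using A finite_subset by blast
  have EV: "E \<subseteq> V \<times> V" unfolding V_def by (auto simp: image_iff) (metis fst_conv snd_conv)+
  have V: "V \<subseteq> {1..n}" unfolding V_def E_def using A ij by auto
  have finV: "finite V" using V finite_subset by blast
  have finC: "finite ?C" using finV by (rule finite_components)
  have j0: "j0 \<in> c0"
    using component_closed[OF EV c0(1), of i0 j0] c0(2) by (simp add: E_def)
  define s where "s = (\<lambda>i. if i < N then if Suc i = N then 0 else Suc i else i)"
  have s: "s permutes {..<N}" unfolding s_def by (rule cyclic_shift_permutes)
  have z_s: "z ^ s i = z * z ^ i" if "i < N" for i
  proof (cases "Suc i = N")
    case True
    then have "z * z ^ i = z ^ N" by auto
    with True z(2) that show ?thesis by (simp add: s_def)
  qed (use that in \<open>simp add: s_def\<close>)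
  have vanish: "(\<Sum>w\<in>{w \<in> copies. Fr w = F0}. \<Phi> w) = 0" if F0: "F0 \<noteq> {}" "F0 \<subseteq> ?C - {c0}" for F0
  proof -
    obtain c where c: "c \<in> F0" using F0 by blast
    then have cC: "c \<in> ?C" "c \<noteq> c0" using F0 by auto
    have cV: "c \<subseteq> V" using component_subset[OF cC(1)] .
    have disj: "c \<inter> c0 = {}" using component_disj[OF cC(1) c0(1)] cC(2) by blast
    \<comment> \<open>The total multiplicity of the edges inside \<open>c\<close>. It lies between 1
      and \<open>N - 1\<close>, hence \<open>z ^ bc \<noteq> 1\<close>.\<close>
    define bc where "bc = (\<Sum>e\<in>A. if fst e \<in> c then b e else 0)"
    have edge: "\<Phi> w = z ^ bc * \<Phi> w'" "Fr w = Fr w'"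
      if w: "w \<in> copies" "w' \<in> copies" and sh: "shifted s c V w w'" for w w'
    proof -
      show "Fr w = Fr w'"
      proof -
        have "meet d (V - d) w' \<longleftrightarrow> meet d (V - d) w" if "d \<in> ?C" for d
          using component_subset[OF that] by (intro shifted_meet[OF s sh]) auto
        then show ?thesis unfolding Fr_def by (intro Collect_cong conj_cong refl) auto
      qed
      \<comment> \<open>The distinguished pair lies in \<open>c0\<close>, so its indicator at copy 0
        is untouched by the shift.\<close>
      have i0j0: "i0 \<in> V - c" "j0 \<in> V - c"
        using disj c0 j0 by (auto simp: V_def E_def)
      have "near (i0, j0) (w' 0) = near (i0, j0) (w 0)"
        using sh N i0j0 by (auto simp: near_def shifted_def)
      moreover have "?L w e ^ b e = z ^ (if fst e \<in> c then b e else 0) * ?L w' e ^ b e" if e: "e \<in> A" for e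
      proof (cases "b e = 0")
        case False
        then have eE: "e \<in> E" using e by (auto simp: E_def)
        obtain u v where uv: "e = (u, v)" by (cases e)
        have same: "u \<in> c \<longleftrightarrow> v \<in> c"
          using component_closed[OF EV cC(1)] eE uv by blast
        have uvV: "u \<in> V" "v \<in> V" using EV eE uv by auto
        show ?thesis
        proof (cases "u \<in> c")
          case True
          have "near e (w' i) = near e (w (s i))" if "i < N" for i
            using sh True same that unfolding shifted_def uv near_def by simp
          then have "z * ?L w' e = (\<Sum>i<N. z ^ s i * of_real (lam * of_bool (near e (w (s i)))))"
            unfolding twisted_edge_def sum_distrib_left by (intro sum.cong refl) (simp add: z_s)
          also have "\<dots> = ?L w e"
            unfolding twisted_edge_def
            by (rule sum.reindex_bij_betw[OF permutes_imp_bij[OF s]])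
          finally show ?thesis
            using True uv by (simp flip: power_mult_distrib)
        next
          case False
          have "near e (w' i) = near e (w i)" if "i < N" for i
            using sh False same that uvV unfolding shifted_def uv near_def by simp
          then have "?L w' e = ?L w e"
            unfolding twisted_edge_def by (intro sum.cong refl) simp
          with False uv show ?thesis by simp
        qed
      qed simp
      ultimately show "\<Phi> w = z ^ bc * \<Phi> w'"
        unfolding \<Phi>_def bc_def by (simp add: prod.distrib power_sum mult_ac cong: prod.cong)
    qed
    have "bc \<le> (\<Sum>e\<in>A. b e)"
      unfolding bc_def by (intro sum_mono) auto
    moreover have "bc > 0"
    proof -
      obtain u where u: "u \<in> c" using component_nonempty[OF cC(1)] by blast
      then obtain e where e: "e \<in> E" "u = fst e \<or> u = snd e" using cV by (auto simp: V_def)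
      have "fst e \<in> c"
        using component_closed[OF EV cC(1), of "fst e" "snd e"] e u by auto
      moreover from this have "e \<noteq> (i0, j0)" using disj c0 by auto
      ultimately have "e \<in> A" "(if fst e \<in> c then b e else 0) > 0"
        using e by (auto simp: E_def)
      then show ?thesis
        unfolding bc_def using finA by (metis (no_types, lifting) gr0I less_numeral_extra(3) sum_eq_0_iff)
    qed
    ultimately have "z ^ bc \<noteq> 1" using prim[of bc] b by linarith
    \<comment> \<open>The indicator of the class is put into the summand, because the shift lemma
      sums over all configurations in which \<open>c\<close> is free.\<close>
    then have "(\<Sum>w\<in>{w \<in> copies. \<not> meet c (V - c) w}. if Fr w = F0 then \<Phi> w else 0) = 0"
      by (intro sum_eq_0_by_shift[OF V cV s, where a = "z ^ bc"]) (auto simp: edge)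
    also have "(\<Sum>w\<in>{w \<in> copies. \<not> meet c (V - c) w}. if Fr w = F0 then \<Phi> w else 0) =
        (\<Sum>w\<in>{w \<in> copies. Fr w = F0}. \<Phi> w)"
      by (rule sum.mono_neutral_cong_right) (use c in \<open>auto simp: Fr_def\<close>)
    finally show ?thesis .
  qed
  have "sum \<Phi> copies = (\<Sum>F0\<in>Pow (?C - {c0}). \<Sum>w\<in>{w \<in> copies. Fr w = F0}. \<Phi> w)"
    by (rule sum.group[symmetric]) (use finC in \<open>auto simp: Fr_def\<close>)
  also have "\<dots> = (\<Sum>F0\<in>{{}}. \<Sum>w\<in>{w \<in> copies. Fr w = F0}. \<Phi> w)"
    by (rule sum.mono_neutral_right) (use finC vanish in auto)
  finally have "sum \<Phi> copies = (\<Sum>w\<in>{w \<in> copies. Fr w = {}}. \<Phi> w)" by simp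
  also have "norm \<dots> \<le> (\<Sum>w\<in>{w \<in> copies. Fr w = {}}. if all_near E w then (lam * real N) ^ (\<Sum>e\<in>A. b e) else 0)"
  proof (rule sum_norm_le)
    fix w
    have prod: "norm (\<Prod>e\<in>A. ?L w e ^ b e) \<le> (\<Prod>e\<in>A. (if \<exists>i<N. near e (w i) then lam * real N else 0) ^ b e)"
      unfolding prod_norm[symmetric] norm_power
      by (intro prod_mono conjI power_mono norm_twisted_edge_le lam z) auto
    show "norm (\<Phi> w) \<le> (if all_near E w then (lam * real N) ^ (\<Sum>e\<in>A. b e) else 0)"
    proof (cases "all_near E w")
      case True
      have "(\<Prod>e\<in>A. (if \<exists>i<N. near e (w i) then lam * real N else 0) ^ b e) = (\<Prod>e\<in>A. (lam * real N) ^ b e)"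
      proof (intro prod.cong refl)
        fix e assume e: "e \<in> A"
        show "(if \<exists>i<N. near e (w i) then lam * real N else 0) ^ b e = (lam * real N) ^ b e"
        proof (cases "b e = 0")
          case False
          with e have "e \<in> E" by (simp add: E_def)
          with True have "\<exists>i<N. near e (w i)" unfolding all_near_def by (rule bspec)
          then show ?thesis by (simp only: if_P)
        qed simp
      qed
      then have "norm (\<Prod>e\<in>A. ?L w e ^ b e) \<le> (lam * real N) ^ (\<Sum>e\<in>A. b e)"
        using prod by (simp add: power_sum)
      then show ?thesis
        using True lam by (auto simp: \<Phi>_def norm_mult)
    next
      case False
      then consider "\<not> (\<exists>i<N. near (i0, j0) (w i))" | e where "e \<in> A" "b e > 0" "\<not> (\<exists>i<N. near e (w i))"
        unfolding all_near_def E_def by blast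
      then have "\<Phi> w = 0"
      proof cases
        case 1
        then show ?thesis using N by (simp add: \<Phi>_def)
      next
        case 2
        then have "?L w e ^ b e = 0"
          by (simp add: twisted_edge_def)
        then have "(\<Prod>e\<in>A. ?L w e ^ b e) = 0"
          using 2 finA by (intro prod_zero) auto
        then show ?thesis by (simp add: \<Phi>_def)
      qed
      with False show ?thesis by simp
    qed
  qed
  also have "\<dots> = (\<Sum>w\<in>{w \<in> copies. Fr w = {} \<and> all_near E w}. (lam * real N) ^ (\<Sum>e\<in>A. b e))"
    by (rule sum.mono_neutral_cong_right) auto
  also have "\<dots> = (lam * real N) ^ (\<Sum>e\<in>A. b e) * cnt (\<lambda>w. Fr w = {} \<and> all_near E w)"
    by (simp add: cnt_def)
  also have "\<dots> \<le> (lam * real N) ^ (\<Sum>e\<in>A. b e) *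
      cnt (\<lambda>w. all_near E w \<and> (\<forall>c\<in>?C - {c0}. meet c (V - c) w))"
    using lam by (intro mult_left_mono cnt_mono) (auto simp: Fr_def)
  finally show ?thesis by (simp only: \<Phi>_def[abs_def])
qed

end

section \<open>Bounds on the cumulants\<close>

lemma card_le_edges_add_components:
  assumes E: "E \<subseteq> V \<times> V" and fin: "finite V"
  shows "card V \<le> card E + card (graph_components V E)"
proof -
  have finE: "finite E" using E fin finite_subset by (metis finite_SigmaI)
  have grow: "card (V - A) \<le> card {e \<in> E. \<not> (fst e \<in> A \<and> snd e \<in> A)}"
    if "A \<subseteq> V" "\<And>A'. A \<subseteq> A' \<Longrightarrow> A' \<subset> V \<Longrightarrow> \<exists>u\<in>A'. \<exists>v\<in>V - A'. (u, v) \<in> E \<or> (v, u) \<in> E" for A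
    using that
  proof (induction "card (V - A)" arbitrary: A)
    case 0
    show ?case unfolding 0(1)[symmetric] by simp
  next
    case (Suc k)
    have "A \<subset> V" using Suc.prems(1) Suc.hyps(2) by auto
    then obtain u v where uv: "u \<in> A" "v \<in> V - A" "(u, v) \<in> E \<or> (v, u) \<in> E"
      using Suc.prems(2)[of A] by blast
    let ?out = "\<lambda>A. {e \<in> E. \<not> (fst e \<in> A \<and> snd e \<in> A)}"
    have "V - insert v A = (V - A) - {v}" by blast
    then have k: "k = card (V - insert v A)"
      using card_Diff_singleton[OF uv(2)] Suc.hyps(2) by simp
    have "card (V - insert v A) \<le> card (?out (insert v A))"
    proof (rule Suc.hyps(1)[OF k])
      show "insert v A \<subseteq> V" using Suc.prems(1) uv by blast
      show "\<exists>u\<in>A'. \<exists>v\<in>V - A'. (u, v) \<in> E \<or> (v, u) \<in> E" if "insert v A \<subseteq> A'" "A' \<subset> V" for A'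
        using Suc.prems(2)[of A'] that by blast
    qed
    also have "card (?out (insert v A)) < card (?out A)"
    proof (rule psubset_card_mono)
      obtain e where e: "e \<in> E" "e = (u, v) \<or> e = (v, u)" using uv(3) by blast
      have "e \<in> ?out A" "e \<notin> ?out (insert v A)" using e uv by auto
      moreover have "?out (insert v A) \<subseteq> ?out A" by auto
      ultimately show "?out (insert v A) \<subset> ?out A" by blast
    qed (use finE in simp)
    finally show ?case using k Suc.hyps(2) by linarith
  qed
  define root where "root c = (SOME u. u \<in> c)" for c :: "'a set"
  have root: "root c \<in> c" if "c \<in> graph_components V E" for c
    using component_nonempty[OF that] unfolding root_def by (simp add: some_in_eq)
  let ?A = "root ` graph_components V E"
  have AV: "?A \<subseteq> V"
    using root component_subset by blast
  have "card (V - ?A) \<le> card {e \<in> E. \<not> (fst e \<in> ?A \<and> snd e \<in> ?A)}"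
  proof (rule grow[OF AV])
    fix A' assume A': "?A \<subseteq> A'" "A' \<subset> V"
    then obtain v where v: "v \<in> V" "v \<notin> A'" by blast
    then obtain c where c: "c \<in> graph_components V E" "v \<in> c"
      using Union_components[of V E] by blast
    have "\<exists>a\<in>A' \<inter> c. \<exists>b\<in>c - A'. (a, b) \<in> E \<or> (b, a) \<in> E"
      by (rule component_expand[OF E c(1) root[OF c(1)]]) (use A' c v in auto)
    then show "\<exists>u\<in>A'. \<exists>v\<in>V - A'. (u, v) \<in> E \<or> (v, u) \<in> E"
      using component_subset[OF c(1)] by blast
  qed
  also have "\<dots> \<le> card E"
    using finE by (intro card_mono) auto
  finally have "card (V - ?A) \<le> card E" .
  moreover have "card ?A \<le> card (graph_components V E)"
    by (rule card_image_le[OF finite_components[OF fin]])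
  moreover have "card V = card (V - ?A) + card ?A"
    using card_Diff_subset[OF finite_subset[OF AV fin] AV] card_mono[OF fin AV] by simp
  ultimately show ?thesis by linarith
qed

text \<open>Each vertex lies on an edge that is not a loop, so no component is a single point.
  Together with \<open>card_le_edges_add_components\<close> this bounds the number of further
  components by the weight of the multi-index.\<close>

lemma two_components_le_card:
  assumes E: "E \<subseteq> V \<times> V" and fin: "finite V" and irr: "\<And>e. e \<in> E \<Longrightarrow> fst e \<noteq> snd e"
    and V: "V = fst ` E \<union> snd ` E"
  shows "2 * card (graph_components V E) \<le> card V"
proof -
  have "1 \<le> card c - 1" if c: "c \<in> graph_components V E" for c
  proof -
    obtain u where u: "u \<in> c" using component_nonempty[OF c] by blast
    then obtain e where e: "e \<in> E" "u = fst e \<or> u = snd e"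
      using component_subset[OF c] V by blast
    have "fst e \<in> c" "snd e \<in> c"
      using component_closed[OF E c, of "fst e" "snd e"] e u by auto
    moreover have "finite c" using component_subset[OF c] fin finite_subset by blast
    ultimately have "card {fst e, snd e} \<le> card c" by (intro card_mono) auto
    then show ?thesis using irr[OF e(1)] by simp
  qed
  then have "(\<Sum>c\<in>graph_components V E. 1) \<le> (\<Sum>c\<in>graph_components V E. card c - 1)"
    by (rule sum_mono)
  then have "card (graph_components V E) \<le> (\<Sum>c\<in>graph_components V E. card c - 1)"
    by simp
  then show ?thesis using sum_card_components[OF fin, of E] by linarith
qed

text \<open>
  Here \<open>r + 1\<close> is the number of components and \<open>k\<close> the number of vertices; the colliding
  components contribute \<open>n\<close> to a power of at most \<open>-r / 2\<close>, which is one factor \<open>n powr (-1/2)\<close> per component.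
\<close>

lemma squared_bound_arith:
  fixes n N \<rho> lam Y :: real and k r s :: nat and \<R> :: "'a set set"
  assumes n: "n \<ge> 1" and N: "N \<ge> 1" and lam: "lam \<ge> 0" and Y: "Y \<ge> 0" and \<rho>: "\<rho> \<ge> 0"
    and kr: "r + 2 \<le> k" and ks: "k \<le> s + r + 2" and rs: "r \<le> s"
    and kN: "real k \<le> 2 * N"
    and \<R>: "card \<R> \<le> 2 ^ r" "\<And>R. R \<in> \<R> \<Longrightarrow> r \<le> 2 * card R \<and> card R \<le> r"
    and bound: "Y \<le> (lam * N) ^ s * (\<Sum>R\<in>\<R>. (N\<^sup>2 * (real k)\<^sup>2 / (n / 2)) ^ card R * (2 * \<rho> * N / (n / 2)) ^ (k - (r + 1)))"
  shows "Y\<^sup>2 \<le> 16 * N\<^sup>2 * \<rho>\<^sup>2 / n\<^sup>2 * (lam\<^sup>2 * 2 ^ 10 * N ^ 12 * max 1 (4 * \<rho>\<^sup>2 / n)) ^ s / n ^ (k - 2)"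
proof -
  define p where "p = 4 * \<rho> * N / n"
  \<comment> \<open>The spanning forest has \<open>e + 1\<close> edges. One edge factor
    \<open>p\<close> is set aside, and its square becomes the prefactor of the bound.\<close>
  define e where "e = k - 2 - r"
  define G where "G = max 1 (4 * \<rho>\<^sup>2 / n)"
  have p: "2 * \<rho> * N / (n / 2) = p" "p \<ge> 0" using n N \<rho> by (auto simp: p_def)
  have e: "k - (r + 1) = e + 1" "e \<le> s" "k - 2 = r + e" using kr ks by (auto simp: e_def)
  have N1: "1 \<le> N ^ j" for j using N by (rule one_le_power)
  \<comment> \<open>After squaring, the collision factor has \<open>n\<close> to the power -2
    \<open>card R\<close>, which is at most \<open>n\<close> to the power -\<open>r\<close>; the
    numerator is at least 1, so there \<open>card R\<close> may be raised to
    \<open>r\<close>.\<close>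
  have q_le: "(N\<^sup>2 * (real k)\<^sup>2 / (n / 2)) ^ card R \<le> sqrt ((64 * N ^ 8 / n) ^ r)" if R: "R \<in> \<R>" for R
  proof (rule real_le_rsqrt)
    have "(real k)\<^sup>2 \<le> (2 * N)\<^sup>2" using kN N by (intro power_mono) auto
    then have "N\<^sup>2 * (real k)\<^sup>2 \<le> N\<^sup>2 * (4 * N\<^sup>2)"
      using N by (intro mult_left_mono) (auto simp: power_mult_distrib)
    then have "N\<^sup>2 * (real k)\<^sup>2 / (n / 2) \<le> N\<^sup>2 * (4 * N\<^sup>2) / (n / 2)"
      using n by (intro divide_right_mono) auto
    also have "\<dots> = 8 * N ^ 4 / n"
      by (simp add: power2_eq_square power4_eq_xxxx)
    finally have "((N\<^sup>2 * (real k)\<^sup>2 / (n / 2)) ^ card R)\<^sup>2 \<le> ((8 * N ^ 4 / n) ^ card R)\<^sup>2"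
      using n by (intro power_mono) auto
    also have "\<dots> = (64 * N ^ 8) ^ card R * (1 / n) ^ (2 * card R)"
      by (simp add: power_mult_distrib power_divide power_mult[symmetric] mult.commute[of _ 2] power_mult[of 8 2])
    also have "\<dots> \<le> (64 * N ^ 8) ^ r * (1 / n) ^ r"
    proof (intro mult_mono)
      show "(64 * N ^ 8) ^ card R \<le> (64 * N ^ 8) ^ r"
        using \<R>(2)[OF R] N1[of 8] by (intro power_increasing) auto
      show "(1 / n) ^ (2 * card R) \<le> (1 / n) ^ r"
        using \<R>(2)[OF R] n by (intro power_decreasing) auto
    qed (use N n in auto)
    also have "\<dots> = (64 * N ^ 8 / n) ^ r"
      by (simp add: power_mult_distrib power_divide)
    finally show "((N\<^sup>2 * (real k)\<^sup>2 / (n / 2)) ^ card R)\<^sup>2 \<le> (64 * N ^ 8 / n) ^ r" .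
  qed
  have "Y \<le> (lam * N) ^ s * (\<Sum>R\<in>\<R>. sqrt ((64 * N ^ 8 / n) ^ r) * p ^ (e + 1))"
    using bound unfolding p e
    by (rule order_trans) (use q_le p lam N in \<open>intro mult_left_mono sum_mono mult_right_mono zero_le_power; simp\<close>)
  also have "\<dots> = (lam * N) ^ s * (real (card \<R>) * (sqrt ((64 * N ^ 8 / n) ^ r) * p ^ (e + 1)))"
    by simp
  also have "\<dots> \<le> (lam * N) ^ s * (2 ^ r * (sqrt ((64 * N ^ 8 / n) ^ r) * p ^ (e + 1)))"
  proof (intro mult_left_mono mult_right_mono)
    show "real (card \<R>) \<le> 2 ^ r" using \<R>(1) by (metis of_nat_le_iff of_nat_numeral of_nat_power)
  qed (use p lam N n in auto)
  finally have "Y\<^sup>2 \<le> ((lam * N) ^ s * (2 ^ r * (sqrt ((64 * N ^ 8 / n) ^ r) * p ^ (e + 1))))\<^sup>2"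
    using Y by (intro power_mono)
  also have "\<dots> = ((lam * N) ^ s)\<^sup>2 * ((2 ^ r)\<^sup>2 * ((64 * N ^ 8 / n) ^ r * (p ^ (e + 1))\<^sup>2))"
    using n N by (simp add: power_mult_distrib)
  also have "\<dots> = (lam\<^sup>2 * N\<^sup>2) ^ s * ((256 * N ^ 8 / n) ^ r * (p\<^sup>2) ^ (e + 1))"
  proof -
    have "((lam * N) ^ s)\<^sup>2 = (lam\<^sup>2 * N\<^sup>2) ^ s" "(p ^ (e + 1))\<^sup>2 = (p\<^sup>2) ^ (e + 1)"
      by (simp_all add: power_mult_distrib power_mult[symmetric] mult.commute)
    moreover have "(2 ^ r)\<^sup>2 * (64 * N ^ 8 / n) ^ r = (256 * N ^ 8 / n) ^ r"
    proof -
      have "(2 ^ r)\<^sup>2 = (4 :: real) ^ r" by (simp add: power_mult[symmetric] mult.commute[of r] power_mult[of 2 2])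
      then show ?thesis by (simp flip: power_mult_distrib)
    qed
    ultimately show ?thesis by (simp add: mult.assoc[symmetric])
  qed
  also have "\<dots> = p\<^sup>2 * ((lam\<^sup>2 * N\<^sup>2) ^ s * ((256 * N ^ 8) ^ r * (16 * \<rho>\<^sup>2 * N\<^sup>2 / n) ^ e)) / n ^ (k - 2)"
  proof -
    \<comment> \<open>One factor 1/n of each squared edge factor goes into
      \<open>n ^ (k - 2)\<close>; what remains is controlled by
      \<open>\<rho>\<^sup>2 / n\<close>.\<close>
    have "p\<^sup>2 = (16 * \<rho>\<^sup>2 * N\<^sup>2 / n) / n"
      by (simp add: p_def power2_eq_square)
    then have "(p\<^sup>2) ^ (e + 1) = p\<^sup>2 * ((16 * \<rho>\<^sup>2 * N\<^sup>2 / n) ^ e / n ^ e)"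
      by (simp only: power_add power_one_right power_divide) (simp only: mult.commute)
    moreover have "(256 * N ^ 8 / n) ^ r = (256 * N ^ 8) ^ r / n ^ r"
      by (rule power_divide)
    ultimately show ?thesis
      unfolding e(3) power_add by (simp only: times_divide_eq_left times_divide_eq_right divide_divide_eq_left mult_ac)
  qed
  \<comment> \<open>Both exponents \<open>r\<close> and \<open>e\<close> are raised to
    \<open>s\<close>. This needs bases of at least 1, which the maximum in \<open>G\<close>
    guarantees for the second.\<close>
  also have "\<dots> \<le> p\<^sup>2 * ((lam\<^sup>2 * N\<^sup>2) ^ s * ((256 * N ^ 8) ^ s * (4 * N\<^sup>2 * G) ^ s)) / n ^ (k - 2)"
  proof (intro divide_right_mono mult_left_mono mult_mono)
    show "(256 * N ^ 8) ^ r \<le> (256 * N ^ 8) ^ s"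
      using rs N1[of 8] by (intro power_increasing) auto
    have "16 * \<rho>\<^sup>2 * N\<^sup>2 / n = 4 * N\<^sup>2 * (4 * \<rho>\<^sup>2 / n)" by simp
    also have "\<dots> \<le> 4 * N\<^sup>2 * G"
      unfolding G_def by (intro mult_left_mono) auto
    finally have "(16 * \<rho>\<^sup>2 * N\<^sup>2 / n) ^ e \<le> (4 * N\<^sup>2 * G) ^ e"
      using n by (intro power_mono) auto
    also have "\<dots> \<le> (4 * N\<^sup>2 * G) ^ s"
    proof (rule power_increasing[OF e(2)])
      have "1 * 1 \<le> (4 * N\<^sup>2) * G"
        using N1[of 2] by (intro mult_mono) (auto simp: G_def)
      then show "1 \<le> 4 * N\<^sup>2 * G" by simp
    qed
    finally show "(16 * \<rho>\<^sup>2 * N\<^sup>2 / n) ^ e \<le> (4 * N\<^sup>2 * G) ^ s" .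
  qed (use n N in auto)
  also have "\<dots> = p\<^sup>2 * (lam\<^sup>2 * N\<^sup>2 * (256 * N ^ 8 * (4 * N\<^sup>2 * G))) ^ s / n ^ (k - 2)"
    by (simp only: power_mult_distrib)
  \<comment> \<open>Here 256 is 64 times the squared 2 per component that counts the sets
    \<open>R\<close>; with the factor 4 it gives 2^10.\<close>
  also have "lam\<^sup>2 * N\<^sup>2 * (256 * N ^ 8 * (4 * N\<^sup>2 * G)) = lam\<^sup>2 * 2 ^ 10 * N ^ 12 * G"
    by (simp add: power2_eq_square eval_nat_numeral)
  also have "p\<^sup>2 = 16 * N\<^sup>2 * \<rho>\<^sup>2 / n\<^sup>2"
    by (simp add: p_def power2_eq_square)
  finally show ?thesis by (simp only: G_def)
qed

context permutation_copies
begin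

definition perms :: "(nat \<Rightarrow> nat) set" where
  "perms = {p. p permutes {1..n}}"

text \<open>The estimated entry enters through its indicator alone; its factor \<open>lam\<close> is
  restored in \<open>entry_risk_ge\<close>. The zero index thus gives a probability.\<close>

definition edge_cumulant :: "complex \<Rightarrow> real \<Rightarrow> nat \<times> nat \<Rightarrow> (nat \<times> nat) set \<Rightarrow> (nat \<times> nat \<Rightarrow> nat) \<Rightarrow> complex" where
  "edge_cumulant z lam e0 =
     twisted_cumulant N z perms (\<lambda>p. of_bool (near e0 p)) (\<lambda>p e. of_real (lam * of_bool (near e p)))"

definition vertices :: "nat \<times> nat \<Rightarrow> (nat \<times> nat) set \<Rightarrow> (nat \<times> nat \<Rightarrow> nat) \<Rightarrow> nat set" where
  "vertices e0 A b = (let E = insert e0 {e \<in> A. b e > 0} in fst ` E \<union> snd ` E)"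

lemma cnt_True: "cnt (\<lambda>_. True) = real (card perms) ^ N"
  unfolding cnt_def copies_def perms_def by (simp add: card_PiE)

lemma perms_finite: "finite perms" and perms_nonempty: "perms \<noteq> {}"
  unfolding perms_def by (auto intro: finite_permutations permutes_id)

lemma card_vertices_le:
  assumes "finite A"
  shows "card (vertices e0 A b) \<le> 2 * ((\<Sum>e\<in>A. b e) + 1)"
    and "card (insert e0 {e \<in> A. b e > 0}) \<le> (\<Sum>e\<in>A. b e) + 1"
proof -
  have "card {e \<in> A. b e > 0} = (\<Sum>e\<in>{e \<in> A. b e > 0}. 1)" by simp
  also have "\<dots> \<le> (\<Sum>e\<in>{e \<in> A. b e > 0}. b e)" by (intro sum_mono) auto
  also have "\<dots> \<le> (\<Sum>e\<in>A. b e)" using assms by (intro sum_mono2) auto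
  finally have *: "card {e \<in> A. b e > 0} \<le> (\<Sum>e\<in>A. b e)" .
  then show E: "card (insert e0 {e \<in> A. b e > 0}) \<le> (\<Sum>e\<in>A. b e) + 1"
    using assms by (simp add: card_insert_if)
  have "card (vertices e0 A b) \<le> card (fst ` insert e0 {e \<in> A. b e > 0}) + card (snd ` insert e0 {e \<in> A. b e > 0})"
    unfolding vertices_def Let_def by (rule card_Un_le)
  also have "\<dots> \<le> card (insert e0 {e \<in> A. b e > 0}) + card (insert e0 {e \<in> A. b e > 0})"
    using assms by (intro add_mono card_image_le) auto
  finally show "card (vertices e0 A b) \<le> 2 * ((\<Sum>e\<in>A. b e) + 1)"
    using E by simp
qed

lemma edge_cumulant_square_le:
  assumes A: "A \<subseteq> {1..n} \<times> {1..n}" and ij: "i0 \<in> {1..n}" "j0 \<in> {1..n}" "i0 \<noteq> j0"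
    and lam: "lam \<ge> 0" and N: "N > 0" and z: "norm z = 1" "z ^ N = 1"
    and prim: "\<And>k. 0 < k \<Longrightarrow> k < N \<Longrightarrow> z ^ k \<noteq> 1"
    and b: "(\<Sum>e\<in>A. b e) < N" and irr: "\<And>e. e \<in> A \<Longrightarrow> b e > 0 \<Longrightarrow> fst e \<noteq> snd e"
    and n: "n \<ge> 2 * (2 * N)\<^sup>2"
  shows "(norm (edge_cumulant z lam (i0, j0) A b))\<^sup>2 \<le>
    16 * (real N)\<^sup>2 * (real \<rho>)\<^sup>2 / (real n)\<^sup>2 *
      (lam\<^sup>2 * 2 ^ 10 * real N ^ 12 * max 1 (4 * (real \<rho>)\<^sup>2 / real n)) ^ (\<Sum>e\<in>A. b e) /
      real n ^ (card (vertices (i0, j0) A b) - 2)"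
proof -
  define E where "E = insert (i0, j0) {e \<in> A. b e > 0}"
  define V where "V = fst ` E \<union> snd ` E"
  have V_eq: "vertices (i0, j0) A b = V" by (simp add: vertices_def E_def V_def)
  let ?C = "graph_components V E" and ?s = "\<Sum>e\<in>A. b e"
  have finA: "finite A" using A finite_subset by blast
  have EV: "E \<subseteq> V \<times> V" unfolding V_def by (auto simp: image_iff) (metis fst_conv snd_conv)+
  have V: "V \<subseteq> {1..n}" unfolding V_def E_def using A ij by auto
  have finV: "finite V" using V finite_subset by blast
  have "i0 \<in> V" by (simp add: V_def E_def)
  then obtain c0 where c0: "c0 \<in> ?C" "i0 \<in> c0"
    using Union_components[of V E] by blast
  have finC: "finite ?C" using finV by (rule finite_components)
  then have C_pos: "card ?C > 0" using c0(1) by (auto simp: card_gt_0_iff)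
  define r where "r = card ?C - 1"
  have kV: "card V \<le> 2 * (?s + 1)" "card E \<le> ?s + 1"
    using card_vertices_le[OF finA, of "(i0, j0)" b] by (simp_all add: V_eq E_def)
  have k2N: "card V \<le> 2 * N" using kV(1) b by auto
  have irrE: "fst e \<noteq> snd e" if "e \<in> E" for e
    using that irr ij(3) by (auto simp: E_def)
  have two: "2 * (r + 1) \<le> card V"
    using two_components_le_card[OF EV finV irrE V_def] C_pos by (simp add: r_def)
  \<comment> \<open>Besides the edges from \<open>b\<close>, at most \<open>?s\<close> of them,
    \<open>E\<close> contains the distinguished pair.\<close>
  have ks: "card V \<le> ?s + r + 2"
    using card_le_edges_add_components[OF EV finV] kV(2) C_pos by (simp add: r_def)
  \<comment> \<open>At most \<open>2 * N\<close> vertices are exposed, and the lower bound on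
    \<open>n\<close> leaves at least half of all positions available.\<close>
  have m: "0 < real n / 2" "real n / 2 + real (card V) \<le> real n"
  proof -
    have "2 * (2 * N) \<le> 2 * (2 * N)\<^sup>2" using N by (simp add: power2_eq_square)
    then have "2 * card V \<le> n" using k2N n by linarith
    then show "real n / 2 + real (card V) \<le> real n" by linarith
    show "0 < real n / 2" using ij by simp
  qed
  let ?\<R> = "{R. R \<subseteq> ?C - {c0} \<and> card ?C - 1 \<le> 2 * card R}"
  let ?sum = "\<Sum>R\<in>?\<R>. ((real N)\<^sup>2 * (real (card V))\<^sup>2 / (real n / 2)) ^ card R *
       (2 * real \<rho> * real N / (real n / 2)) ^ (card V - card ?C)"
  let ?P = "real (card perms) ^ N"
  have P: "?P > 0" using perms_finite perms_nonempty by (simp add: card_gt_0_iff)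
  have "norm (\<Sum>w\<in>copies. of_bool (near (i0, j0) (w 0)) * (\<Prod>e\<in>A. twisted_edge z lam w e ^ b e)) \<le>
      (lam * real N) ^ ?s * cnt (\<lambda>w. all_near E w \<and> (\<forall>c\<in>?C - {c0}. meet c (V - c) w))"
    using norm_twisted_sum_le[OF A ij(1,2) lam N z prim b, of c0] c0 by (simp only: E_def V_def)
  also have "\<dots> \<le> (lam * real N) ^ ?s * (?sum * ?P)"
  proof (rule mult_left_mono)
    show "cnt (\<lambda>w. all_near E w \<and> (\<forall>c\<in>?C - {c0}. meet c (V - c) w)) \<le> ?sum * ?P"
      using count_no_free_component[OF EV V m c0(1)] by (simp only: sum_distrib_right cnt_True)
  qed (use lam in simp)
  finally have "norm (edge_cumulant z lam (i0, j0) A b) \<le> (lam * real N) ^ ?s * ?sum"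
    using P unfolding edge_cumulant_def twisted_cumulant_def copies_def twisted_edge_def perms_def
    by (simp add: norm_divide norm_power field_simps)
  then have "(norm (edge_cumulant z lam (i0, j0) A b))\<^sup>2 \<le>
    16 * (real N)\<^sup>2 * (real \<rho>)\<^sup>2 / (real n)\<^sup>2 *
      (lam\<^sup>2 * 2 ^ 10 * real N ^ 12 * max 1 (4 * (real \<rho>)\<^sup>2 / real n)) ^ ?s / real n ^ (card V - 2)"
  proof (intro squared_bound_arith[where \<R> = ?\<R> and r = r])
    have "card ?C = r + 1" using C_pos by (simp add: r_def)
    then show "norm (edge_cumulant z lam (i0, j0) A b) \<le> (lam * real N) ^ ?s * ?sum \<Longrightarrow>
      norm (edge_cumulant z lam (i0, j0) A b) \<le> (lam * real N) ^ ?s *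
       (\<Sum>R\<in>?\<R>. ((real N)\<^sup>2 * (real (card V))\<^sup>2 / (real n / 2)) ^ card R *
       (2 * real \<rho> * real N / (real n / 2)) ^ (card V - (r + 1)))" by simp
    have card_C0: "card (?C - {c0}) = r" using c0 by (simp add: r_def)
    have "card ?\<R> \<le> card (Pow (?C - {c0}))"
      using finC by (intro card_mono) auto
    then show "card ?\<R> \<le> 2 ^ r"
      using finC card_C0 by (simp add: card_Pow)
    show "r \<le> 2 * card R \<and> card R \<le> r" if "R \<in> ?\<R>" for R
      using that card_mono[of "?C - {c0}" R] finC card_C0 by (auto simp: r_def)
  qed (use two ks k2N N lam ij in auto)
  then show ?thesis by (simp only: V_eq)
qed

end

section \<open>Counting multi-indices and vertex sets\<close>

text \<open>Lowering a positive coordinate by 1 leads from weight \<open>s + 1\<close> to weight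
  \<open>s\<close>, with at most \<open>card U\<close> choices of the coordinate.\<close>

lemma
  fixes A U :: "'v set"
  assumes U: "finite U"
  defines "S \<equiv> \<lambda>s. {b \<in> PiE A (\<lambda>_. UNIV :: nat set). (\<Sum>e\<in>A. b e) = s \<and> (\<forall>e\<in>A. b e > 0 \<longrightarrow> e \<in> U)}"
  assumes A: "finite A"
  shows finite_indices_supported: "finite (S s)"
    and card_indices_supported: "card (S s) \<le> card U ^ s"
proof -
  have "finite (S s) \<and> card (S s) \<le> card U ^ s"
  proof (induction s)
    case 0
    have "S 0 \<subseteq> {\<lambda>e\<in>A. 0}"
    proof
      fix b assume "b \<in> S 0"
      then show "b \<in> {\<lambda>e\<in>A. 0}"
        using A by (auto simp: S_def PiE_iff extensional_def fun_eq_iff)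
    qed
    then show ?case
      using card_mono[of "{\<lambda>e\<in>A. 0}" "S 0"] finite_subset[of "S 0" "{\<lambda>e\<in>A. 0}"] by simp
  next
    case (Suc s)
    let ?T = "\<Union>e\<in>U. (\<lambda>b. b(e := Suc (b e))) ` S s"
    have sub: "S (Suc s) \<subseteq> ?T"
    proof
      fix b assume b: "b \<in> S (Suc s)"
      then have "(\<Sum>e\<in>A. b e) \<noteq> 0" by (simp add: S_def)
      then obtain e where e: "e \<in> A" "b e > 0" by (meson gr0I sum.neutral)
      have eU: "e \<in> U" using b e by (simp add: S_def)
      let ?b = "b(e := b e - 1)"
      have "(\<Sum>x\<in>A. b x) = b e + (\<Sum>x\<in>A - {e}. b x)" "(\<Sum>x\<in>A. ?b x) = ?b e + (\<Sum>x\<in>A - {e}. ?b x)"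
        using A e by (simp_all add: sum.remove)
      moreover have "(\<Sum>x\<in>A - {e}. ?b x) = (\<Sum>x\<in>A - {e}. b x)"
        by (intro sum.cong) auto
      ultimately have "(\<Sum>x\<in>A. ?b x) = s"
        using b e by (simp add: S_def)
      then have "?b \<in> S s"
        using b e by (auto simp: S_def PiE_iff extensional_def)
      moreover have "b = ?b(e := Suc (?b e))" using e by auto
      ultimately show "b \<in> ?T" using eU by blast
    qed
    have fin: "finite ?T" using U Suc by blast
    have "card (S (Suc s)) \<le> card ?T" by (rule card_mono[OF fin sub])
    also have "\<dots> \<le> (\<Sum>e\<in>U. card ((\<lambda>b. b(e := Suc (b e))) ` S s))" by (rule card_UN_le[OF U])
    also have "\<dots> \<le> (\<Sum>e\<in>U. card U ^ s)"
      using Suc by (intro sum_mono) (meson card_image_le le_trans)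
    finally show ?case using finite_subset[OF sub fin] by simp
  qed
  then show "finite (S s)" "card (S s) \<le> card U ^ s" by blast+
qed

lemma sum_geometric_le:
  fixes x :: real
  assumes "0 \<le> x" "x < 1"
  shows "(\<Sum>s=1..D. x ^ s) \<le> x / (1 - x)"
proof -
  have "(\<Sum>s=1..D. x ^ s) = x * (\<Sum>s<D. x ^ s)"
    unfolding sum_distrib_left
    by (rule sum.reindex_bij_witness[of _ Suc "\<lambda>s. s - 1"]) (auto simp flip: power_Suc)
  also have "(\<Sum>s<D. x ^ s) = (1 - x ^ D) / (1 - x)"
    using assms by (simp add: sum_gp_strict)
  also have "\<dots> \<le> 1 / (1 - x)"
    using assms by (intro divide_right_mono) auto
  finally show ?thesis using assms by (simp add: mult_left_mono)
qed

text \<open>Without the pair, a set of size \<open>m\<close> has weight \<open>1 / n ^ m\<close>,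
  and there are at most \<open>n ^ m\<close> of them. Each of the \<open>M + 1\<close> sizes
  contributes at most 1.\<close>

lemma sum_supersets_of_pair:
  assumes n: "n > 0" and ij: "i \<noteq> j"
  shows "(\<Sum>V\<in>{V. V \<subseteq> {1..n} \<and> i \<in> V \<and> j \<in> V \<and> card V \<le> M}. 1 / real n ^ (card V - 2)) \<le> real M + 1"
proof -
  let ?W = "{U. U \<subseteq> {1..n} \<and> card U \<le> M}"
  have card2: "card (V - {i, j}) = card V - 2" if "i \<in> V" "j \<in> V" for V
    using that ij by (subst card_Diff_subset) auto
  have "(\<Sum>V\<in>{V. V \<subseteq> {1..n} \<and> i \<in> V \<and> j \<in> V \<and> card V \<le> M}. 1 / real n ^ (card V - 2)) =
      (\<Sum>U\<in>(\<lambda>V. V - {i, j}) ` {V. V \<subseteq> {1..n} \<and> i \<in> V \<and> j \<in> V \<and> card V \<le> M}. 1 / real n ^ card U)"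
  proof (subst sum.reindex)
    show "inj_on (\<lambda>V. V - {i, j}) {V. V \<subseteq> {1..n} \<and> i \<in> V \<and> j \<in> V \<and> card V \<le> M}"
      by (rule inj_onI) blast
  qed (auto intro!: sum.cong simp: card2)
  also have "\<dots> \<le> (\<Sum>U\<in>?W. 1 / real n ^ card U)"
  proof (rule sum_mono2)
    show "(\<lambda>V. V - {i, j}) ` {V. V \<subseteq> {1..n} \<and> i \<in> V \<and> j \<in> V \<and> card V \<le> M} \<subseteq> ?W"
      using card2 by force
  qed auto
  also have "\<dots> = (\<Sum>m\<le>M. \<Sum>U\<in>{U \<in> ?W. card U = m}. 1 / real n ^ card U)"
    by (rule sum.group[symmetric]) auto
  also have "\<dots> \<le> (\<Sum>m\<le>M. 1)"
  proof (rule sum_mono)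
    fix m assume m: "m \<in> {..M}"
    have "(\<Sum>U\<in>{U \<in> ?W. card U = m}. 1 / real n ^ card U) = real (card {U. U \<subseteq> {1..n} \<and> card U = m}) / real n ^ m"
    proof -
      have "{U \<in> ?W. card U = m} = {U. U \<subseteq> {1..n} \<and> card U = m}" using m by auto
      then show ?thesis by simp
    qed
    also have "\<dots> = real (n choose m) / real n ^ m"
      by (simp add: n_subsets)
    also have "\<dots> \<le> 1"
    proof (cases "m \<le> n")
      case True
      then have "real (n choose m) \<le> real (n ^ m)"
        using binomial_le_pow by (simp only: of_nat_le_iff)
      then show ?thesis using n by simp
    qed (simp add: binomial_eq_0)
    finally show "(\<Sum>U\<in>{U \<in> ?W. card U = m}. 1 / real n ^ card U) \<le> 1" .
  qed
  finally show ?thesis by simp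
qed

context permutation_copies
begin

lemma edge_cumulant_zero_index:
  assumes "N > 0" "\<And>e. e \<in> A \<Longrightarrow> b e = 0"
  shows "edge_cumulant z lam e0 A b = of_real ((\<Sum>p\<in>perms. of_bool (near e0 p)) / real (card perms))"
proof -
  have P: "card perms > 0" using perms_finite perms_nonempty by (simp add: card_gt_0_iff)
  have eq: "{..<N} = insert 0 {1..<N}" using assms(1) by auto
  have "(\<Sum>w\<in>PiE {..<N} (\<lambda>_. perms). of_bool (near e0 (w 0)) :: complex) =
      (\<Sum>p\<in>perms. \<Sum>w\<in>PiE {1..<N} (\<lambda>_. perms). of_bool (near e0 p))"
    unfolding eq by (subst sum_PiE_insert) auto
  also have "\<dots> = of_nat (card perms) ^ (N - 1) * (\<Sum>p\<in>perms. of_bool (near e0 p))"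
    by (simp add: card_PiE sum_distrib_left)
  finally have "edge_cumulant z lam e0 A b = of_nat (card perms) ^ (N - 1) * (\<Sum>p\<in>perms. of_bool (near e0 p)) / of_nat (card perms) ^ N"
    unfolding edge_cumulant_def twisted_cumulant_def using assms(2) by simp
  also have "\<dots> = (\<Sum>p\<in>perms. of_bool (near e0 p)) / of_nat (card perms)"
    using assms(1) P by (cases N) (auto simp: field_simps)
  also have "(\<Sum>p\<in>perms. of_bool (near e0 p)) = (of_real (\<Sum>p\<in>perms. of_bool (near e0 p)) :: complex)"
    unfolding of_real_sum by (intro sum.cong refl) (simp add: of_bool_def)
  finally show ?thesis by simp
qed

text \<open>A diagonal entry is constant, so its twisted sum is \<open>lam\<close> times the sum of
  all powers of \<open>z\<close>, which is 0.\<close>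

lemma edge_cumulant_diagonal:
  assumes A: "finite A" "(u, u) \<in> A" and b: "b (u, u) > 0" and N: "N > 1" and z: "z ^ N = 1" "z \<noteq> 1"
  shows "edge_cumulant z lam e0 A b = 0"
proof -
  have "(\<Sum>i<N. z ^ i) = 0"
    using z by (simp add: geometric_sum)
  then have "(\<Sum>i<N. z ^ i * of_real (lam * of_bool (near (u, u) (w i)))) ^ b (u, u) = 0" for w
    using b by (simp add: near_def flip: sum_distrib_right)
  then have "(\<Prod>e\<in>A. (\<Sum>i<N. z ^ i * of_real (lam * of_bool (near e (w i)))) ^ b e) = 0" for w
    using A by (intro prod_zero) blast+
  then show ?thesis
    unfolding edge_cumulant_def twisted_cumulant_def by simp
qed

text \<open>Nonzero indices are grouped by weight and vertex set. The number of indices in a group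
  is exponential in the weight, \<open>sum_supersets_of_pair\<close> uses up the negative power of
  \<open>n\<close>, and a geometric series in \<zeta> remains.\<close>

lemma sum_edge_cumulants_le:
  assumes N: "N = D + 1" and ij: "i0 \<in> {1..n}" "j0 \<in> {1..n}" "i0 \<noteq> j0"
    and lam: "lam \<ge> 0" and z: "norm z = 1" "z ^ N = 1"
    and prim: "\<And>k. 0 < k \<Longrightarrow> k < N \<Longrightarrow> z ^ k \<noteq> 1"
    and n: "n \<ge> 2 * (2 * N)\<^sup>2"
  defines "A \<equiv> {1..n} \<times> {1..n}"
    and "\<zeta> \<equiv> lam\<^sup>2 * 2 ^ 12 * real N ^ 14 * max 1 (4 * (real \<rho>)\<^sup>2 / real n)"
  assumes \<zeta>: "\<zeta> < 1"
  shows "(\<Sum>b\<in>multi_indices D A. (Re (edge_cumulant z lam (i0, j0) A b))\<^sup>2 / (\<Prod>e\<in>A. fact (b e))) \<le>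
    ((\<Sum>p\<in>perms. of_bool (near (i0, j0) p)) / real (card perms))\<^sup>2 +
    48 * real N ^ 3 * (real \<rho>)\<^sup>2 / (real n)\<^sup>2 * (\<zeta> / (1 - \<zeta>))"
proof -
  let ?J = "multi_indices D A" and ?k = "edge_cumulant z lam (i0, j0) A"
  let ?V = "vertices (i0, j0) A" and ?s = "\<lambda>b. \<Sum>e\<in>A. b e"
  define K where "K = 16 * (real N)\<^sup>2 * (real \<rho>)\<^sup>2 / (real n)\<^sup>2"
  define Z where "Z = lam\<^sup>2 * 2 ^ 10 * real N ^ 12 * max 1 (4 * (real \<rho>)\<^sup>2 / real n)"
  define J where "J = {b \<in> ?J. ?s b > 0 \<and> (\<forall>e\<in>A. b e > 0 \<longrightarrow> fst e \<noteq> snd e)}"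
  have finA: "finite A" by (simp add: A_def)
  have finJ: "finite ?J" using finA by (rule finite_multi_indices)
  then have finJ': "finite J" by (simp add: J_def)
  have n0: "n > 0" using ij by auto
  have K: "K \<ge> 0" and Z: "Z \<ge> 0" by (auto simp: K_def Z_def)
  \<comment> \<open>Each unit of weight selects one of at most \<open>(2 * N)\<^sup>2\<close>
    ordered pairs of vertices. This turns 2^10 and the power 12 into 2^12 and 14.\<close>
  have Z\<zeta>: "Z * (4 * (real N)\<^sup>2) = \<zeta>"
    by (simp add: Z_def \<zeta>_def power2_eq_square eval_nat_numeral)
  have \<zeta>0: "\<zeta> \<ge> 0" by (simp add: \<zeta>_def)
  define zero where "zero = (\<lambda>e\<in>A. 0 :: nat)"
  have zero_J: "zero \<in> ?J" by (auto simp: zero_def multi_indices_def)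
  let ?t = "\<lambda>b. (Re (?k b))\<^sup>2 / (\<Prod>e\<in>A. fact (b e))"
  have t_zero: "?t zero = ((\<Sum>p\<in>perms. of_bool (near (i0, j0) p)) / real (card perms))\<^sup>2"
    using edge_cumulant_zero_index[of A zero z lam "(i0, j0)"] N by (simp add: zero_def)
  have pos: "?s b > 0" if "b \<in> ?J - {zero}" for b
  proof (rule ccontr)
    assume "\<not> ?s b > 0"
    then have "\<forall>e\<in>A. b e = 0" using finA by simp
    then have "b = zero"
      using that by (auto simp: zero_def multi_indices_def PiE_iff extensional_def fun_eq_iff)
    with that show False by simp
  qed
  have t_diag: "?t b = 0" if b: "b \<in> ?J - {zero} - J" for b
  proof -
    have "?s b > 0" using pos b by blast
    then obtain e where e: "e \<in> A" "b e > 0" "fst e = snd e"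
      using b by (auto simp: J_def)
    obtain u where u: "e = (u, u)" using e(3) by (cases e) auto
    have "?s b \<le> D" using b by (auto simp: multi_indices_def)
    then have "N > 1" using \<open>?s b > 0\<close> N by linarith
    then have "?k b = 0"
      using edge_cumulant_diagonal[OF finA, of u b z] e u z(2) prim[of 1] by simp
    then show ?thesis by simp
  qed
  have t_le: "?t b \<le> K * Z ^ ?s b / real n ^ (card (?V b) - 2)" if b: "b \<in> J" for b
  proof -
    have "(Re (?k b))\<^sup>2 \<le> (norm (?k b))\<^sup>2"
      using abs_Re_le_cmod[of "?k b"] abs_le_square_iff[of "Re (?k b)" "norm (?k b)"] by simp
    also have "\<dots> \<le> K * Z ^ ?s b / real n ^ (card (?V b) - 2)"
      unfolding K_def Z_def
    proof (rule edge_cumulant_square_le[OF _ ij lam _ z prim _ _ n])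
      show "?s b < N" using b N by (auto simp: J_def multi_indices_def)
      show "fst e \<noteq> snd e" if "e \<in> A" "b e > 0" for e
        using b that unfolding J_def by blast
    qed (use N in \<open>auto simp: A_def\<close>)
    finally have le: "(Re (?k b))\<^sup>2 \<le> K * Z ^ ?s b / real n ^ (card (?V b) - 2)" .
    have "(\<Prod>e\<in>A. fact (b e) :: real) \<ge> 1"
      by (intro prod_ge_1) (simp add: fact_ge_1)
    then have "?t b \<le> (Re (?k b))\<^sup>2"
      using mult_left_mono[of 1 "\<Prod>e\<in>A. fact (b e)" "(Re (?k b))\<^sup>2"] by (simp add: divide_le_eq)
    with le show ?thesis by linarith
  qed
  have "sum ?t ?J = ?t zero + sum ?t (?J - {zero})"
    using finJ zero_J by (rule sum.remove)
  also have "sum ?t (?J - {zero}) = sum ?t J"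
    by (rule sum.mono_neutral_right) (use finJ t_diag in \<open>auto simp: J_def zero_def\<close>)
  also have "sum ?t J \<le> (\<Sum>b\<in>J. K * Z ^ ?s b / real n ^ (card (?V b) - 2))"
    by (intro sum_mono t_le)
  also have "\<dots> \<le> 48 * real N ^ 3 * (real \<rho>)\<^sup>2 / (real n)\<^sup>2 * (\<zeta> / (1 - \<zeta>))"
  proof -
    let ?Vs = "{V. V \<subseteq> {1..n} \<and> i0 \<in> V \<and> j0 \<in> V \<and> card V \<le> 2 * N}"
    let ?S = "{1..D} \<times> ?Vs"
    have img: "(\<lambda>b. (?s b, ?V b)) ` J \<subseteq> ?S"
    proof
      fix y assume "y \<in> (\<lambda>b. (?s b, ?V b)) ` J"
      then obtain b where b: "b \<in> J" "y = (?s b, ?V b)" by blast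
      have s: "?s b \<in> {1..D}" using b(1) by (auto simp: J_def multi_indices_def)
      have "card (?V b) \<le> 2 * (?s b + 1)" by (rule card_vertices_le(1)[OF finA])
      also have "\<dots> \<le> 2 * N" using s N by simp
      finally have "card (?V b) \<le> 2 * N" .
      moreover have "?V b \<subseteq> {1..n}" "i0 \<in> ?V b" "j0 \<in> ?V b"
        using ij by (auto simp: vertices_def A_def Let_def)
      ultimately show "y \<in> ?S" using s b(2) by blast
    qed
    have "(\<Sum>b\<in>J. K * Z ^ ?s b / real n ^ (card (?V b) - 2)) =
        (\<Sum>y\<in>?S. \<Sum>b\<in>{b \<in> J. (?s b, ?V b) = y}. K * Z ^ ?s b / real n ^ (card (?V b) - 2))"
      by (rule sum.group[symmetric]) (use finJ' img in auto)
    also have "\<dots> \<le> (\<Sum>(s, V)\<in>?S. K * \<zeta> ^ s / real n ^ (card V - 2))"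
    proof (rule sum_mono)
      fix y assume y: "y \<in> ?S"
      obtain s V where sV: "y = (s, V)" by (cases y)
      let ?B = "{b \<in> J. (?s b, ?V b) = y}"
      have finV: "finite V" using y sV finite_subset by auto
      have "card ?B \<le> card {b \<in> PiE A (\<lambda>_. UNIV). ?s b = s \<and> (\<forall>e\<in>A. b e > 0 \<longrightarrow> e \<in> V \<times> V)}"
      proof (rule card_mono)
        show "finite {b \<in> PiE A (\<lambda>_. UNIV). ?s b = s \<and> (\<forall>e\<in>A. b e > 0 \<longrightarrow> e \<in> V \<times> V)}"
          using finV finA by (intro finite_indices_supported) auto
        show "?B \<subseteq> {b \<in> PiE A (\<lambda>_. UNIV). ?s b = s \<and> (\<forall>e\<in>A. b e > 0 \<longrightarrow> e \<in> V \<times> V)}"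
        proof
          fix b assume b: "b \<in> ?B"
          have "e \<in> V \<times> V" if "e \<in> A" "b e > 0" for e
          proof -
            have "fst e \<in> ?V b" "snd e \<in> ?V b" using that by (auto simp: vertices_def Let_def)
            then show ?thesis using b sV by (cases e) auto
          qed
          moreover have "b \<in> PiE A (\<lambda>_. UNIV)" "?s b = s"
            using b sV by (auto simp: J_def multi_indices_def)
          ultimately show "b \<in> {b \<in> PiE A (\<lambda>_. UNIV). ?s b = s \<and> (\<forall>e\<in>A. b e > 0 \<longrightarrow> e \<in> V \<times> V)}"
            by blast
        qed
      qed
      also have "\<dots> \<le> card (V \<times> V) ^ s"
        using finV finA by (intro card_indices_supported) auto
      also have "\<dots> \<le> ((2 * N)\<^sup>2) ^ s"
      proof (rule power_mono)
        have "card V \<le> 2 * N" using y sV by auto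
        then show "card (V \<times> V) \<le> (2 * N)\<^sup>2"
          unfolding card_cartesian_product power2_eq_square by (intro mult_le_mono)
      qed simp
      finally have "real (card ?B) \<le> real (((2 * N)\<^sup>2) ^ s)"
        by (simp only: of_nat_le_iff)
      then have card_B: "real (card ?B) \<le> (4 * (real N)\<^sup>2) ^ s"
        by (simp add: power_mult_distrib)
      have "(\<Sum>b\<in>?B. K * Z ^ ?s b / real n ^ (card (?V b) - 2)) = (\<Sum>b\<in>?B. K * Z ^ s / real n ^ (card V - 2))"
        by (intro sum.cong refl) (auto simp: sV)
      also have "\<dots> = real (card ?B) * (K * Z ^ s / real n ^ (card V - 2))" by simp
      also have "\<dots> \<le> (4 * (real N)\<^sup>2) ^ s * (K * Z ^ s / real n ^ (card V - 2))"
        using K Z card_B by (intro mult_right_mono) auto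
      also have "\<dots> = K * \<zeta> ^ s / real n ^ (card V - 2)"
        unfolding Z\<zeta>[symmetric] by (simp add: power_mult_distrib)
      finally show "(\<Sum>b\<in>?B. K * Z ^ ?s b / real n ^ (card (?V b) - 2)) \<le>
          (case y of (s, V) \<Rightarrow> K * \<zeta> ^ s / real n ^ (card V - 2))"
        by (simp add: sV)
    qed
    also have "\<dots> = (\<Sum>s=1..D. \<Sum>V\<in>?Vs. K * \<zeta> ^ s / real n ^ (card V - 2))"
      by (rule sum.cartesian_product[symmetric])
    also have "\<dots> = K * ((\<Sum>s=1..D. \<zeta> ^ s) * (\<Sum>V\<in>?Vs. 1 / real n ^ (card V - 2)))"
      unfolding sum_product unfolding sum_distrib_left by simp
    \<comment> \<open>Vertex sets have at most \<open>2 * N\<close> elements, hence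
      \<open>2 * N + 1\<close> sizes, bounded by \<open>3 * N\<close>; times the 16 in
      \<open>K\<close> this gives 48.\<close>
    also have "\<dots> \<le> K * ((\<zeta> / (1 - \<zeta>)) * (3 * real N))"
    proof (intro mult_left_mono mult_mono K)
      show "(\<Sum>s=1..D. \<zeta> ^ s) \<le> \<zeta> / (1 - \<zeta>)"
        using \<zeta>0 \<zeta> by (rule sum_geometric_le)
      have "(\<Sum>V\<in>?Vs. 1 / real n ^ (card V - 2)) \<le> real (2 * N) + 1"
        by (rule sum_supersets_of_pair[OF n0 ij(3)])
      then show "(\<Sum>V\<in>?Vs. 1 / real n ^ (card V - 2)) \<le> 3 * real N" using N by simp
    qed (use \<zeta>0 \<zeta> in \<open>auto intro!: sum_nonneg\<close>)
    also have "\<dots> = 48 * real N ^ 3 * (real \<rho>)\<^sup>2 / (real n)\<^sup>2 * (\<zeta> / (1 - \<zeta>))"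
      by (simp add: K_def power2_eq_square power3_eq_cube)
    finally show ?thesis .
  qed
  finally show ?thesis unfolding t_zero by simp
qed

end

section \<open>The seriation model\<close>

lemma ex_primitive_root_of_unity:
  assumes N: "N > 0"
  shows "\<exists>z :: complex. norm z = 1 \<and> z ^ N = 1 \<and> (\<forall>k. 0 < k \<longrightarrow> k < N \<longrightarrow> z ^ k \<noteq> 1)"
proof (intro exI conjI allI impI)
  let ?z = "cis (2 * pi / real N)"
  show "norm ?z = 1" by simp
  show "?z ^ N = 1" unfolding Complex.DeMoivre using N by (simp add: complex_eq_iff)
  fix k assume k: "0 < k" "k < N"
  show "?z ^ k \<noteq> 1"
  proof
    assume "?z ^ k = 1"
    then have "cos (real k * (2 * pi / real N)) = 1"
      unfolding Complex.DeMoivre by (simp add: complex_eq_iff)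
    then obtain m :: int where "real k * (2 * pi / real N) = m * 2 * pi"
      using cos_one_2pi_int by auto
    then have "real k = real_of_int m * real N"
      using N by (simp add: field_simps)
    then have "int k = m * int N"
      by (metis of_int_eq_iff of_int_mult of_int_of_nat_eq)
    then have "int N dvd int k" by simp
    then show False using k zdvd_imp_le[of "int N" "int k"] by simp
  qed
qed

text \<open>Raising the bandwidth by 1 adds one diagonal above and one below, of equal
  length.\<close>

lemma card_band:
  assumes "\<rho> < n"
  shows "real (card {(a, b) \<in> {1..n} \<times> {1..n}. a \<noteq> b \<and> \<bar>int a - int b\<bar> \<le> int \<rho>}) =
    2 * real \<rho> * real n - real \<rho> * (real \<rho> + 1)"
  using assms
proof (induction \<rho>)
  case 0
  have "{(a, b) \<in> {1..n} \<times> {1..n}. a \<noteq> b \<and> \<bar>int a - int b\<bar> \<le> int 0} = {}" by auto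
  then show ?case by simp
next
  case (Suc \<rho>)
  let ?Q = "\<lambda>\<rho>. {(a, b) \<in> {1..n} \<times> {1..n}. a \<noteq> b \<and> \<bar>int a - int b\<bar> \<le> int \<rho>}"
  let ?U = "(\<lambda>a. (a, a + Suc \<rho>)) ` {1..n - Suc \<rho>}" and ?L = "(\<lambda>a. (a + Suc \<rho>, a)) ` {1..n - Suc \<rho>}"
  have fin: "finite (?Q \<rho>)" by (rule finite_subset[of _ "{1..n} \<times> {1..n}"]) auto
  have "?Q (Suc \<rho>) = ?Q \<rho> \<union> (?U \<union> ?L)"
  proof (intro equalityI subsetI)
    fix x assume x: "x \<in> ?Q (Suc \<rho>)"
    obtain a b where ab: "x = (a, b)" by (cases x)
    show "x \<in> ?Q \<rho> \<union> (?U \<union> ?L)"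
    proof (cases "\<bar>int a - int b\<bar> \<le> int \<rho>")
      case False
      then have "b = a + Suc \<rho> \<or> a = b + Suc \<rho>" using x ab by auto
      then show ?thesis
      proof
        assume "b = a + Suc \<rho>"
        then have "x \<in> ?U" using x ab by (intro image_eqI[of _ _ a]) auto
        then show ?thesis by blast
      next
        assume "a = b + Suc \<rho>"
        then have "x \<in> ?L" using x ab by (intro image_eqI[of _ _ b]) auto
        then show ?thesis by blast
      qed
    qed (use x ab in auto)
  qed (use Suc.prems in auto)
  moreover have "card (?Q \<rho> \<union> (?U \<union> ?L)) = card (?Q \<rho>) + (card ?U + card ?L)"
    by (subst card_Un_disjoint, use fin in auto)+
  moreover have "card ?U = n - Suc \<rho>" "card ?L = n - Suc \<rho>"
    by (simp_all add: card_image inj_on_def)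
  ultimately have "real (card (?Q (Suc \<rho>))) = real (card (?Q \<rho>)) + 2 * real (n - Suc \<rho>)"
    by simp
  then show ?case
    using Suc by (simp add: of_nat_diff algebra_simps)
qed

context permutation_copies
begin

text \<open>Relabelling by a permutation shows that all off-diagonal pairs are near equally often.
  Every permutation also permutes these pairs, so averaging over them leaves the deterministic count
  \<open>card_band\<close>.\<close>

lemma near_probability:
  assumes ij: "i \<in> {1..n}" "j \<in> {1..n}" "i \<noteq> j" and \<rho>: "\<rho> < n"
  shows "(\<Sum>p\<in>perms. of_bool (near (i, j) p)) / real (card perms) =
    2 * real \<rho> / (real n - 1) * (1 - (real \<rho> + 1) / (2 * real n))"
proof -
  let ?s = "\<lambda>e. \<Sum>p\<in>perms. of_bool (near e p) :: real"
  let ?O = "{(a, b) \<in> {1..n} \<times> {1..n}. a \<noteq> b}"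
  let ?Q = "{(a, b) \<in> {1..n} \<times> {1..n}. a \<noteq> b \<and> \<bar>int a - int b\<bar> \<le> int \<rho>}"
  have n: "n \<ge> 2" using ij by auto
  have P: "card perms > 0" using perms_finite perms_nonempty by (simp add: card_gt_0_iff)
  have sym: "?s e = ?s (i, j)" if e: "e \<in> ?O" for e
  proof -
    obtain a b where ab: "e = (a, b)" "a \<in> {1..n}" "b \<in> {1..n}" "a \<noteq> b" using e by blast
    obtain q where q: "q permutes {1..n}" "q i = a" "q j = b"
      using extend_to_permutation[of "{1..n}" "{i, j}" "\<lambda>v. if v = i then a else b"] ij ab
      by (auto simp: inj_on_def)
    show ?thesis
    proof (rule sum.reindex_bij_witness[of _ "\<lambda>p. p \<circ> inv q" "\<lambda>p. p \<circ> q"])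
      fix p assume "p \<in> perms"
      then show "p \<circ> q \<in> perms" "p \<circ> inv q \<in> perms"
        using q(1) permutes_inv[OF q(1)] by (auto simp: perms_def intro: permutes_compose)
      show "p \<circ> q \<circ> inv q = p" "p \<circ> inv q \<circ> q = p"
        using permutes_inv_o[OF q(1)] by (simp_all add: o_assoc[symmetric])
      show "of_bool (near (i, j) (p \<circ> q)) = of_bool (near e p)"
        using q ab by (simp add: near_def)
    qed
  qed
  have finO: "finite ?O" by (rule finite_subset[of _ "{1..n} \<times> {1..n}"]) auto
  have cardO: "real (card ?O) = real n * (real n - 1)"
  proof -
    have "?O = {1..n} \<times> {1..n} - (\<lambda>a. (a, a)) ` {1..n}" by auto
    then have "card ?O = n * n - n"
      by (simp add: card_Diff_subset card_image inj_on_def image_subset_iff card_cartesian_product)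
    then show ?thesis using n by (simp add: of_nat_diff algebra_simps)
  qed
  have "real (card ?O) * ?s (i, j) = (\<Sum>e\<in>?O. ?s e)"
    by (simp add: sym)
  also have "\<dots> = (\<Sum>p\<in>perms. \<Sum>e\<in>?O. of_bool (near e p))"
    by (rule sum.swap)
  also have "\<dots> = (\<Sum>p\<in>perms. real (card ?Q))"
  proof (rule sum.cong[OF refl])
    fix p assume "p \<in> perms"
    then have p: "p permutes {1..n}" by (simp add: perms_def)
    have "(\<Sum>e\<in>?O. of_bool (near e p)) = (\<Sum>e\<in>?O. of_bool (near e id) :: real)"
    proof (rule sum.reindex_bij_witness[of _ "map_prod (inv p) (inv p)" "map_prod p p"])
      fix e assume e: "e \<in> ?O"
      have O: "map_prod q q e \<in> ?O" if q: "q permutes {1..n}" for q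
      proof -
        obtain a b where ab: "e = (a, b)" "a \<in> {1..n}" "b \<in> {1..n}" "a \<noteq> b" using e by blast
        then have "q a \<in> {1..n}" "q b \<in> {1..n}" "q a \<noteq> q b"
          using permutes_in_image[OF q] permutes_inj[OF q] by (blast, blast, auto dest: injD)
        then show ?thesis using ab by auto
      qed
      show "map_prod p p e \<in> ?O" "map_prod (inv p) (inv p) e \<in> ?O"
        by (rule O[OF p], rule O[OF permutes_inv[OF p]])
      show "map_prod (inv p) (inv p) (map_prod p p e) = e" "map_prod p p (map_prod (inv p) (inv p) e) = e"
        using permutes_inverses[OF p] by (cases e; simp)+
      show "of_bool (near (map_prod p p e) id) = of_bool (near e p)"
        by (cases e) (simp add: near_def)
    qed
    also have "\<dots> = real (card {e \<in> ?O. near e id})"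
      using finO by (simp add: sum.If_cases of_bool_def Collect_conj_eq Int_commute)
    also have "{e \<in> ?O. near e id} = ?Q"
      by (auto simp: near_def)
    finally show "(\<Sum>e\<in>?O. of_bool (near e p)) = real (card ?Q)" .
  qed
  also have "\<dots> = real (card perms) * (2 * real \<rho> * real n - real \<rho> * (real \<rho> + 1))"
    using card_band[OF \<rho>] by simp
  finally have "(real n * (real n - 1)) * ?s (i, j) = real (card perms) * (2 * real \<rho> * real n - real \<rho> * (real \<rho> + 1))"
    unfolding cardO .
  then have "?s (i, j) / real (card perms) = (2 * real \<rho> * real n - real \<rho> * (real \<rho> + 1)) / (real n * (real n - 1))"
    using P n by (simp add: field_simps)
  also have "\<dots> = 2 * real \<rho> / (real n - 1) * (1 - (real \<rho> + 1) / (2 * real n))"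
    using n by (simp add: field_simps)
  finally show ?thesis .
qed

text \<open>All other factors of the moment identity are real, so taking real parts turns it into
  one for the real parts of the cumulants, which can serve as coefficients \<open>c\<close> of the
  certificate.\<close>

lemma edge_cumulant_moments:
  assumes A: "finite A" and N: "N > 0" and z: "z ^ N = 1"
    and prim: "\<And>k. 0 < k \<Longrightarrow> k < N \<Longrightarrow> z ^ k \<noteq> 1"
    and a: "(\<Sum>v\<in>A. a v) < N"
  shows "(\<Sum>b\<in>PiE A (\<lambda>v. {..a v}). real (\<Prod>v\<in>A. a v choose b v) * Re (edge_cumulant z lam e0 A b) *
      (\<Sum>p\<in>perms. \<Prod>v\<in>A. (lam * of_bool (near v p) + y v) ^ (a v - b v))) =
    (\<Sum>p\<in>perms. of_bool (near e0 p) * (\<Prod>v\<in>A. (lam * of_bool (near v p) + y v) ^ a v))"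
proof -
  have of_bool_of_real: "(of_bool Q :: complex) = of_real (of_bool Q)" for Q
    by (simp add: of_bool_def)
  let ?X = "\<lambda>p v. of_real (lam * of_bool (near v p)) :: complex"
  have "(\<Sum>b\<in>PiE A (\<lambda>v. {..a v}). of_nat (\<Prod>v\<in>A. a v choose b v) * edge_cumulant z lam e0 A b *
      (\<Sum>p\<in>perms. \<Prod>v\<in>A. (of_real (y v) + ?X p v) ^ (a v - b v))) =
    (\<Sum>p\<in>perms. of_bool (near e0 p) * (\<Prod>v\<in>A. (of_real (y v) + ?X p v) ^ a v))"
    unfolding edge_cumulant_def
    by (rule twisted_cumulant_moments[OF A perms_finite perms_nonempty _ z prim a]) (use N in auto)
  then have "Re (\<Sum>b\<in>PiE A (\<lambda>v. {..a v}). of_nat (\<Prod>v\<in>A. a v choose b v) * edge_cumulant z lam e0 A b *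
      of_real (\<Sum>p\<in>perms. \<Prod>v\<in>A. (lam * of_bool (near v p) + y v) ^ (a v - b v))) =
    Re (\<Sum>p\<in>perms. of_real (of_bool (near e0 p) * (\<Prod>v\<in>A. (lam * of_bool (near v p) + y v) ^ a v)))"
    by (simp add: add.commute of_bool_of_real)
  then show ?thesis
    unfolding Re_sum by (simp only: Re_complex_of_real times_complex.sel complex_Re_of_nat complex_Im_of_nat Im_complex_of_real
        mult_zero_left mult_zero_right diff_zero)
qed

end

section \<open>Reduction of the matrix risk to single entries\<close>

lemma integral_seriation_space:
  assumes g: "g \<in> borel_measurable (seriation_space n)"
    and int: "\<And>p. p permutes {1..n} \<Longrightarrow> integrable (PiM (idx n) (\<lambda>_. std_gauss)) (\<lambda>E. g (p, E) :: real)"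
  shows "(\<integral>w. g w \<partial>seriation_space n) =
    (\<Sum>p\<in>{p. p permutes {1..n}}. \<integral>E. g (p, E) \<partial>PiM (idx n) (\<lambda>_. std_gauss)) / real (card {p. p permutes {1..n}})"
proof -
  let ?P = "{p. p permutes {1..n}}"
  let ?M1 = "measure_pmf (pmf_of_set ?P)" and ?M2 = "PiM (idx n) (\<lambda>_. std_gauss)"
  have P: "finite ?P" "?P \<noteq> {}" by (auto intro: finite_permutations permutes_id)
  interpret M2: prob_space ?M2
    by (rule prob_space_PiM) (rule prob_space_std_gauss)
  interpret pair_sigma_finite ?M1 ?M2 by unfold_locales
  have "integrable (?M1 \<Otimes>\<^sub>M ?M2) g"
  proof (rule Fubini_integrable)
    show "g \<in> borel_measurable (?M1 \<Otimes>\<^sub>M ?M2)" using g by (simp add: seriation_space_def)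
    show "integrable ?M1 (\<lambda>p. \<integral>E. norm (g (p, E)) \<partial>?M2)"
      using P by (intro integrable_measure_pmf_finite) (simp add: set_pmf_of_set)
    show "AE p in ?M1. integrable ?M2 (\<lambda>E. g (p, E))"
      using P int by (simp add: AE_measure_pmf_iff set_pmf_of_set)
  qed
  then have "(\<integral>w. g w \<partial>seriation_space n) = (\<integral>p. (\<integral>E. g (p, E) \<partial>?M2) \<partial>?M1)"
    unfolding seriation_space_def by (rule integral_fst'[symmetric])
  also have "\<dots> = (\<Sum>p\<in>?P. \<integral>E. g (p, E) \<partial>?M2) / real (card ?P)"
    using P by (intro integral_pmf_of_set) auto
  finally show ?thesis .
qed

lemma eval_mpoly_on:
  assumes "p \<in> mpolys_le D A" "finite A"
  shows "eval_mpoly p y = (\<Sum>m\<in>Poly_Mapping.keys p. Poly_Mapping.lookup p m * (\<Prod>v\<in>A. y v ^ Poly_Mapping.lookup m v))"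
  unfolding eval_mpoly_def
proof (intro sum.cong refl arg_cong2[where f = "(*)"])
  fix m assume "m \<in> Poly_Mapping.keys p"
  then have "Poly_Mapping.keys m \<subseteq> A" using assms(1) by (simp add: mpolys_le_def)
  then show "(\<Prod>v\<in>Poly_Mapping.keys m. y v ^ Poly_Mapping.lookup m v) = (\<Prod>v\<in>A. y v ^ Poly_Mapping.lookup m v)"
    using assms(2) by (intro prod.mono_neutral_left) (auto simp: in_keys_iff)
qed

lemma degree_mpolys_le:
  assumes "p \<in> mpolys_le D A" "finite A" "m \<in> Poly_Mapping.keys p"
  shows "(\<Sum>v\<in>A. Poly_Mapping.lookup m v) \<le> D"
proof -
  have "Poly_Mapping.keys m \<subseteq> A" "monom_degree m \<le> D"
    using assms by (auto simp: mpolys_le_def)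
  moreover from this have "monom_degree m = (\<Sum>v\<in>A. Poly_Mapping.lookup m v)"
    unfolding monom_degree_def using assms(2) by (intro sum.mono_neutral_left) (auto simp: in_keys_iff)
  ultimately show ?thesis by simp
qed

lemma signal_eq_near: "signal \<rho> lam p v = lam * of_bool (permutation_copies.near \<rho> v p)"
  by (cases v) (simp add: signal_def permutation_copies.near_def)

text \<open>The squared Frobenius norm decouples the entries, so the polynomial of each entry can be
  bounded separately.\<close>

lemma seriation_risk_eq:
  assumes F: "\<And>k. k \<in> idx n \<Longrightarrow> F k \<in> mpolys_le D (idx n)"
  defines "P \<equiv> {p. p permutes {1..n}}"
  shows "seriation_risk n \<rho> lam F = 1 / (real n)\<^sup>2 * (\<Sum>k\<in>idx n.
    (\<Sum>p\<in>P. \<integral>E. (eval_mpoly (F k) (\<lambda>v. signal \<rho> lam p v + E v) - signal \<rho> lam p k)\<^sup>2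
       \<partial>PiM (idx n) (\<lambda>_. std_gauss)) / real (card P))"
proof -
  let ?A = "idx n" and ?M = "PiM (idx n) (\<lambda>_. std_gauss)"
  have finA: "finite ?A" by (simp add: idx_def)
  define err where "err k w = eval_mpoly (F k) (observation \<rho> lam w) - signal \<rho> lam (fst w) k" for k w
  have obs: "observation \<rho> lam w v = signal \<rho> lam (fst w) v + snd w v" for w v
    by (simp add: observation_def case_prod_beta)
  have err_pair: "err k (p, E) = eval_mpoly (F k) (\<lambda>v. signal \<rho> lam p v + E v) - signal \<rho> lam p k" for k p E
    by (simp add: err_def obs[abs_def])
  have meas_signal: "(\<lambda>w. signal \<rho> lam (fst w) v) \<in> borel_measurable (seriation_space n)" for v
    unfolding seriation_space_def by (rule measurable_compose[OF measurable_fst]) simp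
  have meas_noise: "(\<lambda>w. snd w v) \<in> borel_measurable (seriation_space n)" if "v \<in> ?A" for v
  proof -
    have "(\<lambda>E. E v) \<in> measurable ?M std_gauss"
      using that by (rule measurable_component_singleton)
    then have "(\<lambda>E. E v) \<in> borel_measurable ?M" by simp
    then show ?thesis
      unfolding seriation_space_def by (rule measurable_compose[OF measurable_snd])
  qed
  have meas: "err k \<in> borel_measurable (seriation_space n)" if k: "k \<in> ?A" for k
    unfolding err_def eval_mpoly_on[OF F[OF k] finA] obs
    by (intro borel_measurable_diff borel_measurable_sum borel_measurable_times borel_measurable_const
        borel_measurable_prod borel_measurable_power borel_measurable_add meas_signal meas_noise)
  have int: "integrable ?M (\<lambda>E. (err k (p, E))\<^sup>2)" if k: "k \<in> ?A" for k p
    unfolding err_pair power2_eq_square eval_mpoly_on[OF F[OF k] finA]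
    by (intro integrable_polyfun[OF finA] polyfun_mult polyfun_diff polyfun_sum polyfun.scale
        polyfun_shifted_power polyfun_const)
  have "(\<integral>w. (frobenius_norm n (\<lambda>k. eval_mpoly (F k) (observation \<rho> lam w) - signal \<rho> lam (fst w) k))\<^sup>2
      \<partial>seriation_space n) = (\<integral>w. (\<Sum>k\<in>?A. (err k w)\<^sup>2) \<partial>seriation_space n)"
    by (simp add: frobenius_norm_def L2_set_def sum_nonneg err_def)
  also have "\<dots> = (\<Sum>p\<in>P. \<integral>E. (\<Sum>k\<in>?A. (err k (p, E))\<^sup>2) \<partial>?M) / real (card P)"
    unfolding P_def
    by (rule integral_seriation_space)
      (intro borel_measurable_sum borel_measurable_power meas, assumption,
       intro Bochner_Integration.integrable_sum int, assumption)
  also have "\<dots> = (\<Sum>p\<in>P. \<Sum>k\<in>?A. \<integral>E. (err k (p, E))\<^sup>2 \<partial>?M) / real (card P)"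
    using int by (simp add: Bochner_Integration.integral_sum)
  also have "\<dots> = (\<Sum>k\<in>?A. (\<Sum>p\<in>P. \<integral>E. (err k (p, E))\<^sup>2 \<partial>?M) / real (card P))"
    by (subst sum.swap) (simp add: sum_divide_distrib)
  finally show ?thesis
    unfolding seriation_risk_def err_pair by simp
qed

text \<open>The second moment of the entry is \<open>lam\<^sup>2 * \<phi>\<close>. The zero index of
  the certificate takes away \<open>lam\<^sup>2 * \<phi>\<^sup>2\<close>, and all other indices make
  up the error term.\<close>

lemma entry_risk_ge:
  assumes ij: "i \<in> {1..n}" "j \<in> {1..n}" "i \<noteq> j" and \<rho>: "\<rho> < n" and lam: "lam \<ge> 0"
    and f: "f \<in> mpolys_le D (idx n)" and n: "n \<ge> 2 * (2 * D + 2)\<^sup>2"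
  defines "\<phi> \<equiv> 2 * real \<rho> / (real n - 1) * (1 - (real \<rho> + 1) / (2 * real n))"
    and "\<zeta> \<equiv> lam\<^sup>2 * 2 ^ 12 * (real D + 1) ^ 14 * max 1 (4 * (real \<rho>)\<^sup>2 / real n)"
    and "P \<equiv> {p. p permutes {1..n}}"
  assumes \<zeta>: "\<zeta> < 1"
  shows "(\<Sum>p\<in>P. \<integral>E. (eval_mpoly f (\<lambda>v. signal \<rho> lam p v + E v) - signal \<rho> lam p (i, j))\<^sup>2
       \<partial>PiM (idx n) (\<lambda>_. std_gauss)) / real (card P) \<ge>
    lam\<^sup>2 * (\<phi> * (1 - \<phi>) - 48 * (real D + 1) ^ 3 * (real \<rho>)\<^sup>2 / (real n)\<^sup>2 * (\<zeta> / (1 - \<zeta>)))"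
proof -
  interpret permutation_copies n "D + 1" \<rho> .
  let ?A = "idx n" and ?M = "PiM (idx n) (\<lambda>_. std_gauss)"
  have finA: "finite ?A" by (simp add: idx_def)
  have P: "P = perms" by (simp add: P_def perms_def)
  have cardP: "real (card perms) > 0" using perms_finite perms_nonempty by (simp add: card_gt_0_iff)
  obtain z :: complex where z: "norm z = 1" "z ^ (D + 1) = 1" "\<And>k. 0 < k \<Longrightarrow> k < D + 1 \<Longrightarrow> z ^ k \<noteq> 1"
    using ex_primitive_root_of_unity[of "D + 1"] by auto
  let ?c = "\<lambda>b. Re (edge_cumulant z lam (i, j) ?A b)"
  let ?x = "\<lambda>p. of_bool (near (i, j) p) :: real"
  have moments: "(\<Sum>b\<in>PiE ?A (\<lambda>v. {..a v}). real (\<Prod>v\<in>?A. a v choose b v) * (lam * ?c b) *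
         (\<Sum>p\<in>perms. \<Prod>v\<in>?A. (signal \<rho> lam p v + y v) ^ (a v - b v))) =
      (\<Sum>p\<in>perms. (lam * ?x p) * (\<Prod>v\<in>?A. (signal \<rho> lam p v + y v) ^ a v))"
    if a: "(\<Sum>v\<in>?A. a v) \<le> D" for a y
  proof -
    have "lam * (\<Sum>b\<in>PiE ?A (\<lambda>v. {..a v}). real (\<Prod>v\<in>?A. a v choose b v) * ?c b *
         (\<Sum>p\<in>perms. \<Prod>v\<in>?A. (signal \<rho> lam p v + y v) ^ (a v - b v))) =
      lam * (\<Sum>p\<in>perms. ?x p * (\<Prod>v\<in>?A. (signal \<rho> lam p v + y v) ^ a v))"
      unfolding signal_eq_near using a
      by (intro arg_cong[where f = "(*) lam"] edge_cumulant_moments[OF finA _ z(2,3)]) auto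
    then show ?thesis by (simp only: sum_distrib_left mult_ac)
  qed
  have "(\<Sum>p\<in>perms. \<integral>E. (eval_mpoly f (\<lambda>v. signal \<rho> lam p v + E v) - lam * ?x p)\<^sup>2 \<partial>?M) \<ge>
     (\<Sum>p\<in>perms. (lam * ?x p)\<^sup>2) - real (card perms) *
       (\<Sum>b\<in>multi_indices D ?A. (lam * ?c b)\<^sup>2 / (\<Prod>v\<in>?A. fact (b v)))"
    unfolding eval_mpoly_on[OF f finA]
    by (rule low_degree_risk_lower_bound[OF finA perms_finite finite_keys moments degree_mpolys_le[OF f finA]])
  moreover have "(\<Sum>p\<in>perms. (lam * ?x p)\<^sup>2) = lam\<^sup>2 * (real (card perms) * \<phi>)"
  proof -
    have "(\<Sum>p\<in>perms. ?x p) = real (card perms) * \<phi>"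
      using near_probability[OF ij \<rho>] cardP unfolding \<phi>_def[symmetric] by (simp add: field_simps)
    moreover have "(lam * ?x p)\<^sup>2 = lam\<^sup>2 * ?x p" for p
      by (simp add: power2_eq_square of_bool_def)
    ultimately show ?thesis by (simp only: sum_distrib_left[symmetric])
  qed
  moreover have "(\<Sum>b\<in>multi_indices D ?A. (lam * ?c b)\<^sup>2 / (\<Prod>v\<in>?A. fact (b v))) \<le>
      lam\<^sup>2 * (\<phi>\<^sup>2 + 48 * (real D + 1) ^ 3 * (real \<rho>)\<^sup>2 / (real n)\<^sup>2 * (\<zeta> / (1 - \<zeta>)))"
  proof -
    have "(\<Sum>b\<in>multi_indices D ?A. (?c b)\<^sup>2 / (\<Prod>v\<in>?A. fact (b v))) \<le>
        \<phi>\<^sup>2 + 48 * real (D + 1) ^ 3 * (real \<rho>)\<^sup>2 / (real n)\<^sup>2 *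
          ((lam\<^sup>2 * 2 ^ 12 * real (D + 1) ^ 14 * max 1 (4 * (real \<rho>)\<^sup>2 / real n)) /
           (1 - lam\<^sup>2 * 2 ^ 12 * real (D + 1) ^ 14 * max 1 (4 * (real \<rho>)\<^sup>2 / real n)))"
      using sum_edge_cumulants_le[OF refl ij lam z] \<zeta> n
      unfolding near_probability[OF ij \<rho>] \<phi>_def[symmetric] idx_def \<zeta>_def by (simp add: add.commute)
    then have "lam\<^sup>2 * (\<Sum>b\<in>multi_indices D ?A. (?c b)\<^sup>2 / (\<Prod>v\<in>?A. fact (b v))) \<le>
      lam\<^sup>2 * (\<phi>\<^sup>2 + 48 * (real D + 1) ^ 3 * (real \<rho>)\<^sup>2 / (real n)\<^sup>2 * (\<zeta> / (1 - \<zeta>)))"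
      unfolding \<zeta>_def by (intro mult_left_mono) (simp_all add: add.commute)
    then show ?thesis by (simp add: sum_distrib_left power_mult_distrib)
  qed
  ultimately have "(\<Sum>p\<in>perms. \<integral>E. (eval_mpoly f (\<lambda>v. signal \<rho> lam p v + E v) - lam * ?x p)\<^sup>2 \<partial>?M) \<ge>
     lam\<^sup>2 * (real (card perms) * \<phi>) - real (card perms) *
      (lam\<^sup>2 * (\<phi>\<^sup>2 + 48 * (real D + 1) ^ 3 * (real \<rho>)\<^sup>2 / (real n)\<^sup>2 * (\<zeta> / (1 - \<zeta>))))"
    using cardP by (smt (verit) mult_left_mono)
  also have "lam\<^sup>2 * (real (card perms) * \<phi>) - real (card perms) *
      (lam\<^sup>2 * (\<phi>\<^sup>2 + 48 * (real D + 1) ^ 3 * (real \<rho>)\<^sup>2 / (real n)\<^sup>2 * (\<zeta> / (1 - \<zeta>)))) =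
     real (card perms) * (lam\<^sup>2 * (\<phi> * (1 - \<phi>) - 48 * (real D + 1) ^ 3 * (real \<rho>)\<^sup>2 / (real n)\<^sup>2 * (\<zeta> / (1 - \<zeta>))))"
    by (simp only: power2_eq_square ring_distribs mult_ac)
  finally show ?thesis
    unfolding P signal_eq_near[of \<rho> lam _ "(i, j)"] using cardP
    by (simp add: pos_le_divide_eq mult.commute)
qed

lemma card_off_diagonal: "real (card {k \<in> idx n. fst k \<noteq> snd k}) = real n * (real n - 1)"
proof -
  have "{k \<in> idx n. fst k \<noteq> snd k} = idx n - (\<lambda>a. (a, a)) ` {1..n}"
    by (auto simp: idx_def)
  then have "card {k \<in> idx n. fst k \<noteq> snd k} = n * n - n"
    by (simp add: idx_def card_Diff_subset card_image inj_on_def image_subset_iff card_cartesian_product)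
  then show ?thesis by (simp add: of_nat_diff algebra_simps)
qed

theorem theorem4p1:
  fixes n \<rho> D :: nat and lam \<phi> \<zeta> :: real
  assumes "n \<ge> 2"
    and "\<rho> \<in> {0..n - 1}"
    and "lam > 0"
    and "\<phi> = 2 * real \<rho> / (real n - 1) * (1 - (real \<rho> + 1) / (2 * real n))"
    and "n \<ge> 2 * (2 * D + 2)\<^sup>2"
    and "\<zeta> = 2 ^ 12 * lam\<^sup>2 * (real D + 1) ^ 42 * max 1 (4 * (real \<rho>)\<^sup>2 / real n)"
    and "\<zeta> < 1"
  shows "MMSE_le D n \<rho> lam \<ge>
    lam\<^sup>2 * ((real n - 1) / real n) *
      (\<phi> * (1 - \<phi>)
        - 2 ^ 18 * ((real \<rho>)\<^sup>2 / (real n - 1)\<^sup>2) * (real D + 1) ^ 44 *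
          (max \<zeta> (1 / real n) / (1 - max \<zeta> (1 / real n))))"
proof -
  define \<zeta>' where "\<zeta>' = lam\<^sup>2 * 2 ^ 12 * (real D + 1) ^ 14 * max 1 (4 * (real \<rho>)\<^sup>2 / real n)"
  define M where "M = max \<zeta> (1 / real n)"
  define \<delta> where "\<delta> = 48 * (real D + 1) ^ 3 * (real \<rho>)\<^sup>2 / (real n)\<^sup>2 * (\<zeta>' / (1 - \<zeta>'))"
  define P where "P = {p. p permutes {1..n}}"
  define X where "X = lam\<^sup>2 * (\<phi> * (1 - \<phi>) - \<delta>)"
  have n: "real n \<ge> 2" and \<rho>: "\<rho> < n" using assms(1,2) by auto
  \<comment> \<open>The entry bounds carry the power 14, and raising it to 42 only enlarges the
    error term.\<close>
  have "(real D + 1) ^ 14 \<le> (real D + 1) ^ 42" by (intro power_increasing) auto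
  then have "\<zeta>' \<le> \<zeta>"
    unfolding \<zeta>'_def assms(6) by (simp add: mult_ac mult_mono)
  then have \<zeta>'M: "\<zeta>' \<le> M" by (simp add: M_def)
  have \<zeta>'0: "0 \<le> \<zeta>'" by (simp add: \<zeta>'_def)
  have M1: "M < 1" using assms(7) n by (simp add: M_def)
  \<comment> \<open>The map sending t to t / (1 - t) is increasing below 1, and \<open>M\<close>
    stays below 1 because \<open>n \<ge> 2\<close>.\<close>
  have \<delta>_le: "\<delta> \<le> 2 ^ 18 * ((real \<rho>)\<^sup>2 / (real n - 1)\<^sup>2) * (real D + 1) ^ 44 * (M / (1 - M))"
  proof -
    have "(real D + 1) ^ 3 \<le> (real D + 1) ^ 44" by (intro power_increasing) auto
    then have const: "48 * (real D + 1) ^ 3 \<le> 2 ^ 18 * (real D + 1) ^ 44" by (intro mult_mono) auto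
    have ratio: "(real \<rho>)\<^sup>2 / (real n)\<^sup>2 \<le> (real \<rho>)\<^sup>2 / (real n - 1)\<^sup>2"
      using n by (intro divide_left_mono power_mono mult_pos_pos) auto
    have frac: "\<zeta>' / (1 - \<zeta>') \<le> M / (1 - M)"
      using \<zeta>'M \<zeta>'0 M1 by (intro frac_le) auto
    have "48 * (real D + 1) ^ 3 * ((real \<rho>)\<^sup>2 / (real n)\<^sup>2) * (\<zeta>' / (1 - \<zeta>')) \<le>
        2 ^ 18 * (real D + 1) ^ 44 * ((real \<rho>)\<^sup>2 / (real n - 1)\<^sup>2) * (M / (1 - M))"
      by (rule mult_mono[OF mult_mono[OF const ratio] frac]) (use \<zeta>'M \<zeta>'0 M1 in auto)
    then show ?thesis unfolding \<delta>_def by (simp add: mult_ac)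
  qed
  define X' where "X' = \<phi> * (1 - \<phi>) - 2 ^ 18 * ((real \<rho>)\<^sup>2 / (real n - 1)\<^sup>2) * (real D + 1) ^ 44 * (M / (1 - M))"
  have risk_ge: "lam\<^sup>2 * ((real n - 1) / real n) * X' \<le> seriation_risk n \<rho> lam F"
    if F: "F \<in> {F. \<forall>k\<in>idx n. F k \<in> mpolys_le D (idx n)}" for F
  proof -
    let ?r = "\<lambda>k. (\<Sum>p\<in>P. \<integral>E. (eval_mpoly (F k) (\<lambda>v. signal \<rho> lam p v + E v) - signal \<rho> lam p k)\<^sup>2
       \<partial>PiM (idx n) (\<lambda>_. std_gauss)) / real (card P)"
    have r_nonneg: "?r k \<ge> 0" for k by (intro divide_nonneg_nonneg sum_nonneg) auto
    have r_ge: "?r k \<ge> X" if k: "k \<in> {k \<in> idx n. fst k \<noteq> snd k}" for k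
    proof -
      obtain i j where ij: "k = (i, j)" "i \<in> {1..n}" "j \<in> {1..n}" "i \<noteq> j"
        using k by (auto simp: idx_def)
      show ?thesis
        unfolding X_def \<delta>_def \<zeta>'_def P_def assms(4) ij(1)
        by (rule entry_risk_ge[OF ij(2-4) \<rho> _ _ assms(5)])
          (use assms(3,7) F k ij \<open>\<zeta>' \<le> \<zeta>\<close> in \<open>auto simp: \<zeta>'_def\<close>)
    qed
    have "X' \<le> \<phi> * (1 - \<phi>) - \<delta>" using \<delta>_le by (simp add: X'_def)
    then have "lam\<^sup>2 * ((real n - 1) / real n) * X' \<le> lam\<^sup>2 * ((real n - 1) / real n) * (\<phi> * (1 - \<phi>) - \<delta>)"
      using n by (intro mult_left_mono) auto
    also have "\<dots> = 1 / (real n)\<^sup>2 * (real n * (real n - 1) * X)"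
      using n by (simp add: X_def power2_eq_square field_simps)
    also have "\<dots> = 1 / (real n)\<^sup>2 * (\<Sum>k\<in>{k \<in> idx n. fst k \<noteq> snd k}. X)"
      by (simp add: card_off_diagonal)
    also have "\<dots> \<le> 1 / (real n)\<^sup>2 * (\<Sum>k\<in>{k \<in> idx n. fst k \<noteq> snd k}. ?r k)"
      by (intro mult_left_mono sum_mono r_ge) auto
    \<comment> \<open>Diagonal entries are bounded below by 0; the \<open>n * (n - 1)\<close> others
      yield the factor (n - 1) / n.\<close>
    also have "\<dots> \<le> 1 / (real n)\<^sup>2 * (\<Sum>k\<in>idx n. ?r k)"
      by (intro mult_left_mono sum_mono2 r_nonneg) (auto simp: idx_def)
    also have "\<dots> = seriation_risk n \<rho> lam F"
      unfolding P_def by (rule seriation_risk_eq[symmetric]) (use F in auto)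
    finally show ?thesis .
  qed
  \<comment> \<open>The infimum is a conditional one, so an admissible estimator is needed: the zero
    polynomials.\<close>
  have nonempty: "{F :: nat \<times> nat \<Rightarrow> (nat \<times> nat) real_mpoly. \<forall>k\<in>idx n. F k \<in> mpolys_le D (idx n)} \<noteq> {}"
    unfolding ex_in_conv[symmetric] by (rule exI[of _ "\<lambda>_. 0"]) (simp add: mpolys_le_def)
  show ?thesis
    unfolding MMSE_le_def M_def[symmetric] X'_def[symmetric]
    by (rule cINF_greatest[OF nonempty risk_ge])
qed

end
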